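(* For any weight $\mathbf{w}\in\mathcal{W}_d$ and any compactly supported Ahlfors regular absolutely decaying measure $\mu$ on $\mathbb{R}^d$ we have that \[ \mathbf{Bad}(\mathbf{w})\cap \operatorname{supp}\mu\neq\varnothing\,. \]
   Context: Let $d\in\mathbb{N}$ and let $\mathcal{W}_d=\{\mathbf{w}=(w_1,\dots,w_d)\in\mathbb{R}^d : w_1,\ldots,w_d\geq0,\ w_1+\ldots+w_d=1\}$ be the set of $d$-dimensional weights. For $\mathbf{w}\in\mathcal{W}_d$, a vector $\mathbf{x}=(x_1,\dots,x_d)\in\mathbb{R}^d$ is badly approximable with respect to $\mathbf{w}$ if there exists $c>0$ such that for every $q\in\mathbb{N}$ and $\mathbf{p}=(p_1,\dots,p_d)\in\mathbb{Z}^d$ there exists $1\le i\le d$ with $|x_i-p_i/q|\geq c/q^{1+w_i}$; $\mathbf{Bad}(\mathbf{w})$ denotes the set of such vectors. A Borel measure $\mu$ on $\mathbb{R}^d$ is $\alpha$-Ahlfors regular ($\alpha>0$) if there exist $A,\rho_0>0$ such that for every $\mathbf{x}\in\operatorname{supp}\mu$ and all $0<r\le\rho_0$, $A^{-1}r^{\alpha}\le\mu(B(\mathbf{x},r))\le Ar^{\alpha}$; it is Ahlfors regular if it is $\alpha$-Ahlfors regular for some $\alpha>0$. A Borel measure $\mu$ on $\mathbb{R}^d$ is absolutely decaying if there exist $D,\delta>0$ and $r_0>0$ such that for every $\mathbf{x}\in\operatorname{supp}\mu$, $0<r\le r_0$, every hyperplane $H\subseteq\mathbb{R}^d$ and every $r'>0$,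 $\mu(B(H,r')\cap B(\mathbf{x},r))\le D(r'/r)^{\delta}\mu(B(\mathbf{x},r))$, where $B(H,r')$ is the closed $r'$-neighborhood of $H$ and $B(\mathbf{x},r)$ the closed Euclidean ball. *)

theory Defs
  imports "HOL-Analysis.Analysis"
begin

definition weights :: "(real ^ 'd) set" where
  "weights = {w. (\<forall>i. 0 \<le> w $ i) \<and> (\<Sum>i\<in>UNIV. w $ i) = 1}"

text \<open>Denominators range over the positive integers, whence the guard on \<open>q\<close>.\<close>

definition Bad :: "real ^ 'd \<Rightarrow> (real ^ 'd) set" where
  "Bad w = {x. \<exists>c>0. \<forall>q::nat. \<forall>p :: int ^ 'd. q > 0 \<longrightarrow>
     (\<exists>i. \<bar>x $ i - of_int (p $ i) / of_nat q\<bar> \<ge> c / of_nat q powr (1 + w $ i))}"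

definition measure_support :: "'a::topological_space measure \<Rightarrow> 'a set" where
  "measure_support \<mu> = {x. \<forall>U. open U \<and> x \<in> U \<longrightarrow> emeasure \<mu> U > 0}"

definition alpha_Ahlfors_regular :: "real \<Rightarrow> 'a::metric_space measure \<Rightarrow> bool" where
  "alpha_Ahlfors_regular \<alpha> \<mu> \<longleftrightarrow>
     (\<exists>A>0. \<exists>\<rho>\<^sub>0>0. \<forall>x\<in>measure_support \<mu>. \<forall>r. 0 < r \<and> r \<le> \<rho>\<^sub>0 \<longrightarrow>
        ennreal (inverse A * r powr \<alpha>) \<le> emeasure \<mu> (cball x r) \<and>
        emeasure \<mu> (cball x r) \<le> ennreal (A * r powr \<alpha>))"

definition Ahlfors_regular :: "'a::metric_space measure \<Rightarrow> bool" where
  "Ahlfors_regular \<mu> \<longleftrightarrow> (\<exists>\<alpha>>0. alpha_Ahlfors_regular \<alpha> \<mu>)"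

definition hyperplane :: "'a::euclidean_space set \<Rightarrow> bool" where
  "hyperplane H \<longleftrightarrow> (\<exists>a b. a \<noteq> 0 \<and> H = {x. a \<bullet> x = b})"

text \<open>For nonempty \<open>S\<close> only: \<^const>\<open>infdist\<close> to the empty set is \<open>0\<close>.\<close>

definition closed_nbhd :: "'a::metric_space set \<Rightarrow> real \<Rightarrow> 'a set" where
  "closed_nbhd S r = {x. infdist x S \<le> r}"

definition absolutely_decaying :: "'a::euclidean_space measure \<Rightarrow> bool" where
  "absolutely_decaying \<mu> \<longleftrightarrow>
     (\<exists>D>0. \<exists>\<delta>>0. \<exists>r\<^sub>0>0. \<forall>x\<in>measure_support \<mu>. \<forall>r. 0 < r \<and> r \<le> r\<^sub>0 \<longrightarrow>
        (\<forall>H. hyperplane H \<longrightarrow> (\<forall>r'>0.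
           emeasure \<mu> (closed_nbhd H r' \<inter> cball x r)
             \<le> ennreal (D * (r' / r) powr \<delta>) * emeasure \<mu> (cball x r))))"

end

theory Submission
  imports Defs "HOL-Library.Countable"
begin

text \<open>By Dani's correspondence, \<open>x\<close> is badly approximable iff the lattice spanned by the integer vectors,
  sheared by \<open>x\<close>, has no short vectors along a diagonal flow, and all integral subspaces (decomposable
  integer multivectors) have to be controlled simultaneously. The point is found by descending through
  balls centred in the support: a ball of radius \<open>exp (- (1 + w\<^sub>\<iota>) * t)\<close>, \<open>w\<^sub>\<iota>\<close> the maximal weight, goes with
  time \<open>t\<close> of the flow. As coordinates of smaller weight expand more slowly than balls shrink, a subspace may
  contract under the flow on the whole ball. The remedy is a second flow with parameter \<open>s\<close> fixing the
  coordinate of maximal weight, and a potential summing over all \<open>s\<close>, exponentially discounted: a Pluecker type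
  inequality shows that the size of a subspace at \<open>(t + \<Delta>, s)\<close> dominates, by a definite factor, its size at
  \<open>(t, s + h)\<close> for one of two values \<open>h\<close> close to \<open>\<Delta>\<close>. Submodularity of covolumes leaves only one dangerous
  subspace for each rank and each \<open>s\<close>, and absolute decay makes the potential decrease on average over the ball.
  Hence some smaller ball inherits the bound on the potential, and the limit point is badly approximable.\<close>

subsection \<open>Multivectors in coordinates\<close>

text \<open>Sizes are measured somewhere on the ball and not at its centre: at a rational centre
  some integral vector may shrink to 0 as s grows, whereas on a ball of fixed radius the integral
  multivectors have a lower bound uniform in s. All s must enter the potential because the Pluecker
  inequality refers a parameter only to larger ones. The discount keeps the sum finite, and has to
  be so slow that a shift by about \<Delta> costs at most half of the exponent gained. The
  normalizing size in rank j is a power of a small number with exponent j(m+1-j). Strict concavity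
  of this exponent turns submodularity into uniqueness of the dangerous subspace, and uniqueness
  leaves a single affine function per rank and parameter whose zeros have to be avoided; infinitely
  many of them could not be averaged. Subspaces that are not dangerous lose only a bounded factor,
  and the threshold of danger lies so far above the normalizing size that they contribute a small
  constant. The potential after a step is thus on average at most a small constant plus a small
  multiple of the old one.\<close>

text \<open>A multivector is the family of its coordinates, indexed by sets of basis vectors; the order that
  determines the signs is the one of \<open>to_nat\<close>. Left multiplication by a vector is \<open>ext\<close>, and
  \<open>con\<close> is its adjoint.\<close>

definition sg :: "'i::finite \<Rightarrow> 'i set \<Rightarrow> real" where
  "sg k K = (- 1) ^ card {l \<in> K. to_nat l < to_nat k}"

definition ext :: "real ^ 'i \<Rightarrow> real ^ ('i::finite set) \<Rightarrow> real ^ ('i set)" where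
  "ext b \<omega> = (\<chi> K. \<Sum>k\<in>K. sg k K * b $ k * \<omega> $ (K - {k}))"

definition con :: "real ^ 'i \<Rightarrow> real ^ ('i::finite set) \<Rightarrow> real ^ ('i set)" where
  "con b \<omega> = (\<chi> K. \<Sum>k\<in>-K. sg k K * b $ k * \<omega> $ (insert k K))"

definition wedge :: "(real ^ 'i) list \<Rightarrow> real ^ ('i::finite set)" where
  "wedge bs = foldr ext bs (axis {} 1)"

lemma wedge_Nil: "wedge [] = axis {} 1"
  and wedge_Cons: "wedge (b # bs) = ext b (wedge bs)"
  by (simp_all add: wedge_def)

lemma sg_sq: "sg k K * sg k K = 1"
  by (simp add: sg_def flip: power_add mult_2)

lemma sg_pm: "sg k K = 1 \<or> sg k K = - 1"
  by (cases "even (card {l \<in> K. to_nat l < to_nat k})") (auto simp: sg_def)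

lemma sg_self_insert [simp]: "sg k (insert k K) = sg k K"
  unfolding sg_def by (rule arg_cong[where f = "\<lambda>S. (-1) ^ card S"]) auto

lemma sg_self_remove [simp]: "sg k (K - {k}) = sg k K"
  unfolding sg_def by (rule arg_cong[where f = "\<lambda>S. (-1) ^ card S"]) auto

lemma sg_insert:
  assumes "k \<notin> K"
  shows "sg l (insert k K) = (if to_nat k < to_nat l then - sg l K else sg l K)"
proof -
  have "{i \<in> insert k K. to_nat i < to_nat l} =
    (if to_nat k < to_nat l then insert k {i \<in> K. to_nat i < to_nat l} else {i \<in> K. to_nat i < to_nat l})"
    by auto
  moreover have "k \<notin> {i \<in> K. to_nat i < to_nat l}" using assms by simp
  ultimately show ?thesis unfolding sg_def by (simp del: mem_Collect_eq)
qed

text \<open>Exactly one of \<open>k\<close> and \<open>l\<close> precedes the other, so inserting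
  each before looking at the other flips exactly one of the signs. All anticommutation below comes
  from this.\<close>

lemma sg_swap:
  assumes "k \<notin> K" "l \<notin> K" "k \<noteq> l"
  shows "sg k (insert l K) * sg l K = - (sg l (insert k K) * sg k K)"
proof -
  have "to_nat k \<noteq> to_nat l" using assms(3) by simp
  then show ?thesis
    using assms by (auto simp: sg_insert algebra_simps)
qed

lemma ext_linear: "linear (ext b)"
  by (rule linearI)
    (simp_all add: ext_def vec_eq_iff algebra_simps sum.distrib sum_distrib_left)

lemma ext_linear_left: "linear (\<lambda>b. ext b \<omega>)"
  by (rule linearI)
    (simp_all add: ext_def vec_eq_iff algebra_simps sum.distrib sum_distrib_left)

lemma con_linear: "linear (con b)"
  by (rule linearI)
    (simp_all add: con_def vec_eq_iff algebra_simps sum.distrib sum_distrib_left)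

lemma ext_anticommute: "ext b (ext c \<omega>) = - ext c (ext b \<omega>)"
proof -
  have "ext b (ext c \<omega>) $ K = - ext c (ext b \<omega>) $ K" for K
  proof -
    let ?F = "\<lambda>b c k l. sg k K * sg l (K - {k}) * b $ k * c $ l * \<omega> $ (K - {k} - {l})"
    let ?P = "{(k, l). k \<in> K \<and> l \<in> K \<and> k \<noteq> l}"
    have E: "ext b (ext c \<omega>) $ K = (\<Sum>(k, l)\<in>?P. ?F b c k l)" for b c
    proof -
      have "ext b (ext c \<omega>) $ K = (\<Sum>k\<in>K. \<Sum>l\<in>K - {k}. ?F b c k l)"
        by (simp add: ext_def sum_distrib_left algebra_simps)
      also have "\<dots> = (\<Sum>(k, l)\<in>Sigma K (\<lambda>k. K - {k}). ?F b c k l)"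
        by (rule sum.Sigma) auto
      also have "Sigma K (\<lambda>k. K - {k}) = ?P" by auto
      finally show ?thesis .
    qed
    have "(\<Sum>(k, l)\<in>?P. ?F b c k l) = (\<Sum>(k, l)\<in>?P. - ?F c b k l)"
    proof (rule sum.reindex_bij_witness[where i = prod.swap and j = prod.swap], goal_cases)
      case (5 p)
      obtain k l where p: "p = (k, l)" "k \<in> K" "l \<in> K" "k \<noteq> l" using 5 by auto
      have K: "insert k (insert l (K - {k} - {l})) = K" using p by auto
      have "sg k (insert l (K - {k} - {l})) * sg l (K - {k} - {l})
          = - (sg l (insert k (K - {k} - {l})) * sg k (K - {k} - {l}))"
        by (rule sg_swap) (use p in auto)
      moreover have "insert l (K - {k} - {l}) = K - {k}" "insert k (K - {k} - {l}) = K - {l}"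
        using p by auto
      moreover have "sg l (K - {k} - {l}) = sg l (K - {k})" by simp
      moreover have "sg k (K - {k} - {l}) = sg k (K - {l})"
        by (metis Diff_insert Diff_insert2 sg_self_remove)
      ultimately have s: "sg k K * sg l (K - {k}) = - (sg l K * sg k (K - {l}))"
        by simp
      have e: "K - {k} - {l} = K - {l} - {k}" by auto
      have "?F b c k l = (sg k K * sg l (K - {k})) * (b $ k * c $ l * \<omega> $ (K - {k} - {l}))"
        by (simp only: ac_simps)
      also have "\<dots> = - ?F c b l k" unfolding s e by simp
      finally show ?case by (simp add: p)
    qed auto
    then show ?thesis unfolding vector_uminus_component E
      by (simp add: split_def sum_negf)
  qed
  then show ?thesis by (simp add: vec_eq_iff)
qed

lemma ext_same [simp]: "ext b (ext b \<omega>) = 0"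
  using ext_anticommute[of b b \<omega>] by (auto simp: vec_eq_iff)

lemma sum_split_factor:
  fixes s c b w :: real
  shows "s * c * (s * b * w + (\<Sum>l\<in>K. g l * b' l * h l))
    = (s * s) * (b * c * w) + (\<Sum>l\<in>K. s * g l * c * b' l * h l)"
  by (simp only: distrib_left sum_distrib_left mult_ac)

text \<open>The canonical anticommutation relation between exterior and interior multiplication.
  Terms that remove and insert the same index add up to the inner product; the others cancel by
  \<open>sg_swap\<close>. The metric properties of \<open>ext\<close> follow from it.\<close>

lemma con_ext: "con c (ext b \<omega>) = (b \<bullet> c) *\<^sub>R \<omega> - ext b (con c \<omega>)"
proof -
  have "con c (ext b \<omega>) $ K + ext b (con c \<omega>) $ K = (b \<bullet> c) * \<omega> $ K" for K
  proof -
    have 1: "con c (ext b \<omega>) $ K = (\<Sum>k\<in>-K. b $ k * c $ k * \<omega> $ K)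
      + (\<Sum>k\<in>-K. \<Sum>l\<in>K. sg k K * sg l (insert k K) * c $ k * b $ l * \<omega> $ (insert k (K - {l})))"
    proof -
      have "con c (ext b \<omega>) $ K = (\<Sum>k\<in>-K. sg k K * c $ k *
          (\<Sum>l\<in>insert k K. sg l (insert k K) * b $ l * \<omega> $ (insert k K - {l})))"
        by (simp add: con_def ext_def)
      also have "\<dots> = (\<Sum>k\<in>-K. b $ k * c $ k * \<omega> $ K + (\<Sum>l\<in>K.
          sg k K * sg l (insert k K) * c $ k * b $ l * \<omega> $ (insert k (K - {l}))))"
      proof (rule sum.cong[OF refl])
        fix k assume k: "k \<in> - K"
        have "(\<Sum>l\<in>K. sg l (insert k K) * b $ l * \<omega> $ (insert k K - {l}))
          = (\<Sum>l\<in>K. sg l (insert k K) * b $ l * \<omega> $ (insert k (K - {l})))"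
        proof (rule sum.cong[OF refl])
          fix l assume "l \<in> K"
          then have "insert k K - {l} = insert k (K - {l})" using k by auto
          then show "sg l (insert k K) * b $ l * \<omega> $ (insert k K - {l})
            = sg l (insert k K) * b $ l * \<omega> $ (insert k (K - {l}))" by simp
        qed
        note 1 = this
        have 2: "insert k K - {k} = K" using k by auto
        have "sg k K * c $ k * (\<Sum>l\<in>insert k K. sg l (insert k K) * b $ l * \<omega> $ (insert k K - {l}))
          = sg k K * c $ k * (sg k K * b $ k * \<omega> $ K
            + (\<Sum>l\<in>K. sg l (insert k K) * b $ l * \<omega> $ (insert k (K - {l}))))"
          using k by (simp add: 1 2)
        also have "\<dots> = (sg k K * sg k K) * (b $ k * c $ k * \<omega> $ K) + (\<Sum>l\<in>K.
            sg k K * sg l (insert k K) * c $ k * b $ l * \<omega> $ (insert k (K - {l})))"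
          by (rule sum_split_factor)
        finally show "sg k K * c $ k * (\<Sum>l\<in>insert k K. sg l (insert k K) * b $ l * \<omega> $ (insert k K - {l}))
          = b $ k * c $ k * \<omega> $ K + (\<Sum>l\<in>K.
          sg k K * sg l (insert k K) * c $ k * b $ l * \<omega> $ (insert k (K - {l})))"
          by (simp add: sg_sq)
      qed
      finally show ?thesis by (simp add: sum.distrib)
    qed
    have 2: "ext b (con c \<omega>) $ K = (\<Sum>l\<in>K. b $ l * c $ l * \<omega> $ K)
      + (\<Sum>l\<in>K. \<Sum>k\<in>-K. sg l K * sg k (K - {l}) * b $ l * c $ k * \<omega> $ (insert k (K - {l})))"
    proof -
      have "ext b (con c \<omega>) $ K = (\<Sum>l\<in>K. sg l K * b $ l *
          (\<Sum>k\<in>-(K - {l}). sg k (K - {l}) * c $ k * \<omega> $ (insert k (K - {l}))))"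
        by (simp add: con_def ext_def)
      also have "\<dots> = (\<Sum>l\<in>K. b $ l * c $ l * \<omega> $ K + (\<Sum>k\<in>-K.
          sg l K * sg k (K - {l}) * b $ l * c $ k * \<omega> $ (insert k (K - {l}))))"
      proof (rule sum.cong[OF refl])
        fix l assume l: "l \<in> K"
        have 1: "- (K - {l}) = insert l (- K)" using l by auto
        have 2: "insert l (K - {l}) = K" using l by auto
        have "sg l K * b $ l * (\<Sum>k\<in>-(K - {l}). sg k (K - {l}) * c $ k * \<omega> $ (insert k (K - {l})))
          = sg l K * b $ l * (sg l K * c $ l * \<omega> $ K
            + (\<Sum>k\<in>-K. sg k (K - {l}) * c $ k * \<omega> $ (insert k (K - {l}))))"
          using l unfolding 1 by (subst sum.insert) (auto simp: 2 insert_absorb)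
        also have "\<dots> = (sg l K * sg l K) * (c $ l * b $ l * \<omega> $ K) + (\<Sum>k\<in>-K.
          sg l K * sg k (K - {l}) * b $ l * c $ k * \<omega> $ (insert k (K - {l})))"
          by (rule sum_split_factor)
        finally show "sg l K * b $ l * (\<Sum>k\<in>-(K - {l}). sg k (K - {l}) * c $ k * \<omega> $ (insert k (K - {l})))
          = b $ l * c $ l * \<omega> $ K + (\<Sum>k\<in>-K.
          sg l K * sg k (K - {l}) * b $ l * c $ k * \<omega> $ (insert k (K - {l})))"
          by (simp add: sg_sq mult.commute)
      qed
      finally show ?thesis by (simp add: sum.distrib)
    qed
    have 3: "(\<Sum>l\<in>K. \<Sum>k\<in>-K. sg l K * sg k (K - {l}) * b $ l * c $ k * \<omega> $ (insert k (K - {l})))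
      = - (\<Sum>k\<in>-K. \<Sum>l\<in>K. sg k K * sg l (insert k K) * c $ k * b $ l * \<omega> $ (insert k (K - {l})))"
      unfolding sum_negf[symmetric]
    proof (subst sum.swap, intro sum.cong[OF refl])
      fix k l assume kl: "k \<in> - K" "l \<in> K"
      have "sg k (insert l (K - {l})) * sg l (K - {l}) = - (sg l (insert k (K - {l})) * sg k (K - {l}))"
        by (rule sg_swap) (use kl in auto)
      moreover have "insert l (K - {l}) = K" using kl by auto
      moreover have "sg l (insert k (K - {l})) = sg l (insert k K)"
      proof -
        have "insert k (K - {l}) = insert k K - {l}" using kl by auto
        then show ?thesis by simp
      qed
      ultimately have s: "sg k K * sg l K = - (sg l (insert k K) * sg k (K - {l}))" by simp
      have "sg l K * sg k (K - {l}) = - (sg k K * sg l (insert k K))"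
        using s sg_pm[of k K] sg_pm[of l K] sg_pm[of k "K - {l}"] sg_pm[of l "insert k K"] by auto
      then show "sg l K * sg k (K - {l}) * b $ l * c $ k * \<omega> $ insert k (K - {l}) =
        - (sg k K * sg l (insert k K) * c $ k * b $ l * \<omega> $ insert k (K - {l}))" by simp
    qed
    have 4: "(b \<bullet> c) * \<omega> $ K = (\<Sum>k\<in>-K. b $ k * c $ k * \<omega> $ K) + (\<Sum>l\<in>K. b $ l * c $ l * \<omega> $ K)"
    proof -
      have "(b \<bullet> c) * \<omega> $ K = (\<Sum>k\<in>UNIV. b $ k * c $ k * \<omega> $ K)"
        by (simp add: inner_vec_def sum_distrib_right)
      also have "UNIV = -K \<union> K" by auto
      finally show ?thesis by (subst (asm) sum.union_disjoint) auto
    qed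
    show ?thesis unfolding 1 2 3 4 by simp
  qed
  then show ?thesis by (simp add: vec_eq_iff eq_diff_eq)
qed

lemma inner_ext: "ext b \<omega> \<bullet> \<eta> = \<omega> \<bullet> con b \<eta>"
proof -
  have "ext b \<omega> \<bullet> \<eta> = (\<Sum>(K, k)\<in>Sigma UNIV (\<lambda>K. K). sg k K * b $ k * \<omega> $ (K - {k}) * \<eta> $ K)"
    by (subst sum.Sigma[symmetric]) (auto simp: inner_vec_def ext_def sum_distrib_right)
  also have "\<dots> = (\<Sum>(K, k)\<in>Sigma UNIV (\<lambda>K. - K). sg k K * b $ k * \<omega> $ K * \<eta> $ (insert k K))"
    by (rule sum.reindex_bij_witness[where i = "\<lambda>(K, k). (insert k K, k)" and j = "\<lambda>(K, k). (K - {k}, k)"])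
      (auto simp: insert_absorb)
  also have "\<dots> = \<omega> \<bullet> con b \<eta>"
    by (subst sum.Sigma[symmetric]) (auto simp: inner_vec_def con_def sum_distrib_left algebra_simps)
  finally show ?thesis .
qed

text \<open>Pythagoras: \<open>con b \<omega>\<close> measures the share of \<omega> that already
  contains the direction of \<open>b\<close>, which is lost in the product.\<close>

lemma norm_ext_sq: "(norm (ext b \<omega>))\<^sup>2 = (norm b)\<^sup>2 * (norm \<omega>)\<^sup>2 - (norm (con b \<omega>))\<^sup>2"
proof -
  have "ext b \<omega> \<bullet> ext b \<omega> = \<omega> \<bullet> con b (ext b \<omega>)" by (rule inner_ext)
  also have "\<dots> = (b \<bullet> b) * (\<omega> \<bullet> \<omega>) - ext b (con b \<omega>) \<bullet> \<omega>"
    by (simp add: con_ext inner_diff_right inner_commute)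
  also have "ext b (con b \<omega>) \<bullet> \<omega> = con b \<omega> \<bullet> con b \<omega>" by (rule inner_ext)
  finally show ?thesis by (simp add: power2_norm_eq_inner)
qed

lemma norm_ext_le: "norm (ext b \<omega>) \<le> norm b * norm \<omega>"
proof (rule power2_le_imp_le)
  show "(norm (ext b \<omega>))\<^sup>2 \<le> (norm b * norm \<omega>)\<^sup>2"
    using norm_ext_sq[of b \<omega>] by (simp add: power_mult_distrib)
qed simp

section \<open>Decomposable multivectors, distances to spans and submodularity\<close>

lemma con_wedge_orthogonal:
  assumes "\<And>a. a \<in> set as \<Longrightarrow> a \<bullet> b = 0"
  shows "con b (wedge as) = 0"
  using assms
proof (induction as)
  case Nil
  show ?case by (auto simp: wedge_Nil con_def vec_eq_iff axis_def)
next
  case (Cons a as)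
  then show ?case by (simp add: wedge_Cons con_ext linear_0[OF ext_linear])
qed

lemma ext_wedge_span:
  assumes "b \<in> span (set as)"
  shows "ext b (wedge as) = 0"
proof -
  have mem: "ext a (wedge as) = 0" if "a \<in> set as" for a
    using that
  proof (induction as)
    case (Cons c as)
    show ?case
    proof (cases "a = c")
      case False
      with Cons have "ext a (wedge as) = 0" by simp
      then show ?thesis
        by (subst wedge_Cons, subst ext_anticommute) (simp add: linear_0[OF ext_linear])
    qed (simp add: wedge_Cons)
  qed simp
  have "subspace {b. ext b (wedge as) = 0}"
    by (auto simp: subspace_def linear_add[OF ext_linear_left] linear_cmul[OF ext_linear_left]
        linear_0[OF ext_linear_left])
  then have "span (set as) \<subseteq> {b. ext b (wedge as) = 0}"
    by (intro span_minimal) (auto simp: mem)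
  with assms show ?thesis by auto
qed

text \<open>The norm of \<open>ext b (wedge as)\<close> is the distance from \<open>b\<close> to the span of \<open>as\<close>, times the norm
  of \<open>wedge as\<close>.\<close>

lemma orthogonal_part:
  obtains b' where "b - b' \<in> span (set as)" "\<And>a. a \<in> span (set as) \<Longrightarrow> a \<bullet> b' = 0"
    "norm (ext b (wedge as)) = norm b' * norm (wedge as)"
proof -
  obtain y z where yz: "y \<in> span (set as)" "\<And>w. w \<in> span (set as) \<Longrightarrow> orthogonal z w" "b = y + z"
    by (rule orthogonal_subspace_decomp_exists[of "set as" b]) blast
  have o: "a \<bullet> z = 0" if "a \<in> span (set as)" for a
    using yz(2)[OF that] by (simp add: orthogonal_def inner_commute)
  have "con z (wedge as) = 0" by (rule con_wedge_orthogonal) (simp add: o span_base)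
  then have "(norm (ext z (wedge as)))\<^sup>2 = (norm z * norm (wedge as))\<^sup>2"
    using norm_ext_sq[of z "wedge as"] by (simp add: power_mult_distrib)
  then have "norm (ext z (wedge as)) = norm z * norm (wedge as)"
    by (rule power2_eq_imp_eq) simp_all
  moreover have "ext b (wedge as) = ext z (wedge as)"
  proof -
    have "ext (y + z) (wedge as) = ext y (wedge as) + ext z (wedge as)"
      by (rule linear_add[OF ext_linear_left])
    also have "ext y (wedge as) = 0" using yz(1) by (rule ext_wedge_span)
    finally show ?thesis using yz(3) by simp
  qed
  moreover have "b - z \<in> span (set as)" using yz(1) yz(3) by simp
  ultimately show ?thesis using that[of z] o by (simp only:)
qed

lemma ext_wedge_eq_0_iff:
  assumes "wedge as \<noteq> 0"
  shows "ext b (wedge as) = 0 \<longleftrightarrow> b \<in> span (set as)"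
proof
  assume 0: "ext b (wedge as) = 0"
  obtain b' where b': "b - b' \<in> span (set as)" "norm (ext b (wedge as)) = norm b' * norm (wedge as)"
    by (rule orthogonal_part[of b as])
  then have "b' = 0" using 0 assms by simp
  then show "b \<in> span (set as)" using b' by simp
qed (rule ext_wedge_span)

text \<open>The distance from \<open>b\<close> to a larger span is smaller. The quotients of norms
  are multiplied out so that dependent lists are covered.\<close>

lemma norm_ext_wedge_mono:
  assumes "set as \<subseteq> span (set cs)"
  shows "norm (ext b (wedge cs)) * norm (wedge as) \<le> norm (ext b (wedge as)) * norm (wedge cs)"
proof -
  obtain b' where b': "b - b' \<in> span (set as)" "norm (ext b (wedge as)) = norm b' * norm (wedge as)"
    by (rule orthogonal_part[of b as])
  have "b - b' \<in> span (set cs)" 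
    using b'(1) span_minimal[OF assms subspace_span] by blast
  then have "ext b (wedge cs) = ext b' (wedge cs)"
    using ext_wedge_span[of "b - b'" cs] by (simp add: linear_diff[OF ext_linear_left])
  then have "norm (ext b (wedge cs)) \<le> norm b' * norm (wedge cs)" by (simp add: norm_ext_le)
  then have "norm (ext b (wedge cs)) * norm (wedge as) \<le> norm b' * norm (wedge cs) * norm (wedge as)"
    by (rule mult_right_mono) simp
  then show ?thesis unfolding b'(2) by (simp add: ac_simps)
qed

text \<open>When the vectors of \<open>bs\<close> are added one at a time, each of them enlarges the
  norm in the presence of \<open>cs\<close> by no larger a factor than in its absence. With
  \<open>as\<close> spanning the intersection of two subspaces this is the submodularity of
  covolumes.\<close>

lemma norm_wedge_submodular:
  "norm (wedge as) * norm (wedge (bs @ cs @ as)) \<le> norm (wedge (bs @ as)) * norm (wedge (cs @ as))"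
proof (induction bs)
  case (Cons b bs)
  let ?n = "\<lambda>xs. norm (wedge xs)"
  have e: "norm (ext b (wedge (bs @ cs @ as))) * ?n (bs @ as) \<le> norm (ext b (wedge (bs @ as))) * ?n (bs @ cs @ as)"
    by (rule norm_ext_wedge_mono) (auto intro: span_base)
  show ?case
  proof (cases "wedge (bs @ as) = 0")
    \<comment> \<open>Nothing can be cancelled here, but the induction hypothesis makes the
      left-hand side vanish.\<close>
    case True
    have *: "?n (bs @ cs @ as) * ?n as = 0"
      using Cons True mult_nonneg_nonneg[of "?n as" "?n (bs @ cs @ as)"]
      by (metis antisym mult.commute mult_zero_left norm_ge_zero norm_zero)
    have "norm (ext b (wedge (bs @ cs @ as))) * ?n as \<le> norm b * (?n (bs @ cs @ as) * ?n as)"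
      using mult_right_mono[OF norm_ext_le[of b "wedge (bs @ cs @ as)"], of "?n as"]
      by (simp add: mult.assoc)
    then have "norm (ext b (wedge (bs @ cs @ as))) * ?n as \<le> 0" unfolding * by simp
    then show ?thesis using True by (simp add: wedge_Cons mult.commute linear_0[OF ext_linear])
  next
    case False
    then have pos: "?n (bs @ as) > 0" by simp
    have "?n (bs @ as) * (?n as * norm (ext b (wedge (bs @ cs @ as))))
       = ?n as * (norm (ext b (wedge (bs @ cs @ as))) * ?n (bs @ as))" by simp
    also have "\<dots> \<le> ?n as * (norm (ext b (wedge (bs @ as))) * ?n (bs @ cs @ as))"
      by (intro mult_left_mono e) auto
    also have "\<dots> = norm (ext b (wedge (bs @ as))) * (?n as * ?n (bs @ cs @ as))" by simp
    also have "\<dots> \<le> norm (ext b (wedge (bs @ as))) * (?n (bs @ as) * ?n (cs @ as))"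
      by (intro mult_left_mono Cons) auto
    also have "\<dots> = ?n (bs @ as) * (norm (ext b (wedge (bs @ as))) * ?n (cs @ as))" by simp
    finally show ?thesis using pos by (simp add: wedge_Cons)
  qed
qed simp

section \<open>Products with basis vectors and a quadratic inequality\<close>

lemma ext_axis: "ext (axis k 1) \<omega> $ K = (if k \<in> K then sg k K * \<omega> $ (K - {k}) else 0)"
proof -
  have "ext (axis k 1) \<omega> $ K = (\<Sum>l\<in>K. if l = k then sg k K * \<omega> $ (K - {k}) else 0)"
    unfolding ext_def vec_lambda_beta by (rule sum.cong) (auto simp: axis_def)
  then show ?thesis by (simp add: sum.delta)
qed

lemma con_axis: "con (axis k 1) \<omega> $ K = (if k \<in> K then 0 else sg k K * \<omega> $ (insert k K))"
proof -
  have "con (axis k 1) \<omega> $ K = (\<Sum>l\<in>-K. if l = k then sg k K * \<omega> $ (insert k K) else 0)"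
    unfolding con_def vec_lambda_beta by (rule sum.cong) (auto simp: axis_def)
  then show ?thesis by (simp add: sum.delta)
qed

lemma norm_sq_sum: "(norm (\<omega> :: real ^ 'n))\<^sup>2 = (\<Sum>K\<in>UNIV. (\<omega> $ K)\<^sup>2)"
  unfolding power2_norm_eq_inner inner_vec_def by (simp add: power2_eq_square[symmetric])

text \<open>Multiplication by a basis vector kills the coordinates that contain it and moves the
  others, up to sign, to distinct places.\<close>

lemma norm_ext_axis_sq: "(norm (ext (axis k 1) \<omega>))\<^sup>2 = (\<Sum>K | k \<notin> K. (\<omega> $ K)\<^sup>2)"
proof -
  have "(norm (ext (axis k 1) \<omega>))\<^sup>2 = (\<Sum>K | k \<in> K. (sg k K * \<omega> $ (K - {k}))\<^sup>2)"
    unfolding norm_sq_sum by (rule sum.mono_neutral_cong_right) (auto simp: ext_axis)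
  also have "\<dots> = (\<Sum>K | k \<notin> K. (\<omega> $ K)\<^sup>2)"
    by (rule sum.reindex_bij_witness[where i = "insert k" and j = "\<lambda>K. K - {k}"])
      (auto simp: insert_absorb power_mult_distrib power2_eq_square sg_sq)
  finally show ?thesis .
qed

text \<open>The submodularity of the norm, applied to the lines spanned by two basis vectors, yields a
  quadratic inequality between coordinates that does not hold for indecomposable multivectors.\<close>

lemma wedge_pluecker:
  fixes bs :: "(real ^ 'i::finite) list"
  assumes kl: "k \<noteq> l" and \<omega>: "\<omega> = wedge bs"
  shows "(\<Sum>K | k \<notin> K \<and> l \<notin> K. (\<omega> $ K)\<^sup>2) * (\<Sum>K | k \<in> K \<and> l \<in> K. (\<omega> $ K)\<^sup>2)
    \<le> (\<Sum>K | k \<in> K \<and> l \<notin> K. (\<omega> $ K)\<^sup>2) * (\<Sum>K | k \<notin> K \<and> l \<in> K. (\<omega> $ K)\<^sup>2)"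
proof -
  let ?s = "\<lambda>P. \<Sum>K | P K. (\<omega> $ K)\<^sup>2"
  let ?nn = "?s (\<lambda>K. k \<notin> K \<and> l \<notin> K)" and ?yy = "?s (\<lambda>K. k \<in> K \<and> l \<in> K)"
  let ?yn = "?s (\<lambda>K. k \<in> K \<and> l \<notin> K)" and ?ny = "?s (\<lambda>K. k \<notin> K \<and> l \<in> K)"
  have split: "?s P = ?s (\<lambda>K. P K \<and> Q K) + ?s (\<lambda>K. P K \<and> \<not> Q K)" for P Q
  proof -
    have "{K. P K} = {K. P K \<and> Q K} \<union> {K. P K \<and> \<not> Q K}" by auto
    then show ?thesis by (simp, subst sum.union_disjoint) auto
  qed
  have a: "(norm (ext (axis k 1) \<omega>))\<^sup>2 = ?ny + ?nn"
    unfolding norm_ext_axis_sq by (rule split)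
  have b: "(norm (ext (axis l 1) \<omega>))\<^sup>2 = ?yn + ?nn"
    unfolding norm_ext_axis_sq split[of "\<lambda>K. l \<notin> K" "\<lambda>K. k \<in> K"] by (simp add: conj_commute)
  have c: "(norm \<omega>)\<^sup>2 = ?yy + ?yn + ?ny + ?nn"
    unfolding norm_sq_sum using split[of "\<lambda>_. True" "\<lambda>K. k \<in> K"] split[of "\<lambda>K. k \<in> K" "\<lambda>K. l \<in> K"]
      split[of "\<lambda>K. k \<notin> K" "\<lambda>K. l \<in> K"] by simp
  have d: "(norm (ext (axis k 1) (ext (axis l 1) \<omega>)))\<^sup>2 = ?nn"
  proof -
    have "(norm (ext (axis k 1) (ext (axis l 1) \<omega>)))\<^sup>2 = (\<Sum>K | k \<notin> K. (ext (axis l 1) \<omega> $ K)\<^sup>2)"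
      by (rule norm_ext_axis_sq)
    also have "\<dots> = (\<Sum>K | k \<notin> K \<and> l \<in> K. (sg l K * \<omega> $ (K - {l}))\<^sup>2)"
      by (rule sum.mono_neutral_cong_right) (auto simp: ext_axis)
    also have "\<dots> = ?nn"
      by (rule sum.reindex_bij_witness[where i = "insert l" and j = "\<lambda>K. K - {l}"])
        (use kl in \<open>auto simp: insert_absorb power_mult_distrib power2_eq_square sg_sq\<close>)
    finally show ?thesis .
  qed
  have "norm \<omega> * norm (ext (axis k 1) (ext (axis l 1) \<omega>))
      \<le> norm (ext (axis k 1) \<omega>) * norm (ext (axis l 1) \<omega>)"
    using norm_wedge_submodular[of bs "[axis k 1]" "[axis l 1]"] by (simp add: \<omega> wedge_Cons)
  then have "(norm \<omega> * norm (ext (axis k 1) (ext (axis l 1) \<omega>)))\<^sup>2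
      \<le> (norm (ext (axis k 1) \<omega>) * norm (ext (axis l 1) \<omega>))\<^sup>2"
    by (intro power_mono) auto
  \<comment> \<open>After expansion all terms but \<open>?yy * ?nn\<close> and
    \<open>?ny * ?yn\<close> occur on both sides.\<close>
  then have "(?yy + ?yn + ?ny + ?nn) * ?nn \<le> (?ny + ?nn) * (?yn + ?nn)"
    unfolding power_mult_distrib a b c d .
  then show ?thesis by (simp add: algebra_simps)
qed

subsection \<open>Integer multivectors\<close>

text \<open>One development serves both coefficient rings in use: the integers for lattices and the
  reals for subspaces.\<close>

definition subring :: "real set \<Rightarrow> bool" where
  "subring R \<longleftrightarrow> 1 \<in> R \<and> (\<forall>x\<in>R. \<forall>y\<in>R. x - y \<in> R \<and> x * y \<in> R)"

lemma subring_Ints: "subring \<int>" and subring_UNIV: "subring UNIV"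
  by (auto simp: subring_def)

lemma subringD:
  assumes "subring R"
  shows "0 \<in> R" "1 \<in> R" "x \<in> R \<Longrightarrow> - x \<in> R" "x \<in> R \<Longrightarrow> y \<in> R \<Longrightarrow> x + y \<in> R"
    "x \<in> R \<Longrightarrow> y \<in> R \<Longrightarrow> x - y \<in> R" "x \<in> R \<Longrightarrow> y \<in> R \<Longrightarrow> x * y \<in> R"
proof -
  have 1: "1 \<in> R" and d: "\<And>x y. x \<in> R \<Longrightarrow> y \<in> R \<Longrightarrow> x - y \<in> R"
    and m: "\<And>x y. x \<in> R \<Longrightarrow> y \<in> R \<Longrightarrow> x * y \<in> R"
    using assms by (auto simp: subring_def)
  have 0: "0 \<in> R" using d[OF 1 1] by simp
  have n: "- x \<in> R" if "x \<in> R" for x using d[OF 0 that] by simp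
  have p: "x + y \<in> R" if "x \<in> R" "y \<in> R" using d[OF that(1) n[OF that(2)]] by simp
  show "0 \<in> R" "1 \<in> R" "x \<in> R \<Longrightarrow> - x \<in> R" "x \<in> R \<Longrightarrow> y \<in> R \<Longrightarrow> x + y \<in> R"
    "x \<in> R \<Longrightarrow> y \<in> R \<Longrightarrow> x - y \<in> R" "x \<in> R \<Longrightarrow> y \<in> R \<Longrightarrow> x * y \<in> R"
    by (fact 0 1 n p d m)+
qed

section \<open>Exterior powers of finitely generated modules\<close>

primrec comb :: "real set \<Rightarrow> (real ^ 'i) list \<Rightarrow> (real ^ 'i) set" where
  "comb R [] = {0}"
| "comb R (b # bs) = {k *\<^sub>R b + z | k z. k \<in> R \<and> z \<in> comb R bs}"

lemma comb_UNIV: "comb UNIV bs = span (set bs)"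
proof (induction bs)
  case (Cons b bs)
  have "comb UNIV (b # bs) = {x. \<exists>k. x - k *\<^sub>R b \<in> span (set bs)}"
  proof (rule set_eqI)
    fix x
    have "x = k *\<^sub>R b + z \<longleftrightarrow> x - k *\<^sub>R b = z" for k z by (auto simp: algebra_simps)
    then show "x \<in> comb UNIV (b # bs) \<longleftrightarrow> x \<in> {x. \<exists>k. x - k *\<^sub>R b \<in> span (set bs)}"
      by (simp add: Cons)
  qed
  then show ?case by (simp add: span_insert)
qed simp

lemma comb_append: "comb R (as @ bs) = {x + y | x y. x \<in> comb R as \<and> y \<in> comb R bs}"
proof (induction as)
  case (Cons a as)
  show ?case
  proof (rule set_eqI, rule iffI)
    fix v assume "v \<in> comb R ((a # as) @ bs)"
    then obtain k x y where "v = k *\<^sub>R a + (x + y)" "k \<in> R" "x \<in> comb R as" "y \<in> comb R bs"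
      by (auto simp: Cons)
    moreover from this have "k *\<^sub>R a + x \<in> comb R (a # as)" by auto
    moreover have "k *\<^sub>R a + (x + y) = k *\<^sub>R a + x + y" by simp
    ultimately show "v \<in> {x + y | x y. x \<in> comb R (a # as) \<and> y \<in> comb R bs}"
      by blast
  next
    fix v assume "v \<in> {x + y | x y. x \<in> comb R (a # as) \<and> y \<in> comb R bs}"
    then obtain k x y where v: "v = (k *\<^sub>R a + x) + y" "k \<in> R" "x \<in> comb R as" "y \<in> comb R bs"
      by auto
    then have "v = k *\<^sub>R a + (x + y)" "x + y \<in> comb R (as @ bs)" by (auto simp: Cons)
    then show "v \<in> comb R ((a # as) @ bs)" using v(2) unfolding append_Cons comb.simps by blast
  qed
qed simp

lemma comb_map:
  assumes "linear T" "x \<in> comb R bs"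
  shows "T x \<in> comb R (map T bs)"
  using assms(2)
  by (induction bs arbitrary: x)
    (auto simp: linear_0[OF assms(1)] linear_add[OF assms(1)] linear_cmul[OF assms(1)], blast)

lemma comb_mono: "R \<subseteq> R' \<Longrightarrow> comb R bs \<subseteq> comb R' bs"
  by (induction bs) auto

text \<open>The \<open>n\<close>-th exterior power of the \<open>R\<close>-module generated by
  \<open>p\<close>, realized inside the real multivectors; over the integers it is in general not a
  real subspace.\<close>

inductive_set wedge_module :: "real set \<Rightarrow> (real ^ 'i) list \<Rightarrow> nat \<Rightarrow> (real ^ ('i::finite set)) set"
  for R :: "real set" and p :: "(real ^ 'i) list" and n :: nat where
  zero: "0 \<in> wedge_module R p n"
| step: "\<omega> \<in> wedge_module R p n \<Longrightarrow> k \<in> R \<Longrightarrow> length cs = n \<Longrightarrow> set cs \<subseteq> comb R p \<Longrightarrow>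
    k *\<^sub>R wedge cs + \<omega> \<in> wedge_module R p n"

lemma wedge_module_add:
  "\<omega> \<in> wedge_module R p n \<Longrightarrow> \<eta> \<in> wedge_module R p n \<Longrightarrow> \<omega> + \<eta> \<in> wedge_module R p n"
  by (induction rule: wedge_module.induct) (auto simp: add.assoc intro: wedge_module.intros)

lemma wedge_module_scale:
  assumes "subring R" "k \<in> R"
  shows "\<omega> \<in> wedge_module R p n \<Longrightarrow> k *\<^sub>R \<omega> \<in> wedge_module R p n"
proof (induction rule: wedge_module.induct)
  case (step \<omega> l cs)
  then have "(k * l) *\<^sub>R wedge cs + k *\<^sub>R \<omega> \<in> wedge_module R p n"
    using assms by (intro wedge_module.step) (auto simp: subringD)
  then show ?case by (simp add: scaleR_add_right)
qed (simp add: wedge_module.zero)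

lemma wedge_module_ext:
  assumes "c \<in> comb R p"
  shows "\<omega> \<in> wedge_module R p n \<Longrightarrow> ext c \<omega> \<in> wedge_module R p (Suc n)"
proof (induction rule: wedge_module.induct)
  case (step \<omega> l cs)
  then have "l *\<^sub>R wedge (c # cs) + ext c \<omega> \<in> wedge_module R p (Suc n)"
    using assms by (intro wedge_module.step) auto
  then show ?case
    by (simp add: wedge_Cons linear_add[OF ext_linear] linear_cmul[OF ext_linear])
qed (simp add: wedge_module.zero linear_0[OF ext_linear])

text \<open>If every factor is written as a multiple of \<open>b\<close> plus a combination of
  \<open>p\<close>, at most one \<open>b\<close> survives in each product. This removes one
  generator and so drives the induction in \<open>wedge_module_top\<close>. The alternative
  \<open>\<beta> = 0\<close> covers the empty product, which has no degree to give away.\<close>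

lemma wedge_comb_split:
  assumes R: "subring R" and "set cs \<subseteq> comb R (b # p)"
  shows "\<exists>\<alpha> \<beta>. wedge cs = \<alpha> + ext b \<beta> \<and> \<alpha> \<in> wedge_module R p (length cs) \<and>
    (\<beta> = 0 \<or> (\<exists>m. length cs = Suc m \<and> \<beta> \<in> wedge_module R p m))"
  using assms(2)
proof (induction cs)
  case Nil
  have "1 *\<^sub>R wedge [] + 0 \<in> wedge_module R p 0"
    using subringD(2)[OF R] by (intro wedge_module.intros) auto
  then show ?case by (intro exI[of _ "wedge []"] exI[of _ 0]) (simp add: linear_0[OF ext_linear])
next
  case (Cons c cs)
  then obtain \<alpha> \<beta> where ab: "wedge cs = \<alpha> + ext b \<beta>" "\<alpha> \<in> wedge_module R p (length cs)"
    "\<beta> = 0 \<or> (\<exists>m. length cs = Suc m \<and> \<beta> \<in> wedge_module R p m)" by auto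
  obtain k z where c: "c = k *\<^sub>R b + z" "k \<in> R" "z \<in> comb R p" using Cons(2) by auto
  have cb: "ext c (ext b \<beta>) = - ext b (ext z \<beta>)"
    unfolding c(1) by (subst ext_anticommute)
      (simp add: linear_add[OF ext_linear_left] linear_add[OF ext_linear] linear_cmul[OF ext_linear_left] linear_cmul[OF ext_linear])
  have "wedge (c # cs) = ext z \<alpha> + ext b (k *\<^sub>R \<alpha> + (- 1) *\<^sub>R ext z \<beta>)"
    unfolding wedge_Cons ab(1) linear_add[OF ext_linear] cb
    by (simp add: c(1) linear_add[OF ext_linear_left] linear_add[OF ext_linear] linear_diff[OF ext_linear]
        linear_cmul[OF ext_linear_left] linear_cmul[OF ext_linear] linear_neg[OF ext_linear])
  moreover have "ext z \<alpha> \<in> wedge_module R p (Suc (length cs))"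
    using c ab by (intro wedge_module_ext)
  moreover have "ext z \<beta> \<in> wedge_module R p (length cs)"
    using ab(3) wedge_module_ext[OF c(3)] by (auto simp: linear_0[OF ext_linear] wedge_module.zero)
  then have "k *\<^sub>R \<alpha> + (- 1) *\<^sub>R ext z \<beta> \<in> wedge_module R p (length cs)"
    using R c(2) ab(2) by (intro wedge_module_add wedge_module_scale) (auto simp: subringD)
  ultimately show ?case by (metis length_Cons)
qed

text \<open>The top exterior power has one generator and the higher ones vanish. This replaces
  determinants, and it records that the factor stays in the ring.\<close>

lemma wedge_module_top:
  assumes R: "subring R"
  shows "\<omega> \<in> wedge_module R p n \<Longrightarrow>
    (n = length p \<longrightarrow> (\<exists>k\<in>R. \<omega> = k *\<^sub>R wedge p)) \<and> (n > length p \<longrightarrow> \<omega> = 0)"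
proof (induction p arbitrary: \<omega> n)
  case Nil
  from Nil show ?case
  proof (induction rule: wedge_module.induct)
    case (step \<omega> k cs)
    have "wedge cs = 0" if n: "n > 0"
    proof -
      obtain c cs' where "cs = c # cs'" using n step(3) by (cases cs) auto
      then show ?thesis using step(4) by (simp add: wedge_Cons linear_0[OF ext_linear_left])
    qed
    moreover have "\<exists>k'\<in>R. k *\<^sub>R wedge [] + \<omega> = k' *\<^sub>R wedge []" if n: "n = 0"
    proof -
      obtain l where "l \<in> R" "\<omega> = l *\<^sub>R wedge []" using step(5) n by auto
      then show ?thesis using step(2) subringD(4)[OF R, of k l]
        by (intro bexI[of _ "k + l"]) (auto simp: scaleR_add_left)
    qed
    ultimately show ?case using step by auto
  qed (auto intro!: bexI[of _ 0] simp: subringD[OF R])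
next
  case (Cons b p)
  have gen: "(length cs = length (b # p) \<longrightarrow> (\<exists>k\<in>R. wedge cs = k *\<^sub>R wedge (b # p))) \<and>
      (length cs > length (b # p) \<longrightarrow> wedge cs = 0)" if cs: "set cs \<subseteq> comb R (b # p)" for cs
  proof -
    obtain \<alpha> \<beta> where ab: "wedge cs = \<alpha> + ext b \<beta>" "\<alpha> \<in> wedge_module R p (length cs)"
      "\<beta> = 0 \<or> (\<exists>m. length cs = Suc m \<and> \<beta> \<in> wedge_module R p m)"
      using wedge_comb_split[OF R cs] by blast
    have 1: "\<alpha> = 0" if "length cs > length p" using Cons.IH[OF ab(2)] that by auto
    have 2: "\<exists>k\<in>R. \<beta> = k *\<^sub>R wedge p" if "length cs = Suc (length p)"
    proof (cases "\<beta> = 0")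
      case True
      then show ?thesis by (intro bexI[of _ 0]) (auto simp: subringD[OF R])
    next
      case False
      then show ?thesis using ab(3) Cons.IH[of \<beta> "length p"] that by auto
    qed
    have 3: "\<beta> = 0" if "length cs > Suc (length p)"
      using ab(3) Cons.IH[of \<beta>] that by auto
    have "\<exists>k\<in>R. wedge cs = k *\<^sub>R wedge (b # p)" if "length cs = length (b # p)"
    proof -
      obtain k where "k \<in> R" "\<beta> = k *\<^sub>R wedge p" using 2 \<open>length cs = length (b # p)\<close> by auto
      then show ?thesis using 1 \<open>length cs = length (b # p)\<close> unfolding ab(1) wedge_Cons
        by (intro bexI[of _ k]) (simp_all add: linear_cmul[OF ext_linear])
    qed
    then show ?thesis using 1 3 unfolding ab(1) wedge_Cons by (auto simp: linear_0[OF ext_linear])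
  qed
  from Cons.prems show ?case
  proof (induction rule: wedge_module.induct)
    case zero
    show ?case by (auto intro!: bexI[of _ 0] simp: subringD[OF R])
  next
    case (step \<omega> k cs)
    have "\<exists>k'\<in>R. k *\<^sub>R wedge cs + \<omega> = k' *\<^sub>R wedge (b # p)" if n: "n = length (b # p)"
    proof -
      obtain l where l: "l \<in> R" "wedge cs = l *\<^sub>R wedge (b # p)" using gen[OF step(4)] step(3) n by auto
      obtain m where m: "m \<in> R" "\<omega> = m *\<^sub>R wedge (b # p)" using step(5) n by auto
      have "k * l + m \<in> R" using l m step(2) by (simp add: subringD[OF R])
      then show ?thesis unfolding l(2) m(2)
        by (intro bexI[of _ "k * l + m"]) (simp_all add: scaleR_add_left)
    qed
    then show ?case using gen[OF step(4)] step(3,5) by auto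
  qed
qed

text \<open>\<open>k\<close> is the determinant of the matrix of coefficients. Over the integers a
  nonzero \<open>k\<close> has absolute value at least 1, so passing to a sublattice does not
  decrease the covolume.\<close>

lemma wedge_comb:
  assumes "subring R" "length cs = length p" "set cs \<subseteq> comb R p"
  obtains k where "k \<in> R" "wedge cs = k *\<^sub>R wedge p"
proof -
  have "1 *\<^sub>R wedge cs + 0 \<in> wedge_module R p (length p)"
    using assms by (intro wedge_module.intros) (auto simp: subringD)
  then show ?thesis using wedge_module_top[OF assms(1)] that by fastforce
qed

section \<open>Degree, independence and dimension\<close>

lemma wedge_card: "wedge bs $ K \<noteq> 0 \<Longrightarrow> card K = length bs"
proof (induction bs arbitrary: K)
  case Nil
  then show ?case by (auto simp: wedge_Nil axis_def split: if_splits)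
next
  case (Cons b bs)
  then obtain k where "k \<in> K" "wedge bs $ (K - {k}) \<noteq> 0"
    unfolding wedge_Cons ext_def vec_lambda_beta by (auto elim!: sum.not_neutral_contains_not_neutral)
  with Cons.IH[of "K - {k}"] have "card (K - {k}) = length bs" by simp
  with \<open>k \<in> K\<close> show ?case by (metis card_Suc_Diff1 finite length_Cons)
qed

lemma wedge_length_le:
  fixes bs :: "(real ^ 'i::finite) list"
  assumes "wedge bs \<noteq> 0"
  shows "length bs \<le> CARD('i)"
proof -
  obtain K where "wedge bs $ K \<noteq> 0" using assms by (auto simp: vec_eq_iff)
  from wedge_card[OF this] show ?thesis by (metis card_mono finite_class.finite_UNIV subset_UNIV)
qed

lemma wedge_Cons_nonzero:
  "wedge (b # bs) \<noteq> 0 \<longleftrightarrow> wedge bs \<noteq> 0 \<and> b \<notin> span (set bs)"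
  by (cases "wedge bs = 0") (auto simp: wedge_Cons ext_wedge_eq_0_iff linear_0[OF ext_linear])

lemma wedge_independent:
  "wedge bs \<noteq> 0 \<Longrightarrow> independent (set bs) \<and> distinct bs"
  by (induction bs) (auto simp: wedge_Cons_nonzero independent_insert independent_empty intro: span_base)

lemma wedge_dim:
  assumes "wedge bs \<noteq> 0"
  shows "dim (span (set bs)) = length bs"
  using wedge_independent[OF assms] by (simp add: dim_eq_card_independent distinct_card)

lemma wedge_appendD: "wedge (as @ bs) \<noteq> 0 \<Longrightarrow> wedge bs \<noteq> 0"
  by (induction as) (auto simp: wedge_Cons_nonzero)

section \<open>Integer lattices and their primitive sublattices\<close>

definition int_lattice :: "'i set \<Rightarrow> (real ^ 'i) set" where
  "int_lattice A = {z. (\<forall>k. z $ k \<in> \<int>) \<and> (\<forall>k. k \<notin> A \<longrightarrow> z $ k = 0)}"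

lemma int_lattice_closed:
  assumes "x \<in> int_lattice A"
  shows "y \<in> int_lattice A \<Longrightarrow> x - y \<in> int_lattice A" "y \<in> int_lattice A \<Longrightarrow> x + y \<in> int_lattice A"
    "k \<in> \<int> \<Longrightarrow> k *\<^sub>R x \<in> int_lattice A"
  using assms by (auto simp: int_lattice_def)

lemma comb_int_lattice: "set bs \<subseteq> int_lattice A \<Longrightarrow> comb \<int> bs \<subseteq> int_lattice A"
  by (induction bs) (auto simp: int_lattice_closed, simp add: int_lattice_def)

lemma wedge_support:
  assumes "\<And>b k. b \<in> set bs \<Longrightarrow> k \<notin> A \<Longrightarrow> b $ k = 0" "\<not> K \<subseteq> A"
  shows "wedge bs $ K = 0"
  using assms
proof (induction bs arbitrary: K)
  case Nil
  then show ?case by (auto simp: wedge_Nil axis_def)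
next
  case (Cons b bs)
  have "sg k K * b $ k * wedge bs $ (K - {k}) = 0" for k
  proof (cases "k \<in> A")
    case True
    then have "\<not> K - {k} \<subseteq> A" using Cons.prems(2) by auto
    then show ?thesis using Cons by simp
  qed (use Cons.prems(1) in simp)
  then show ?case unfolding wedge_Cons ext_def vec_lambda_beta by (intro sum.neutral ballI)
qed

lemma wedge_Ints:
  assumes "set bs \<subseteq> int_lattice A"
  shows "wedge bs $ K \<in> \<int>"
  using assms
proof (induction bs arbitrary: K)
  case Nil
  show ?case by (auto simp: wedge_Nil axis_def)
next
  case (Cons b bs)
  have "sg k K \<in> \<int>" for k by (simp add: sg_def)
  then show ?case unfolding wedge_Cons ext_def vec_lambda_beta
    by (intro Ints_sum Ints_mult) (use Cons in \<open>auto simp: int_lattice_def\<close>)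
qed

text \<open>A primitive sublattice, presented by a basis.\<close>

definition primitive :: "'i set \<Rightarrow> (real ^ 'i::finite) list \<Rightarrow> bool" where
  "primitive A bs \<longleftrightarrow> set bs \<subseteq> int_lattice A \<and> wedge bs \<noteq> 0 \<and> int_lattice A \<inter> span (set bs) \<subseteq> comb \<int> bs"

lemma primitive_Nil: "primitive A []"
  by (auto simp: primitive_def wedge_Nil axis_eq_0_iff)

text \<open>A vector \<open>b\<close> minimizing the (integral) squared norm of \<open>ext b (wedge as)\<close> extends a primitive
  list: otherwise division with remainder would yield a smaller one.\<close>

lemma primitive_extend:
  assumes prim: "primitive A as" and z0: "z0 \<in> int_lattice A" "z0 \<notin> span (set as)"
  obtains b where "b \<in> int_lattice A" "b \<in> span (insert z0 (set as))" "primitive A (b # as)"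
proof -
  let ?L = "int_lattice A" and ?S = "span (set as)"
  have L: "set as \<subseteq> ?L" and nz: "wedge as \<noteq> 0" and p: "?L \<inter> ?S \<subseteq> comb \<int> as"
    using prim by (auto simp: primitive_def)
  define Q where "Q b = (norm (wedge (b # as)))\<^sup>2" for b
  have Q_int: "Q b \<in> \<int>" if "b \<in> ?L" for b
    unfolding Q_def norm_sq_sum using wedge_Ints[of "b # as" A] L that by (intro Ints_sum Ints_power) auto
  define X where "X b \<longleftrightarrow> b \<in> ?L \<and> b \<in> span (insert z0 (set as)) \<and> b \<notin> ?S" for b
  have "X z0" using z0 by (simp add: X_def span_base)
  then obtain b where b: "X b" and min: "\<And>y. X y \<Longrightarrow> nat \<lfloor>Q b\<rfloor> \<le> nat \<lfloor>Q y\<rfloor>"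
    using ex_has_least_nat[of X z0 "\<lambda>b. nat \<lfloor>Q b\<rfloor>"] by blast
  have minQ: "Q b \<le> Q y" if "X y" for y
  proof -
    have "\<lfloor>Q b\<rfloor> \<le> \<lfloor>Q y\<rfloor>" using min[OF that] by (simp add: Q_def nat_le_eq_zle)
    then have "real_of_int \<lfloor>Q b\<rfloor> \<le> real_of_int \<lfloor>Q y\<rfloor>" by simp
    moreover have "real_of_int \<lfloor>Q b\<rfloor> = Q b" "real_of_int \<lfloor>Q y\<rfloor> = Q y"
      using Q_int b that by (simp_all add: X_def)
    ultimately show ?thesis by simp
  qed
  have nzb: "wedge (b # as) \<noteq> 0" using b nz by (simp add: wedge_Cons_nonzero X_def)
  have "z \<in> comb \<int> (b # as)" if z: "z \<in> ?L" "z \<in> span (set (b # as))" for z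
  proof -
    obtain \<beta> where \<beta>: "z - \<beta> *\<^sub>R b \<in> ?S" using z(2) by (auto simp: span_insert)
    define k where "k = real_of_int \<lfloor>\<beta>\<rfloor>"
    define z' where "z' = z - k *\<^sub>R b"
    have kI: "k \<in> \<int>" by (simp add: k_def)
    have z'L: "z' \<in> ?L" unfolding z'_def using b kI z by (intro int_lattice_closed) (auto simp: X_def)
    have "span (set (b # as)) \<subseteq> span (insert z0 (set as))"
      using b by (intro span_minimal) (auto simp: X_def intro: span_base)
    then have "z \<in> span (insert z0 (set as))" using z(2) by auto
    then have z'S: "z' \<in> span (insert z0 (set as))"
      unfolding z'_def using b by (intro span_diff span_scale) (auto simp: X_def)
    have e: "z' = (\<beta> - k) *\<^sub>R b + (z - \<beta> *\<^sub>R b)" by (simp add: z'_def algebra_simps)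
    have w: "wedge (z' # as) = (\<beta> - k) *\<^sub>R wedge (b # as)"
      unfolding e wedge_Cons using ext_wedge_span[OF \<beta>]
      by (simp add: linear_add[OF ext_linear_left] linear_cmul[OF ext_linear_left])
    have "\<beta> = k"
    proof (rule ccontr)
      assume ne: "\<beta> \<noteq> k"
      then have "wedge (z' # as) \<noteq> 0" using w nzb by simp
      then have "X z'" using z'L z'S by (simp add: X_def wedge_Cons_nonzero)
      then have "Q b \<le> Q z'" by (rule minQ)
      also have "Q z' = (\<beta> - k)\<^sup>2 * Q b" unfolding Q_def w by (simp add: power_mult_distrib)
      also have "\<dots> < 1 * Q b"
      proof (rule mult_strict_right_mono)
        have "0 \<le> \<beta> - k" "\<beta> - k < 1" unfolding k_def by linarith+
        then show "(\<beta> - k)\<^sup>2 < 1" by (simp add: power_less_one_iff abs_square_less_1)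
        show "Q b > 0" using nzb by (simp add: Q_def)
      qed
      finally show False by simp
    qed
    then have "z - k *\<^sub>R b \<in> comb \<int> as" using \<beta> z'L p by (auto simp: z'_def)
    then show ?thesis using kI by (auto intro!: exI[of _ k] exI[of _ "z - k *\<^sub>R b"])
  qed
  then have "primitive A (b # as)" using nzb b L by (auto simp: primitive_def X_def)
  then show ?thesis using that[of b] b by (auto simp: X_def)
qed

text \<open>The extension terminates since primitive lists are independent. Applied to an
  intersection of two subspaces and then to each of the two, it yields adapted bases.\<close>

lemma primitive_maximal:
  fixes as :: "(real ^ 'i::finite) list"
  assumes "primitive A as" "subspace V" "set as \<subseteq> V"
  shows "\<exists>bs. primitive A (bs @ as) \<and> set bs \<subseteq> V \<and> int_lattice A \<inter> V \<subseteq> span (set (bs @ as))"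
  using assms
proof (induction "CARD('i) - length as" arbitrary: as rule: less_induct)
  case (less as)
  show ?case
  proof (cases "int_lattice A \<inter> V \<subseteq> span (set as)")
    case True
    then show ?thesis using less by (intro exI[of _ "[]"]) auto
  next
    case False
    then obtain z where z: "z \<in> int_lattice A" "z \<in> V" "z \<notin> span (set as)" by auto
    obtain b where b: "b \<in> span (insert z (set as))" "primitive A (b # as)"
      using primitive_extend[OF less.prems(1) z(1,3)] .
    have bV: "b \<in> V" using b(1) span_minimal[of "insert z (set as)" V] z(2) less.prems by auto
    have "length (b # as) \<le> CARD('i)" using b(2) wedge_length_le[of "b # as"] by (auto simp: primitive_def)
    then have "CARD('i) - length (b # as) < CARD('i) - length as" by auto
    from less.hyps[OF this b(2) less.prems(2)] bV less.prems(3)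
    obtain bs where "primitive A (bs @ b # as)" "set bs \<subseteq> V"
      "int_lattice A \<inter> V \<subseteq> span (set (bs @ b # as))" by auto
    then show ?thesis using bV by (intro exI[of _ "bs @ [b]"]) auto
  qed
qed

text \<open>Cramer's rule: the coefficient \<alpha> of \<open>c\<close> is a quotient of integer
  coordinates of two wedges. Its denominator is cleared first, and the induction clears the
  remaining ones.\<close>

lemma integer_relation:
  assumes "set bs \<subseteq> int_lattice A" "wedge bs \<noteq> 0" "z \<in> int_lattice A" "z \<in> span (set bs)"
  shows "\<exists>n\<in>\<int>. n \<noteq> 0 \<and> n *\<^sub>R z \<in> comb \<int> bs"
  using assms
proof (induction bs arbitrary: z)
  case Nil
  then show ?case by (intro bexI[of _ 1]) auto
next
  case (Cons c bs)
  obtain \<alpha> where \<alpha>: "z - \<alpha> *\<^sub>R c \<in> span (set bs)" using Cons.prems(4) by (auto simp: span_insert)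
  obtain K where K: "wedge (c # bs) $ K \<noteq> 0" using Cons.prems(2) by (auto simp: vec_eq_iff)
  define n m where "n = wedge (c # bs) $ K" and "m = wedge (z # bs) $ K"
  have I: "n \<in> \<int>" "m \<in> \<int>" unfolding n_def m_def
    using wedge_Ints[of "c # bs" A] wedge_Ints[of "z # bs" A] Cons.prems by auto
  have "ext (\<alpha> *\<^sub>R c + (z - \<alpha> *\<^sub>R c)) (wedge bs) = \<alpha> *\<^sub>R ext c (wedge bs)"
    unfolding linear_add[OF ext_linear_left] linear_cmul[OF ext_linear_left] using ext_wedge_span[OF \<alpha>] by simp
  then have "m = \<alpha> * n" by (simp add: m_def n_def wedge_Cons)
  then have e: "n *\<^sub>R z - m *\<^sub>R c = n *\<^sub>R (z - \<alpha> *\<^sub>R c)" by (simp add: algebra_simps)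
  have "n *\<^sub>R z - m *\<^sub>R c \<in> int_lattice A"
    using Cons.prems I by (intro int_lattice_closed) auto
  moreover have "n *\<^sub>R z - m *\<^sub>R c \<in> span (set bs)" unfolding e using \<alpha> by (rule span_scale)
  ultimately obtain n' where n': "n' \<in> \<int>" "n' \<noteq> 0" "n' *\<^sub>R (n *\<^sub>R z - m *\<^sub>R c) \<in> comb \<int> bs"
    using Cons.IH[of "n *\<^sub>R z - m *\<^sub>R c"] Cons.prems by (auto simp: wedge_Cons_nonzero)
  have "(n' * n) *\<^sub>R z \<in> comb \<int> (c # bs)"
    using n' I by (auto intro!: exI[of _ "n' * m"] exI[of _ "n' *\<^sub>R (n *\<^sub>R z - m *\<^sub>R c)"] simp: algebra_simps)
  then show ?case using n' I K by (intro bexI[of _ "n' * n"]) (auto simp: n_def)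
qed

text \<open>In the second case \<open>as\<close> is a basis of the integer points in the
  intersection of the two spans, and \<open>cs\<close>, \<open>cs'\<close> complete it to bases of
  the integer points in each span, so that the concatenation spans the sum.\<close>

lemma int_wedge_cases:
  assumes bs: "set bs \<subseteq> int_lattice A" "wedge bs \<noteq> 0"
    and bs': "set bs' \<subseteq> int_lattice A" "wedge bs' \<noteq> 0"
    and len: "length bs = length bs'"
  obtains (proportional) k where "wedge bs' = k *\<^sub>R wedge bs"
  | (split) as cs cs' where "set (cs @ cs' @ as) \<subseteq> int_lattice A" "cs \<noteq> []"
    "length (cs @ as) = length bs" "length (cs' @ as) = length bs" "wedge (cs @ cs' @ as) \<noteq> 0"
    "set bs \<subseteq> comb \<int> (cs @ as)" "set bs' \<subseteq> comb \<int> (cs' @ as)"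
proof (cases "set bs' \<subseteq> span (set bs)")
  case True
  then obtain k where "wedge bs' = k *\<^sub>R wedge bs"
    using wedge_comb[OF subring_UNIV, of bs' bs] len by (auto simp: comb_UNIV)
  then show ?thesis by (rule proportional)
next
  case False
  let ?L = "int_lattice A" and ?V = "span (set bs)" and ?V' = "span (set bs')"
  have "subspace (?V \<inter> ?V')" by (simp add: subspace_inter)
  with primitive_maximal[OF primitive_Nil, of "?V \<inter> ?V'" A]
  obtain as where as: "primitive A as" "set as \<subseteq> ?V \<inter> ?V'" "?L \<inter> (?V \<inter> ?V') \<subseteq> span (set as)"
    by auto
  obtain cs where cs: "primitive A (cs @ as)" "set cs \<subseteq> ?V" "?L \<inter> ?V \<subseteq> span (set (cs @ as))"
    using primitive_maximal[OF as(1), of ?V] as(2) by auto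
  obtain cs' where cs': "primitive A (cs' @ as)" "set cs' \<subseteq> ?V'" "?L \<inter> ?V' \<subseteq> span (set (cs' @ as))"
    using primitive_maximal[OF as(1), of ?V'] as(2) by auto
  have sV: "span (set (cs @ as)) = ?V"
    using as cs bs span_base[of _ "set bs"] by (intro subset_antisym span_minimal) auto
  have sV': "span (set (cs' @ as)) = ?V'"
    using as cs' bs' span_base[of _ "set bs'"] by (intro subset_antisym span_minimal) auto
  have l: "length (cs @ as) = length bs" "length (cs' @ as) = length bs'"
    using wedge_dim[of "cs @ as"] wedge_dim[of bs] wedge_dim[of "cs' @ as"] wedge_dim[of bs'] cs(1) cs'(1) bs bs'
    unfolding sV sV' by (auto simp: primitive_def)
  have L: "set (cs @ cs' @ as) \<subseteq> ?L" using cs(1) cs'(1) by (auto simp: primitive_def)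
  \<comment> \<open>Independence is not immediate, because \<open>as\<close> accounts only for the
    integer points of the intersection. A linear relation is therefore made integral first; this
    puts \<open>y\<close> into the lattice as well as into both spans.\<close>
  have "wedge (ds @ cs' @ as) \<noteq> 0" if "wedge (ds @ as) \<noteq> 0" "set ds \<subseteq> ?L" "set ds \<subseteq> ?V" for ds
    using that
  proof (induction ds)
    case Nil
    show ?case using cs'(1) by (auto simp: primitive_def)
  next
    case (Cons d ds)
    have d: "d \<notin> span (set (ds @ as))" "wedge (ds @ as) \<noteq> 0" "wedge (ds @ cs' @ as) \<noteq> 0"
      using Cons by (auto simp: wedge_Cons_nonzero)
    show ?case
    proof (rule ccontr)
      assume "\<not> wedge ((d # ds) @ cs' @ as) \<noteq> 0"
      then have "d \<in> span (set (ds @ cs' @ as))" using d(3) by (auto simp: wedge_Cons_nonzero)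
      then obtain n where n: "n \<in> \<int>" "n \<noteq> 0" "n *\<^sub>R d \<in> comb \<int> (ds @ cs' @ as)"
        using integer_relation[of "ds @ cs' @ as" A d] d(3) L Cons.prems(2) by auto
      then obtain x y where xy: "n *\<^sub>R d = x + y" "x \<in> comb \<int> ds" "y \<in> comb \<int> (cs' @ as)"
        by (auto simp: comb_append[of _ ds])
      have "x \<in> comb UNIV ds" "y \<in> comb UNIV (cs' @ as)"
        using xy comb_mono[of \<int> UNIV] by blast+
      then have xs: "x \<in> span (set ds)" and yV': "y \<in> ?V'"
        using sV' by (simp_all only: comb_UNIV)
      have yL: "y \<in> ?L" using xy(3) comb_int_lattice[of "cs' @ as" A] L by auto
      have ye: "y = n *\<^sub>R d - x" using xy(1) by simp
      have "x \<in> ?V" using xs span_minimal[of "set ds" ?V] Cons.prems(3) by auto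
      then have "y \<in> ?V" unfolding ye using Cons.prems(3) by (intro span_diff span_scale) auto
      then have "y \<in> span (set as)" using yL yV' as(3) by auto
      then have "n *\<^sub>R d \<in> span (set (ds @ as))"
        unfolding xy(1) using xs span_mono[of "set ds" "set (ds @ as)"] span_mono[of "set as" "set (ds @ as)"]
        by (intro span_add) auto
      then have "d \<in> span (set (ds @ as))" 
        using n(2) span_scale[of "n *\<^sub>R d" _ "inverse n"] by simp
      with d(1) show False ..
    qed
  qed
  then have nz: "wedge (cs @ cs' @ as) \<noteq> 0" using cs L by (auto simp: primitive_def)
  have "cs \<noteq> []"
  proof
    assume "cs = []"
    then have "span (set as) = ?V" using sV by simp
    moreover have "span (set as) \<subseteq> ?V'" using as(2) by (intro span_minimal) auto
    moreover have "cs' = []" using l len \<open>cs = []\<close> by simp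
    then have "span (set as) = ?V'" using sV' by simp
    ultimately show False using False span_base[of _ "set bs'"] by auto
  qed
  moreover have "set bs \<subseteq> comb \<int> (cs @ as)"
    using cs(1) sV bs(1) span_base[of _ "set bs"] by (auto simp: primitive_def)
  moreover have "set bs' \<subseteq> comb \<int> (cs' @ as)"
    using cs'(1) sV' bs'(1) span_base[of _ "set bs'"] by (auto simp: primitive_def)
  ultimately show ?thesis using split[OF L] l len nz by auto
qed

subsection \<open>Weighted flows on multivectors\<close>

lemma abs_sg: "\<bar>sg k K\<bar> = 1"
  using sg_pm[of k K] by auto

lemma norm_wedge_single: "norm (wedge [b]) = norm b"
proof -
  have "con b (wedge []) = 0" by (rule con_wedge_orthogonal) simp
  then have "(norm (wedge [b]))\<^sup>2 = (norm b)\<^sup>2"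
    using norm_ext_sq[of b "wedge []"] by (simp add: wedge_Cons) (simp add: wedge_Nil)
  then show ?thesis by (rule power2_eq_imp_eq) auto
qed

lemma wedge_diagonal:
  "wedge (map (\<lambda>b. \<chi> k. exp (g k) * b $ k) bs) = (\<chi> K. exp (\<Sum>k\<in>K. g k) * wedge bs $ K)"
proof (induction bs)
  case Nil
  show ?case by (auto simp: wedge_Nil vec_eq_iff axis_def)
next
  case (Cons b bs)
  have "sg k K * (exp (g k) * b $ k) * (exp (\<Sum>k\<in>K - {k}. g k) * wedge bs $ (K - {k}))
    = exp (\<Sum>k\<in>K. g k) * (sg k K * b $ k * wedge bs $ (K - {k}))" if "k \<in> K" for k K
  proof -
    have "(\<Sum>k\<in>K. g k) = g k + (\<Sum>k\<in>K - {k}. g k)" using that by (intro sum.remove) auto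
    then show ?thesis by (simp add: exp_add)
  qed
  then have "(\<Sum>k\<in>K. sg k K * (exp (g k) * b $ k) * (exp (\<Sum>k\<in>K - {k}. g k) * wedge bs $ (K - {k})))
    = exp (\<Sum>k\<in>K. g k) * (\<Sum>k\<in>K. sg k K * b $ k * wedge bs $ (K - {k}))" for K
    unfolding sum_distrib_left by (intro sum.cong refl)
  then show ?case by (simp add: wedge_Cons Cons ext_def vec_eq_iff)
qed

locale weighted_flow =
  fixes w :: "real ^ 'd" and \<iota> :: 'd
  assumes weights: "w \<in> weights" and max_weight: "\<And>i. w $ i \<le> w $ \<iota>"
begin

definition S :: "'d set" where "S = {i. w $ i > 0}"
definition m :: nat where "m = card S"
definition wmin :: real where "wmin = Min ((\<lambda>i. w $ i) ` S)"
definition A :: "'d option set" where "A = insert None (Some ` S)"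

text \<open>The coordinate \<open>None\<close> carries the denominators. The coordinates of weight \<open>0\<close> impose no
  condition and are suppressed.\<close>

definition lift :: "real ^ 'd \<Rightarrow> real ^ 'd option" where
  "lift x = (\<chi> k. case k of None \<Rightarrow> 0 | Some i \<Rightarrow> if i \<in> S then x $ i else 0)"

definition shear1 :: "real ^ 'd \<Rightarrow> real ^ 'd option \<Rightarrow> real ^ 'd option" where
  "shear1 x b = b + b $ None *\<^sub>R lift x"

text \<open>The action of \<open>shear1 x\<close> on multivectors. There are no terms of higher
  order because \<open>shear1 x\<close> differs from the identity by a map of rank at most
  one.\<close>

definition shear :: "real ^ 'd \<Rightarrow> real ^ 'd option set \<Rightarrow> real ^ 'd option set" where
  "shear x \<omega> = \<omega> + ext (lift x) (con (axis None 1) \<omega>)"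

definition \<nu> :: "'d option set \<Rightarrow> real" where
  "\<nu> K = (\<Sum>k\<in>K. case k of None \<Rightarrow> 0 | Some i \<Rightarrow> w $ i)"

text \<open>The exponents of the flow \<open>(t, s)\<close>: time \<open>s\<close> moves all coordinates except the one of maximal
  weight.\<close>

definition rate :: "real \<Rightarrow> real \<Rightarrow> 'd option \<Rightarrow> real" where
  "rate t s k = (case k of None \<Rightarrow> - t - (1 - w $ \<iota>) * s | Some i \<Rightarrow> w $ i * (if i = \<iota> then t else t + s))"

definition G :: "real \<Rightarrow> real \<Rightarrow> 'd option set \<Rightarrow> real" where
  "G t s K = (\<Sum>k\<in>K. rate t s k)"

definition \<Phi> :: "real \<Rightarrow> real \<Rightarrow> real ^ 'd \<Rightarrow> real ^ 'd option set \<Rightarrow> real ^ 'd option set" where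
  "\<Phi> t s x \<omega> = (\<chi> K. exp (G t s K) * shear x \<omega> $ K)"

definition dec :: "nat \<Rightarrow> (real ^ 'd option set) set" where
  "dec j = {wedge bs | bs. length bs = j \<and> set bs \<subseteq> int_lattice A \<and> wedge bs \<noteq> 0}"

section \<open>Weights and exponents\<close>

lemma w_nonneg: "0 \<le> w $ i" and w_sum: "(\<Sum>i\<in>UNIV. w $ i) = 1"
  using weights by (auto simp: weights_def)

lemma \<iota>_S: "\<iota> \<in> S"
proof (rule ccontr)
  assume "\<iota> \<notin> S"
  then have "w $ i = 0" for i using max_weight[of i] w_nonneg[of i] by (simp add: S_def)
  then show False using w_sum by simp
qed

lemma wmin_le: "i \<in> S \<Longrightarrow> wmin \<le> w $ i"
  by (simp add: wmin_def)

lemma wmin_pos: "0 < wmin"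
proof -
  have "wmin \<in> (\<lambda>i. w $ i) ` S" unfolding wmin_def using \<iota>_S by (intro Min_in) auto
  then show ?thesis by (auto simp: S_def)
qed

lemma w\<iota>_le_1: "w $ \<iota> \<le> 1"
  using member_le_sum[of \<iota> UNIV "\<lambda>i. w $ i"] w_nonneg w_sum by simp

lemma wmin_le_1: "wmin \<le> 1"
  using wmin_le[OF \<iota>_S] w\<iota>_le_1 by simp

lemma m_pos: "0 < m"
  using \<iota>_S by (auto simp: m_def card_gt_0_iff)

lemma card_A: "card A = Suc m"
  by (simp add: A_def m_def card_image)

lemma \<nu>_UNIV: "\<nu> UNIV = 1"
  unfolding \<nu>_def UNIV_option_conv using w_sum by (subst sum.insert) (auto simp: sum.reindex)

lemma \<nu>_mono: "K \<subseteq> K' \<Longrightarrow> \<nu> K \<le> \<nu> K'"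
  unfolding \<nu>_def by (intro sum_mono2) (auto simp: w_nonneg split: option.splits)

lemma \<nu>_le_1: "\<nu> K \<le> 1"
  using \<nu>_mono[of K UNIV] \<nu>_UNIV by simp

lemma \<nu>_insert: "Some i \<notin> K \<Longrightarrow> \<nu> (insert (Some i) K) = w $ i + \<nu> K"
  by (simp add: \<nu>_def)

lemma \<nu>_ge: "Some i \<in> K \<Longrightarrow> w $ i \<le> \<nu> K"
  using \<nu>_mono[of "{Some i}" K] by (simp add: \<nu>_def)

lemma \<nu>_ge_wmin:
  assumes "K \<subseteq> A" "card K \<ge> 1" "None \<notin> K"
  shows "wmin \<le> \<nu> K"
proof -
  obtain k where "k \<in> K" using assms(2) by (metis card.empty all_not_in_conv not_one_le_zero)
  with assms obtain i where "Some i \<in> K" "i \<in> S" by (auto simp: A_def)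
  then show ?thesis using \<nu>_ge[of i K] wmin_le[of i] by simp
qed

lemma exists_free_coordinate:
  assumes "card K \<le> m" "None \<in> K"
  obtains i where "i \<in> S" "Some i \<notin> K"
proof -
  have "\<not> A \<subseteq> K" using card_mono[of K A] assms card_A by auto
  then show ?thesis using that assms by (auto simp: A_def)
qed

lemma \<nu>_le_wmin:
  assumes "card K \<le> m" "None \<in> K"
  shows "\<nu> K \<le> 1 - wmin"
proof -
  obtain i where "i \<in> S" "Some i \<notin> K" using exists_free_coordinate[OF assms] .
  then show ?thesis using \<nu>_insert[of i K] \<nu>_le_1[of "insert (Some i) K"] wmin_le[of i] by simp
qed

text \<open>Besides the total weight only the membership of \<open>None\<close> and of
  \<open>Some \<iota>\<close> enters; hence the four types of coordinates in
  \<open>\<Phi>_contraction\<close>.\<close>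

lemma G_eq: "G t s K = t * (\<nu> K - of_bool (None \<in> K))
    + s * (\<nu> K - w $ \<iota> * of_bool (Some \<iota> \<in> K) - (1 - w $ \<iota>) * of_bool (None \<in> K))"
proof -
  let ?u = "\<lambda>k. case k of None \<Rightarrow> 0 | Some i \<Rightarrow> w $ i"
  have "rate t s k = t * (?u k - of_bool (k = None))
    + s * (?u k - w $ \<iota> * of_bool (k = Some \<iota>) - (1 - w $ \<iota>) * of_bool (k = None))" for k
    by (auto simp: rate_def algebra_simps split: option.splits)
  then have "G t s K = t * (\<nu> K - (\<Sum>k\<in>K. of_bool (k = None)))
    + s * (\<nu> K - w $ \<iota> * (\<Sum>k\<in>K. of_bool (k = Some \<iota>)) - (1 - w $ \<iota>) * (\<Sum>k\<in>K. of_bool (k = None)))"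
    by (simp add: G_def \<nu>_def sum.distrib sum_subtractf flip: sum_distrib_left)
  moreover have "(\<Sum>k\<in>K. of_bool (k = l)) = (of_bool (l \<in> K) :: real)" for l
    by (simp add: of_bool_def sum.delta)
  ultimately show ?thesis by simp
qed

section \<open>The shear and the flow on multivectors\<close>

lemma lift_linear: "linear lift"
  by (rule linearI) (auto simp: lift_def vec_eq_iff split: option.splits)

lemma lift_axis: "i \<in> S \<Longrightarrow> lift (axis i 1) = axis (Some i) 1"
  by (auto simp: lift_def vec_eq_iff axis_def split: option.splits)

lemma shear_wedge: "shear x (wedge bs) = wedge (map (shear1 x) bs)"
proof (induction bs)
  case Nil
  have "con (axis None 1) (wedge []) = (0 :: real ^ 'd option set)" by (rule con_wedge_orthogonal) simp
  then show ?case by (simp add: shear_def linear_0[OF ext_linear])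
next
  case (Cons b bs)
  let ?\<omega> = "wedge bs" and ?e = "axis None 1"
  have i: "b \<bullet> ?e = b $ None" by (simp add: inner_axis)
  have "shear x (wedge (b # bs)) = ext b ?\<omega> + b $ None *\<^sub>R ext (lift x) ?\<omega> + ext b (ext (lift x) (con ?e ?\<omega>))"
    unfolding shear_def wedge_Cons con_ext i
    by (simp add: linear_diff[OF ext_linear] linear_cmul[OF ext_linear] ext_anticommute[of "lift x" b])
  also have "\<dots> = ext (shear1 x b) (shear x ?\<omega>)"
    unfolding shear1_def shear_def
    by (simp add: linear_add[OF ext_linear] linear_add[OF ext_linear_left] linear_cmul[OF ext_linear_left]
        linear_cmul[OF ext_linear])
  finally show ?case by (simp add: Cons wedge_Cons)
qed

definition act1 :: "real \<Rightarrow> real \<Rightarrow> real ^ 'd \<Rightarrow> real ^ 'd option \<Rightarrow> real ^ 'd option" where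
  "act1 t s x b = (\<chi> k. exp (rate t s k) * shear1 x b $ k)"

lemma act1_linear: "linear (act1 t s x)"
  by (rule linearI) (auto simp: act1_def shear1_def vec_eq_iff algebra_simps)

lemma \<Phi>_wedge: "\<Phi> t s x (wedge bs) = wedge (map (act1 t s x) bs)"
  using wedge_diagonal[of "rate t s" "map (shear1 x) bs"]
  by (simp add: \<Phi>_def G_def shear_wedge act1_def[abs_def] comp_def)

lemma shear_linear: "linear (shear x)"
  by (rule linearI) (simp_all add: shear_def linear_add[OF ext_linear] linear_add[OF con_linear]
      linear_cmul[OF ext_linear] linear_cmul[OF con_linear] scaleR_add_right)

lemma \<Phi>_linear: "linear (\<Phi> t s x)"
  by (rule linearI) (auto simp: \<Phi>_def vec_eq_iff linear_add[OF shear_linear] linear_cmul[OF shear_linear] algebra_simps)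

text \<open>Contraction removes \<open>None\<close> and \<open>lift x\<close> cannot put it back.
  These coordinates are therefore constant on every ball.\<close>

lemma shear_None: "None \<in> K \<Longrightarrow> shear x \<omega> $ K = \<omega> $ K"
proof -
  assume K: "None \<in> K"
  have "sg k K * lift x $ k * con (axis None 1) \<omega> $ (K - {k}) = 0" for k
    using K by (cases k) (simp_all add: con_axis lift_def)
  then have "ext (lift x) (con (axis None 1) \<omega>) $ K = 0"
    unfolding ext_def vec_lambda_beta by (intro sum.neutral ballI)
  then show ?thesis by (simp add: shear_def)
qed

lemma \<Phi>_eq_0_iff: "\<Phi> t s x \<omega> = 0 \<longleftrightarrow> \<omega> = 0"
proof
  assume "\<Phi> t s x \<omega> = 0"
  then have sh: "shear x \<omega> = 0" by (auto simp: \<Phi>_def vec_eq_iff)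
  then have "\<omega> $ K = 0" if "None \<in> K" for K using shear_None[OF that, of x \<omega>] by simp
  then have "con (axis None 1) \<omega> = 0" by (auto simp: vec_eq_iff con_axis)
  then show "\<omega> = 0" using sh by (simp add: shear_def linear_0[OF ext_linear])
qed (simp add: linear_0[OF \<Phi>_linear])

text \<open>Decay near hyperplanes controls affine functions; this makes it applicable to
  multivectors of every rank.\<close>

lemma shear_affine: "\<exists>a. \<forall>x. shear x \<omega> $ K = \<omega> $ K + a \<bullet> x"
proof -
  let ?f = "\<lambda>x. ext (lift x) (con (axis None 1) \<omega>) $ K"
  have "linear ?f"
    by (rule linearI) (simp_all add: linear_add[OF lift_linear] linear_cmul[OF lift_linear]
      linear_add[OF ext_linear_left] linear_cmul[OF ext_linear_left])
  from adjoint_works[OF this, of _ 1] show ?thesis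
    by (intro exI[of _ "adjoint ?f 1"]) (simp add: shear_def inner_commute)
qed

lemma \<Phi>_affine: "\<Phi> t s (y + u *\<^sub>R (x - y)) \<omega> = (1 - u) *\<^sub>R \<Phi> t s y \<omega> + u *\<^sub>R \<Phi> t s x \<omega>"
proof -
  have "shear (y + u *\<^sub>R (x - y)) \<omega> $ K = (1 - u) * shear y \<omega> $ K + u * shear x \<omega> $ K" for K
    using shear_affine[of \<omega> K] by (auto simp: inner_add_right inner_diff_right algebra_simps)
  then show ?thesis unfolding vec_eq_iff \<Phi>_def vec_lambda_beta vector_add_component vector_scaleR_component
    by (simp only: distrib_left real_scaleR_def mult_ac simp_thms)
qed

text \<open>Moving \<open>x\<close> in the direction \<open>i\<close> trades \<open>None\<close> for
  \<open>Some i\<close>. A coordinate with \<open>None\<close> can thus be read off from the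
  variation of one without it.\<close>

lemma shear_difference:
  assumes "i \<in> S" "Some i \<notin> J" "None \<notin> J"
  shows "\<bar>shear (x + r *\<^sub>R axis i 1) \<omega> $ insert (Some i) J - shear x \<omega> $ insert (Some i) J\<bar>
    = \<bar>r\<bar> * \<bar>\<omega> $ insert None J\<bar>"
proof -
  have "shear (x + r *\<^sub>R axis i 1) \<omega> - shear x \<omega> = r *\<^sub>R ext (axis (Some i) 1) (con (axis None 1) \<omega>)"
    using assms(1) by (simp add: shear_def linear_add[OF lift_linear] linear_cmul[OF lift_linear] lift_axis
      linear_add[OF ext_linear_left] linear_cmul[OF ext_linear_left])
  then show ?thesis
    using assms by (simp add: ext_axis con_axis abs_mult abs_sg flip: vector_minus_component)
qed

section \<open>Integral decomposable multivectors under the flow\<close>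

lemma dec_nonzero: "\<omega> \<in> dec j \<Longrightarrow> \<omega> \<noteq> 0"
  by (auto simp: dec_def)

lemma dec_Ints: "\<omega> \<in> dec j \<Longrightarrow> \<omega> $ K \<in> \<int>"
  by (auto simp: dec_def wedge_Ints)

lemma dec_abs_ge_1:
  assumes "\<omega> \<in> dec j" "\<omega> $ K \<noteq> 0"
  shows "1 \<le> \<bar>\<omega> $ K\<bar>"
  using Ints_nonzero_abs_ge1[OF dec_Ints[OF assms(1)] assms(2)] .

lemma dec_shear_support:
  assumes "\<omega> \<in> dec j" "shear x \<omega> $ K \<noteq> 0"
  shows "card K = j" "K \<subseteq> A"
proof -
  obtain bs where bs: "\<omega> = wedge bs" "length bs = j" "set bs \<subseteq> int_lattice A"
    using assms(1) by (auto simp: dec_def)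
  have nz: "wedge (map (shear1 x) bs) $ K \<noteq> 0" using assms(2) by (simp add: bs(1) shear_wedge)
  then show "card K = j" using wedge_card bs(2) by (metis length_map)
  have "b' $ k = 0" if "b' \<in> set (map (shear1 x) bs)" "k \<notin> A" for b' k
  proof -
    obtain b where b: "b \<in> set bs" "b' = shear1 x b" using \<open>b' \<in> _\<close> by auto
    obtain i where i: "k = Some i" "i \<notin> S" using \<open>k \<notin> A\<close> by (cases k) (auto simp: A_def)
    have "b $ k = 0" using b(1) bs(3) \<open>k \<notin> A\<close> by (auto simp: int_lattice_def)
    then show ?thesis by (simp add: b(2) i shear1_def lift_def)
  qed
  then show "K \<subseteq> A" using wedge_support nz by blast
qed

lemma shear_0: "shear 0 \<omega> = \<omega>"
  by (simp add: shear_def linear_0[OF lift_linear] linear_0[OF ext_linear_left])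

lemma dec_support:
  assumes "\<omega> \<in> dec j" "\<omega> $ K \<noteq> 0"
  shows "card K = j" "K \<subseteq> A"
  using dec_shear_support[of \<omega> j 0 K] assms by (simp_all add: shear_0)

lemma dec_exists_coordinate: "\<omega> \<in> dec j \<Longrightarrow> \<exists>K. \<omega> $ K \<noteq> 0"
  using dec_nonzero by (auto simp: vec_eq_iff)

lemma dec_rank_le: "\<omega> \<in> dec j \<Longrightarrow> j \<le> Suc m"
  using dec_exists_coordinate dec_support card_mono[of A] card_A by (metis finite)

lemma norm_\<Phi>_ge: "exp (G t s K) * \<bar>shear x \<omega> $ K\<bar> \<le> norm (\<Phi> t s x \<omega>)"
  using component_le_norm_cart[of "\<Phi> t s x \<omega>" K] by (simp add: \<Phi>_def abs_mult)

text \<open>The only nonzero coordinate is an integer, which the shear does not change; nor does the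
  flow, whose exponents over \<open>A\<close> add up to 0. These ranks occur for intersections and
  sums.\<close>

lemma norm_\<Phi>_extreme_rank:
  assumes "\<omega> \<in> dec j" "j = 0 \<or> j = Suc m"
  shows "1 \<le> norm (\<Phi> t s x \<omega>)"
proof -
  obtain K where K: "\<omega> $ K \<noteq> 0" using dec_exists_coordinate[OF assms(1)] by auto
  note sup = dec_support[OF assms(1) K]
  have "K = {} \<or> K = A" using sup assms(2) card_A card_subset_eq[of A K] by auto
  moreover have "\<nu> A = 1"
  proof -
    have "\<nu> A = (\<Sum>i\<in>S. w $ i)" by (simp add: \<nu>_def A_def sum.reindex)
    also have "\<dots> = (\<Sum>i\<in>UNIV. w $ i)"
      using w_nonneg by (intro sum.mono_neutral_left) (auto simp: S_def order.antisym not_less)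
    finally show ?thesis using w_sum by simp
  qed
  ultimately have "G t s K = 0" using \<iota>_S
    by (auto simp: G_eq A_def) (simp_all add: \<nu>_def G_def algebra_simps)
  moreover have "shear x \<omega> $ K = \<omega> $ K"
  proof (cases "K = {}")
    case True
    then show ?thesis by (simp add: shear_def ext_def)
  next
    case False
    then have "None \<in> K" using \<open>K = {} \<or> K = A\<close> by (auto simp: A_def)
    then show ?thesis by (rule shear_None)
  qed
  ultimately show ?thesis using norm_\<Phi>_ge[of t s K x \<omega>] dec_abs_ge_1[OF assms(1) K] by simp
qed

text \<open>For nonnegative times no coordinate without \<open>None\<close> contracts. If some
  coordinate with \<open>None\<close> is nonzero, it is an integer, and exchanging
  \<open>None\<close> for a free index gives a coordinate that varies by at least \<open>r\<close>
  over the ball. Otherwise the shear acts trivially and integrality suffices. It is essential that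
  the bound does not depend on \<open>s\<close>.\<close>

lemma norm_\<Phi>_initial:
  assumes \<omega>: "\<omega> \<in> dec j" and j: "1 \<le> j" "j \<le> m" and ts: "0 \<le> t" "0 \<le> s" and r: "0 < r" "r \<le> 1"
  shows "\<exists>x\<in>cball x0 r. r / 2 \<le> norm (\<Phi> t s x \<omega>)"
proof -
  have Gpos: "0 \<le> G t s K" if "None \<notin> K" for K
    unfolding G_def using that ts w_nonneg
    by (intro sum_nonneg) (auto simp: rate_def split: option.splits)
  have big: "c \<le> norm (\<Phi> t s x \<omega>)" if "None \<notin> K" "c \<le> \<bar>shear x \<omega> $ K\<bar>" for K x c
  proof -
    have "\<bar>shear x \<omega> $ K\<bar> \<le> exp (G t s K) * \<bar>shear x \<omega> $ K\<bar>"
      using Gpos[OF that(1)] mult_right_mono[of 1 "exp (G t s K)" "\<bar>shear x \<omega> $ K\<bar>"] by simp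
    then show ?thesis using that(2) norm_\<Phi>_ge[of t s K x \<omega>] by simp
  qed
  show ?thesis
  proof (cases "\<exists>K. None \<in> K \<and> \<omega> $ K \<noteq> 0")
    case True
    then obtain K where K: "None \<in> K" "\<omega> $ K \<noteq> 0" by auto
    obtain i where i: "i \<in> S" "Some i \<notin> K"
      using exists_free_coordinate[of K] dec_support[OF \<omega> K(2)] j K(1) by auto
    let ?J = "K - {None}" and ?x = "x0 + r *\<^sub>R axis i 1"
    have "insert None ?J = K" using K by auto
    then have "\<bar>shear ?x \<omega> $ insert (Some i) ?J - shear x0 \<omega> $ insert (Some i) ?J\<bar> = r * \<bar>\<omega> $ K\<bar>"
      using shear_difference[of i ?J x0 r \<omega>] i r by auto
    moreover have "r \<le> r * \<bar>\<omega> $ K\<bar>" using dec_abs_ge_1[OF \<omega> K(2)] r by simp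
    ultimately have "r / 2 \<le> \<bar>shear ?x \<omega> $ insert (Some i) ?J\<bar> \<or> r / 2 \<le> \<bar>shear x0 \<omega> $ insert (Some i) ?J\<bar>"
      by linarith
    moreover have "?x \<in> cball x0 r" using r by (simp add: dist_norm)
    moreover have "None \<notin> insert (Some i) ?J" by simp
    ultimately show ?thesis using big[of "insert (Some i) ?J" "r / 2"] r
      by (metis centre_in_cball less_imp_le)
  next
    case False
    then have "con (axis None 1) \<omega> = 0" by (auto simp: vec_eq_iff con_axis)
    then have e: "shear x0 \<omega> = \<omega>" by (simp add: shear_def linear_0[OF ext_linear])
    obtain K where K: "\<omega> $ K \<noteq> 0" using dec_exists_coordinate[OF \<omega>] by auto
    then have "None \<notin> K" using False by auto
    then have "1 \<le> norm (\<Phi> t s x0 \<omega>)" using big[of K] dec_abs_ge_1[OF \<omega> K] e by simp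
    then show ?thesis using r by (intro bexI[of _ x0]) auto
  qed
qed

text \<open>No coordinate contracts faster than at rate 1, since weights are nonnegative and only
  \<open>None\<close> has a negative exponent.\<close>

lemma norm_\<Phi>_time:
  assumes "0 \<le> \<Delta>"
  shows "exp (- \<Delta>) * norm (\<Phi> t s x \<omega>) \<le> norm (\<Phi> (t + \<Delta>) s x \<omega>)"
proof -
  have "norm (exp (- \<Delta>) *\<^sub>R \<Phi> t s x \<omega>) \<le> norm (\<Phi> (t + \<Delta>) s x \<omega>)"
  proof (rule norm_le_componentwise_cart)
    fix K
    have "0 \<le> \<nu> K" using \<nu>_mono[of "{}" K] by (simp add: \<nu>_def)
    then have "- \<Delta> \<le> \<Delta> * (\<nu> K - of_bool (None \<in> K))"
      using assms mult_left_mono[of "-1" "\<nu> K - of_bool (None \<in> K)" \<Delta>] by (auto split: if_splits)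
    then have "- \<Delta> + G t s K \<le> G (t + \<Delta>) s K" by (simp add: G_eq algebra_simps)
    then have "exp (- \<Delta>) * exp (G t s K) \<le> exp (G (t + \<Delta>) s K)" by (simp flip: exp_add)
    then show "norm ((exp (- \<Delta>) *\<^sub>R \<Phi> t s x \<omega>) $ K) \<le> norm (\<Phi> (t + \<Delta>) s x \<omega> $ K)"
      by (simp add: \<Phi>_def abs_mult mult_right_mono flip: mult.assoc)
  qed
  then show ?thesis by simp
qed

text \<open>\<alpha> and \<beta> represent the intersection and the sum of two integral subspaces.
  They depend on the subspaces only, so the inequality is available for all flow parameters and all
  points at once.\<close>

lemma dec_cases:
  assumes "\<omega> \<in> dec j" "\<omega>' \<in> dec j"
  obtains (proportional) k where "\<omega>' = k *\<^sub>R \<omega>"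
  | (split) i \<alpha> \<beta> where "1 \<le> i" "i \<le> j" "\<alpha> \<in> dec (j - i)" "\<beta> \<in> dec (j + i)"
    "\<And>t s x. norm (\<Phi> t s x \<alpha>) * norm (\<Phi> t s x \<beta>) \<le> norm (\<Phi> t s x \<omega>) * norm (\<Phi> t s x \<omega>')"
proof -
  obtain bs where bs: "\<omega> = wedge bs" "length bs = j" "set bs \<subseteq> int_lattice A" "wedge bs \<noteq> 0"
    using assms(1) by (auto simp: dec_def)
  obtain bs' where bs': "\<omega>' = wedge bs'" "length bs' = j" "set bs' \<subseteq> int_lattice A" "wedge bs' \<noteq> 0"
    using assms(2) by (auto simp: dec_def)
  have len: "length bs = length bs'" by (simp add: bs bs')
  show ?thesis
  proof (rule int_wedge_cases[OF bs(3,4) bs'(3,4) len])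
    fix k assume "wedge bs' = k *\<^sub>R wedge bs"
    then show ?thesis using proportional[of k] by (simp add: bs bs')
  next
    fix as cs cs'
    assume L: "set (cs @ cs' @ as) \<subseteq> int_lattice A" and ne: "cs \<noteq> []"
      and l: "length (cs @ as) = length bs" "length (cs' @ as) = length bs"
      and nz: "wedge (cs @ cs' @ as) \<noteq> 0"
      and c: "set bs \<subseteq> comb \<int> (cs @ as)" "set bs' \<subseteq> comb \<int> (cs' @ as)"
    have \<alpha>: "wedge as \<in> dec (j - length cs)"
      using L l bs(2) wedge_appendD[of "cs @ cs'" as] nz by (auto simp: dec_def intro!: exI[of _ as])
    have \<beta>: "wedge (cs @ cs' @ as) \<in> dec (j + length cs)"
      using L l bs(2) nz by (auto simp: dec_def intro!: exI[of _ "cs @ cs' @ as"])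
    \<comment> \<open>The given lists generate sublattices of those generated by the adapted bases,
      and the index \<open>k\<close> is a nonzero integer.\<close>
    have le: "norm (wedge (map (act1 t s x) ds)) \<le> norm (wedge (map (act1 t s x) zs))"
      if sub: "set zs \<subseteq> comb \<int> ds" and eq: "length zs = length ds" and zs: "wedge zs \<noteq> 0" for t s x ds zs
    proof -
      have sub': "set (map (act1 t s x) zs) \<subseteq> comb \<int> (map (act1 t s x) ds)"
        using sub comb_map[OF act1_linear] by auto
      then obtain k where k: "k \<in> \<int>" "wedge (map (act1 t s x) zs) = k *\<^sub>R wedge (map (act1 t s x) ds)"
        using wedge_comb[OF subring_Ints _ sub'] eq by auto
      have "wedge (map (act1 t s x) zs) \<noteq> 0"
        using zs \<Phi>_eq_0_iff[of t s x "wedge zs"] by (simp add: \<Phi>_wedge)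
      then have "k \<noteq> 0" using k by auto
      then have "1 \<le> \<bar>k\<bar>" using k(1) by (rule Ints_nonzero_abs_ge1[rotated])
      then show ?thesis unfolding k(2) by (simp add: mult_le_cancel_right1)
    qed
    have "norm (\<Phi> t s x (wedge as)) * norm (\<Phi> t s x (wedge (cs @ cs' @ as)))
        \<le> norm (\<Phi> t s x \<omega>) * norm (\<Phi> t s x \<omega>')" for t s x
    proof -
      let ?T = "act1 t s x"
      have "norm (wedge (map ?T as)) * norm (wedge (map ?T cs @ map ?T cs' @ map ?T as))
        \<le> norm (wedge (map ?T cs @ map ?T as)) * norm (wedge (map ?T cs' @ map ?T as))"
        by (rule norm_wedge_submodular)
      also have "\<dots> \<le> norm (wedge (map ?T bs)) * norm (wedge (map ?T bs'))"
        using le[OF c(1)] le[OF c(2)] l bs bs' by (intro mult_mono) auto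
      finally show ?thesis by (simp add: \<Phi>_wedge bs bs')
    qed
    moreover have "1 \<le> length cs" "length cs \<le> j" using ne l bs(2) by (auto simp: Suc_le_eq)
    ultimately show ?thesis using split[OF _ _ \<alpha> \<beta>] by blast
  qed
qed

text \<open>In time \<open>\<Delta>\<close> some coordinate that grows on the ball catches up, provided
  that one may increase the parameter \<open>s\<close> by about \<open>\<Delta>\<close>. Whether slightly more or slightly less depends on
  which factor of the quadratic inequality is the small one.\<close>

lemma \<Phi>_contraction:
  fixes x0 :: "real ^ 'd" and t s \<Delta> \<eta> \<sigma> :: real
  defines "B \<equiv> cball x0 (exp (- (1 + w $ \<iota>) * t))" and "N \<equiv> real CARD('d option set)"
  assumes \<omega>: "\<omega> \<in> dec j" and j: "1 \<le> j" "j \<le> m" and s: "0 \<le> s" and \<Delta>: "0 < \<Delta>"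
    and \<eta>: "0 < \<eta>" "\<eta> \<le> wmin / 4"
    and \<sigma>: "\<And>K x. x \<in> B \<Longrightarrow> exp (G (t + \<Delta>) s K) * \<bar>shear x \<omega> $ K\<bar> \<le> \<sigma>"
  shows "\<exists>h\<in>{(1 - \<eta>) * \<Delta>, (1 + \<eta>) * \<Delta>}. \<forall>x\<in>B.
    norm (\<Phi> t (s + h) x \<omega>) \<le> 2 * N\<^sup>2 * exp (- \<eta> * wmin * \<Delta>) * \<sigma>"
proof -
  define r where "r = exp (- (1 + w $ \<iota>) * t)"
  define \<Omega> where "\<Omega> x K = exp (G (t + \<Delta>) s K) * \<bar>shear x \<omega> $ K\<bar>" for x K
  have r: "0 < r" by (simp add: r_def)
  have x0B: "x0 \<in> B" by (simp add: B_def)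
  have \<Omega>0: "0 \<le> \<Omega> x K" for x K by (simp add: \<Omega>_def)
  have \<Omega>\<sigma>: "\<Omega> x K \<le> \<sigma>" if "x \<in> B" for x K using \<sigma>[OF that] by (simp add: \<Omega>_def)
  have \<sigma>0: "0 \<le> \<sigma>" using \<Omega>0[of x0 "{}"] \<Omega>\<sigma>[OF x0B, of "{}"] by simp
  have N1: "1 \<le> N" unfolding N_def using zero_less_card_finite[where 'a = "'d option set"] by linarith
  have w\<iota>: "0 < w $ \<iota>" "w $ \<iota> \<le> 1" "wmin \<le> w $ \<iota>" using \<iota>_S w\<iota>_le_1 wmin_le by (auto simp: S_def)
  have \<eta>': "\<eta> \<le> 1 / 4" "\<eta> * wmin \<le> 1 / 4" "\<eta> * wmin \<le> wmin / 4"
  proof -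
    show 1: "\<eta> \<le> 1 / 4" using \<eta> wmin_le_1 by simp
    show "\<eta> * wmin \<le> wmin / 4" using mult_right_mono[OF 1, of wmin] wmin_pos by simp
    then show "\<eta> * wmin \<le> 1 / 4" using wmin_le_1 by simp
  qed
  \<comment> \<open>A step of length \<open>r\<close> in the direction \<iota> turns
    \<open>K\<close> into \<open>?I\<close>, whose size is at most \<sigma>. The exponents of the
    two differ by at least \<open>(1 + w $ \<iota>) * (t + \<Delta>)\<close>; the factor
    \<open>r\<close> uses up the part with \<open>t\<close> and leaves the part with
    \<Delta>.\<close>
  have small: "\<Omega> x K \<le> 2 * exp (- (1 + w $ \<iota>) * \<Delta>) * \<sigma>" if "None \<in> K" "Some \<iota> \<notin> K" for x K
  proof -
    let ?J = "K - {None}" and ?x = "x0 + r *\<^sub>R axis \<iota> 1"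
    let ?I = "insert (Some \<iota>) ?J"
    have K: "insert None ?J = K" using that by auto
    have d: "\<bar>shear ?x \<omega> $ ?I - shear x0 \<omega> $ ?I\<bar> = r * \<bar>\<omega> $ K\<bar>"
      using shear_difference[of \<iota> ?J x0 r \<omega>] that r \<iota>_S unfolding K by auto
    have "?x \<in> B" using r by (simp add: B_def r_def dist_norm)
    then have "\<Omega> ?x ?I + \<Omega> x0 ?I \<le> 2 * \<sigma>" using \<Omega>\<sigma>[of ?x ?I] \<Omega>\<sigma>[of x0 ?I] x0B by simp
    then have "exp (G (t + \<Delta>) s ?I) * (\<bar>shear ?x \<omega> $ ?I\<bar> + \<bar>shear x0 \<omega> $ ?I\<bar>) \<le> 2 * \<sigma>"
      by (simp add: \<Omega>_def distrib_left)
    note 2 = this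
    have "exp (G (t + \<Delta>) s ?I) * (r * \<bar>\<omega> $ K\<bar>)
      \<le> exp (G (t + \<Delta>) s ?I) * (\<bar>shear ?x \<omega> $ ?I\<bar> + \<bar>shear x0 \<omega> $ ?I\<bar>)"
      unfolding d[symmetric] by (intro mult_left_mono) auto
    from order_trans[OF this 2] have 1: "exp (G (t + \<Delta>) s ?I) * r * \<bar>\<omega> $ K\<bar> \<le> 2 * \<sigma>"
      by (simp only: mult.assoc)
    have "G (t + \<Delta>) s K = rate (t + \<Delta>) s None + G (t + \<Delta>) s ?J"
      unfolding G_def using that by (intro sum.remove) auto
    moreover have "G (t + \<Delta>) s ?I = rate (t + \<Delta>) s (Some \<iota>) + G (t + \<Delta>) s ?J"
      unfolding G_def using that by (subst sum.insert) auto
    ultimately have "G (t + \<Delta>) s K = G (t + \<Delta>) s ?I - (1 + w $ \<iota>) * (t + \<Delta>) - (1 - w $ \<iota>) * s"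
      by (simp add: rate_def algebra_simps)
    also have "\<dots> \<le> G (t + \<Delta>) s ?I + (- (1 + w $ \<iota>) * t) + (- (1 + w $ \<iota>) * \<Delta>)"
      using s w\<iota> mult_left_mono[of "w $ \<iota>" 1 s] by (simp add: algebra_simps)
    finally have "exp (G (t + \<Delta>) s K) \<le> exp (G (t + \<Delta>) s ?I + (- (1 + w $ \<iota>) * t) + (- (1 + w $ \<iota>) * \<Delta>))"
      by simp
    also have "\<dots> = exp (G (t + \<Delta>) s ?I) * r * exp (- (1 + w $ \<iota>) * \<Delta>)"
      by (simp only: exp_add r_def)
    finally have "\<Omega> x K \<le> exp (G (t + \<Delta>) s ?I) * r * exp (- (1 + w $ \<iota>) * \<Delta>) * \<bar>\<omega> $ K\<bar>"
      unfolding \<Omega>_def shear_None[OF that(1)] by (rule mult_right_mono) simp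
    also have "\<dots> = exp (- (1 + w $ \<iota>) * \<Delta>) * (exp (G (t + \<Delta>) s ?I) * r * \<bar>\<omega> $ K\<bar>)" by simp
    also have "\<dots> \<le> exp (- (1 + w $ \<iota>) * \<Delta>) * (2 * \<sigma>)" using 1 by (intro mult_left_mono) auto
    finally show ?thesis by simp
  qed
  \<comment> \<open>The quadratic inequality bounds the coordinates with neither index, times those
    with both, by the mixed ones, of which those with \<open>None\<close> alone are small. As
    \<open>J\<close> contains \<open>None\<close>, its coordinate may be taken at any other point
    \<open>y\<close>.\<close>
  have prod: "\<Omega> x I * \<Omega> y J \<le> 2 * N * exp (- \<Delta>) * \<sigma>\<^sup>2"
    if I: "None \<notin> I" "Some \<iota> \<notin> I" and J: "None \<in> J" "Some \<iota> \<in> J" and x: "x \<in> B" for x y I J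
  proof -
    obtain bs where bs: "\<omega> = wedge bs" using \<omega> by (auto simp: dec_def)
    let ?W = "\<Phi> (t + \<Delta>) s x \<omega>"
    have W2: "(?W $ K)\<^sup>2 = (\<Omega> x K)\<^sup>2" for K by (simp add: \<Phi>_def \<Omega>_def power_mult_distrib)
    have "(\<Omega> x I)\<^sup>2 * (\<Omega> x J)\<^sup>2
      \<le> (\<Sum>K | Some \<iota> \<notin> K \<and> None \<notin> K. (?W $ K)\<^sup>2) * (\<Sum>K | Some \<iota> \<in> K \<and> None \<in> K. (?W $ K)\<^sup>2)"
      unfolding W2 using I J by (intro mult_mono member_le_sum sum_nonneg) auto
    also have "\<dots> \<le> (\<Sum>K | Some \<iota> \<in> K \<and> None \<notin> K. (?W $ K)\<^sup>2) * (\<Sum>K | Some \<iota> \<notin> K \<and> None \<in> K. (?W $ K)\<^sup>2)"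
      by (rule wedge_pluecker[of _ _ _ "map (act1 (t + \<Delta>) s x) bs"]) (auto simp: bs \<Phi>_wedge)
    also have "\<dots> \<le> (N * \<sigma>\<^sup>2) * (N * (2 * exp (- (1 + w $ \<iota>) * \<Delta>) * \<sigma>)\<^sup>2)"
    proof (intro mult_mono)
      have le: "(\<Sum>K | P K. (?W $ K)\<^sup>2) \<le> N * c\<^sup>2" if "\<And>K. P K \<Longrightarrow> \<Omega> x K \<le> c" "0 \<le> c" for P c
      proof -
        have "(\<Sum>K | P K. (?W $ K)\<^sup>2) \<le> real (card {K. P K}) * c\<^sup>2"
          unfolding W2 using that \<Omega>0 by (intro sum_bounded_above power_mono) auto
        also have "\<dots> \<le> N * c\<^sup>2" unfolding N_def
          by (intro mult_right_mono of_nat_mono card_mono) auto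
        finally show ?thesis .
      qed
      show "(\<Sum>K | Some \<iota> \<in> K \<and> None \<notin> K. (?W $ K)\<^sup>2) \<le> N * \<sigma>\<^sup>2"
        using \<Omega>\<sigma>[OF x] \<sigma>0 by (intro le) auto
      show "(\<Sum>K | Some \<iota> \<notin> K \<and> None \<in> K. (?W $ K)\<^sup>2) \<le> N * (2 * exp (- (1 + w $ \<iota>) * \<Delta>) * \<sigma>)\<^sup>2"
        using small \<sigma>0 by (intro le) auto
    qed (use N1 in \<open>auto intro: sum_nonneg\<close>)
    also have "\<dots> = (2 * N * exp (- (1 + w $ \<iota>) * \<Delta>) * \<sigma>\<^sup>2)\<^sup>2"
      by (simp add: power_mult_distrib power2_eq_square)
    also have "\<dots> \<le> (2 * N * exp (- \<Delta>) * \<sigma>\<^sup>2)\<^sup>2"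
    proof (intro power_mono mult_right_mono mult_left_mono)
      show "exp (- (1 + w $ \<iota>) * \<Delta>) \<le> exp (- \<Delta>)" using w\<iota> \<Delta> by (simp add: algebra_simps)
    qed (use N1 in auto)
    finally have "(\<Omega> x I * \<Omega> x J)\<^sup>2 \<le> (2 * N * exp (- \<Delta>) * \<sigma>\<^sup>2)\<^sup>2" by (simp add: power_mult_distrib)
    then have "\<Omega> x I * \<Omega> x J \<le> 2 * N * exp (- \<Delta>) * \<sigma>\<^sup>2"
      by (rule power2_le_imp_le) (use N1 in auto)
    moreover have "\<Omega> y J = \<Omega> x J" using J by (simp add: \<Omega>_def shear_None)
    ultimately show ?thesis by simp
  qed
  have sq: "exp (- \<Delta>) = exp (- \<Delta> / 2) * exp (- \<Delta> / 2)" by (simp flip: exp_add)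
  \<comment> \<open>Since the product is small, either all coordinates with both indices are small
    or all those with neither. Testing the former at \<open>x0\<close> decides this for the whole
    ball.\<close>
  define caseA where "caseA \<longleftrightarrow> (\<forall>J. None \<in> J \<and> Some \<iota> \<in> J \<longrightarrow> \<Omega> x0 J \<le> 2 * N * exp (- \<Delta> / 2) * \<sigma>)"
  have A': "\<Omega> x J \<le> 2 * N * exp (- \<Delta> / 2) * \<sigma>" if caseA "None \<in> J" "Some \<iota> \<in> J" for x J
  proof -
    have "\<Omega> x J = \<Omega> x0 J" using that by (simp add: \<Omega>_def shear_None)
    then show ?thesis using that by (simp add: caseA_def)
  qed
  have B': "\<Omega> x I \<le> exp (- \<Delta> / 2) * \<sigma>" if nA: "\<not> caseA" and x: "x \<in> B" and I: "None \<notin> I" "Some \<iota> \<notin> I" for x I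
  proof (rule ccontr)
    assume "\<not> ?thesis"
    then have a: "exp (- \<Delta> / 2) * \<sigma> < \<Omega> x I" by simp
    obtain J where J: "None \<in> J" "Some \<iota> \<in> J" "2 * N * exp (- \<Delta> / 2) * \<sigma> < \<Omega> x0 J"
      using nA by (auto simp: caseA_def not_le)
    have "(exp (- \<Delta> / 2) * \<sigma>) * (2 * N * exp (- \<Delta> / 2) * \<sigma>) < \<Omega> x I * \<Omega> x0 J"
      using a J(3) \<sigma>0 N1 by (intro mult_strict_mono') auto
    also have "\<dots> \<le> 2 * N * exp (- \<Delta>) * \<sigma>\<^sup>2" using I J x by (intro prod)
    finally show False unfolding sq by (simp add: power2_eq_square mult_ac)
  qed
  \<comment> \<open>The change \<open>E\<close> of the exponent is
    \<open>\<nu> K * (h - \<Delta>)\<close> for sets with neither index and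
    \<open>(\<nu> K - 1) * (h - \<Delta>)\<close> for sets with both. The sign of
    \<open>h - \<Delta>\<close> is chosen to contract the type not known to be small; the other type
    has \<open>exp (- \<Delta> / 2)\<close> to spare.\<close>
  define h where "h = (if caseA then (1 - \<eta>) * \<Delta> else (1 + \<eta>) * \<Delta>)"
  have main: "exp (G t (s + h) K) * \<bar>shear x \<omega> $ K\<bar> \<le> 2 * N * exp (- \<eta> * wmin * \<Delta>) * \<sigma>"
    if x: "x \<in> B" for x K
  proof (cases "shear x \<omega> $ K = 0")
    case True
    then show ?thesis using N1 \<sigma>0 by simp
  next
    case False
    note K = dec_shear_support[OF \<omega> False]
    define E where "E = G t (s + h) K - G (t + \<Delta>) s K"
    have E: "exp (G t (s + h) K) * \<bar>shear x \<omega> $ K\<bar> = exp E * \<Omega> x K"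
      by (simp add: E_def \<Omega>_def exp_diff)
    have E': "E = h * (\<nu> K - w $ \<iota> * of_bool (Some \<iota> \<in> K) - (1 - w $ \<iota>) * of_bool (None \<in> K))
        - \<Delta> * (\<nu> K - of_bool (None \<in> K))" by (simp add: E_def G_eq algebra_simps)
    have fin: "exp E * \<Omega> x K \<le> 2 * N * exp (- \<eta> * wmin * \<Delta>) * \<sigma>"
      if "E + e \<le> - \<eta> * wmin * \<Delta>" "\<Omega> x K \<le> c * exp e * \<sigma>" "c \<le> 2 * N" "0 \<le> c" for e c
    proof -
      have "exp E * \<Omega> x K \<le> exp E * (c * exp e * \<sigma>)" using that by (intro mult_left_mono) auto
      also have "\<dots> = c * exp (E + e) * \<sigma>" by (simp add: exp_add)
      also have "\<dots> \<le> 2 * N * exp (- \<eta> * wmin * \<Delta>) * \<sigma>"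
        using that \<sigma>0 N1 by (intro mult_mono) auto
      finally show ?thesis .
    qed
    have h: "h - \<Delta> = \<eta> * \<Delta> \<or> h - \<Delta> = - (\<eta> * \<Delta>)" "h \<le> (1 + \<eta>) * \<Delta>" "0 \<le> h"
      using \<eta> \<eta>' \<Delta> by (auto simp: h_def algebra_simps mult_le_cancel_left1)
    have \<eta>\<Delta>: "\<eta> * wmin * \<Delta> \<le> \<Delta> / 4" "\<eta> * \<Delta> \<le> \<Delta> / 4" "0 \<le> \<eta> * \<Delta>"
      using mult_right_mono[OF \<eta>'(2), of \<Delta>] mult_right_mono[OF \<eta>'(1), of \<Delta>] \<Delta> \<eta> by auto
    have \<nu>1: "0 \<le> \<nu> K" "\<nu> K \<le> 1" using \<nu>_mono[of "{}" K] \<nu>_le_1 by (simp_all add: \<nu>_def)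
    show ?thesis unfolding E
    proof (cases "None \<in> K")
      case None: False
      have \<nu>w: "wmin \<le> \<nu> K" using \<nu>_ge_wmin K j None by auto
      show "exp E * \<Omega> x K \<le> 2 * N * exp (- \<eta> * wmin * \<Delta>) * \<sigma>"
      proof (cases "Some \<iota> \<in> K")
        case True
        have "E = h * (\<nu> K - w $ \<iota>) - \<Delta> * \<nu> K" using True None by (simp add: E')
        also have "\<dots> \<le> (1 + \<eta>) * \<Delta> * (\<nu> K - w $ \<iota>) - \<Delta> * \<nu> K"
          using h(2) \<nu>_ge[OF True] by (simp add: mult_right_mono)
        also have "\<dots> = \<Delta> * (\<eta> * \<nu> K - \<eta> * w $ \<iota> - w $ \<iota>)" by (simp add: algebra_simps)
        also have "\<dots> \<le> \<Delta> * (- (\<eta> * wmin))"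
        proof (rule mult_left_mono)
          have "\<eta> * \<nu> K \<le> \<eta>" using \<nu>1 \<eta> by simp
          moreover have "0 \<le> \<eta> * w $ \<iota>" using \<eta> w\<iota> by simp
          ultimately show "\<eta> * \<nu> K - \<eta> * w $ \<iota> - w $ \<iota> \<le> - (\<eta> * wmin)"
            using \<eta> \<eta>' w\<iota> by linarith
        qed (use \<Delta> in simp)
        finally show ?thesis using \<Omega>\<sigma>[OF x, of K] N1 by (intro fin[of 0 1]) (auto simp: mult_ac)
      next
        case False
        then have e: "E = \<nu> K * (h - \<Delta>)" using None by (simp add: E' algebra_simps)
        show ?thesis
        proof (cases caseA)
          case True
          then have "E = - (\<nu> K * (\<eta> * \<Delta>))" unfolding e h_def by (simp add: algebra_simps)
          also have "\<dots> \<le> - (wmin * (\<eta> * \<Delta>))" using \<nu>w \<eta>\<Delta> by (simp add: mult_right_mono)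
          finally show ?thesis using \<Omega>\<sigma>[OF x, of K] N1 by (intro fin[of 0 1]) (auto simp: mult_ac)
        next
          case nA: False
          then have "E = \<nu> K * (\<eta> * \<Delta>)" unfolding e h_def by (simp add: algebra_simps)
          also have "\<dots> \<le> 1 * (\<eta> * \<Delta>)" using \<nu>1 \<eta>\<Delta> by (intro mult_right_mono) auto
          finally show ?thesis using B'[OF nA x None False] N1 \<eta>\<Delta> by (intro fin[of "- \<Delta> / 2" 1]) auto
        qed
      qed
    next
      case None: True
      have \<nu>w: "\<nu> K \<le> 1 - wmin" using \<nu>_le_wmin K j None by auto
      show "exp E * \<Omega> x K \<le> 2 * N * exp (- \<eta> * wmin * \<Delta>) * \<sigma>"
      proof (cases "Some \<iota> \<in> K")
        case False
        have "E = (1 - \<nu> K) * (\<Delta> - h) + h * w $ \<iota>" using False None by (simp add: E' algebra_simps)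
        also have "\<dots> \<le> 1 * (\<eta> * \<Delta>) + (1 + \<eta>) * \<Delta> * w $ \<iota>"
        proof (intro add_mono)
          have "(1 - \<nu> K) * (\<Delta> - h) \<le> (1 - \<nu> K) * (\<eta> * \<Delta>)"
            using h(1) \<nu>1 \<eta>\<Delta>(3) by (intro mult_left_mono) auto
          also have "\<dots> \<le> 1 * (\<eta> * \<Delta>)" using \<nu>1 \<eta>\<Delta>(3) by (intro mult_right_mono) auto
          finally show "(1 - \<nu> K) * (\<Delta> - h) \<le> 1 * (\<eta> * \<Delta>)" .
          show "h * w $ \<iota> \<le> (1 + \<eta>) * \<Delta> * w $ \<iota>" using h w\<iota> by (intro mult_right_mono) auto
        qed
        finally have "E + - (1 + w $ \<iota>) * \<Delta> \<le> \<eta> * \<Delta> + \<eta> * \<Delta> * w $ \<iota> - \<Delta>" by (simp add: algebra_simps)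
        moreover have "\<eta> * \<Delta> * w $ \<iota> \<le> \<eta> * \<Delta>" using w\<iota> \<eta>\<Delta>(3) by (simp add: mult_left_le)
        ultimately show ?thesis using small[OF None False, of x] N1 \<eta>\<Delta>
          by (intro fin[of "- (1 + w $ \<iota>) * \<Delta>" 2]) auto
      next
        case True
        then have e: "E = (\<nu> K - 1) * (h - \<Delta>)" using None by (simp add: E' algebra_simps)
        show ?thesis
        proof (cases caseA)
          case cA: True
          then have "E = (1 - \<nu> K) * (\<eta> * \<Delta>)" unfolding e h_def by (simp add: algebra_simps)
          also have "\<dots> \<le> 1 * (\<eta> * \<Delta>)" using \<nu>1 \<eta>\<Delta> by (intro mult_right_mono) auto
          finally show ?thesis using A'[OF cA None True, of x] N1 \<eta>\<Delta> by (intro fin[of "- \<Delta> / 2" "2 * N"]) auto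
        next
          case nA: False
          then have "E = - ((1 - \<nu> K) * (\<eta> * \<Delta>))" unfolding e h_def by (simp add: algebra_simps)
          also have "\<dots> \<le> - (wmin * (\<eta> * \<Delta>))" using \<nu>w \<eta>\<Delta> by (simp add: mult_right_mono)
          finally show ?thesis using \<Omega>\<sigma>[OF x, of K] N1 by (intro fin[of 0 1]) (auto simp: mult_ac)
        qed
      qed
    qed
  qed
  have "norm (\<Phi> t (s + h) x \<omega>) \<le> 2 * N\<^sup>2 * exp (- \<eta> * wmin * \<Delta>) * \<sigma>" if x: "x \<in> B" for x
  proof -
    have "norm (\<Phi> t (s + h) x \<omega>) \<le> (\<Sum>K\<in>UNIV. \<bar>\<Phi> t (s + h) x \<omega> $ K\<bar>)" by (rule norm_le_l1_cart)
    also have "\<dots> \<le> real CARD('d option set) * (2 * N * exp (- \<eta> * wmin * \<Delta>) * \<sigma>)"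
      using main[OF x] by (intro sum_bounded_above) (simp add: \<Phi>_def abs_mult)
    finally show ?thesis by (simp add: N_def power2_eq_square mult_ac)
  qed
  then show ?thesis by (intro bexI[of _ h]) (auto simp: h_def)
qed

end

subsection \<open>Absolutely decaying measures\<close>

lemma closed_measure_support: "closed (measure_support \<mu>)"
proof -
  have "- measure_support \<mu> = \<Union>{U. open U \<and> emeasure \<mu> U = 0}"
    by (auto simp: measure_support_def zero_less_iff_neq_zero)
  moreover have "open (\<Union>{U. open U \<and> emeasure \<mu> U = 0})" by (intro open_Union) auto
  ultimately show ?thesis by (simp add: closed_def)
qed

lemma null_sets_compl_support:
  fixes \<mu> :: "'a::second_countable_topology measure"
  assumes [measurable_cong]: "sets \<mu> = sets borel"
  shows "- measure_support \<mu> \<in> null_sets \<mu>"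
proof -
  let ?F = "{U. open U \<and> emeasure \<mu> U = 0}"
  obtain F where F: "F \<subseteq> ?F" "countable F" "\<Union>F = \<Union>?F"
    using Lindelof[of ?F] by auto
  have "- measure_support \<mu> = \<Union>F"
    unfolding F(3) by (auto simp: measure_support_def zero_less_iff_neq_zero)
  moreover have "(\<Union>U\<in>F. U) \<in> null_sets \<mu>"
    using F by (intro null_sets_UN') (auto simp: null_sets_def assms)
  ultimately show ?thesis by simp
qed

lemma measure_support_nonempty:
  fixes \<mu> :: "'a::second_countable_topology measure"
  assumes "sets \<mu> = sets borel" "emeasure \<mu> UNIV \<noteq> 0"
  shows "measure_support \<mu> \<noteq> {}"
  using null_sets_compl_support[OF assms(1)] assms(2) by (auto simp: null_sets_def)

text \<open>A series comparable to \<open>\<phi> powr - \<gamma>\<close> on \<open>(0, 1]\<close>, and infinite at \<open>0\<close>.\<close>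

definition inv_powr :: "real \<Rightarrow> real \<Rightarrow> ennreal" where
  "inv_powr \<gamma> \<phi> = (\<Sum>k. ennreal (2 powr (\<gamma> * (real k + 1))) * of_bool (\<phi> \<le> 2 powr - real k))"

text \<open>One term suffices: the one with \<phi> between \<open>2 powr - (k + 1)\<close> and
  \<open>2 powr - k\<close>.\<close>

lemma inv_powr_ge:
  assumes "0 < \<phi>" "\<phi> \<le> 1" "0 \<le> \<gamma>"
  shows "ennreal (\<phi> powr - \<gamma>) \<le> inv_powr \<gamma> \<phi>"
proof -
  define k where "k = nat \<lfloor>- log 2 \<phi>\<rfloor>"
  have l: "0 \<le> - log 2 \<phi>" using assms by (simp add: log_le_zero_cancel_iff)
  then have k: "real k \<le> - log 2 \<phi>" "- log 2 \<phi> < real k + 1" unfolding k_def by linarith+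
  have \<phi>: "\<phi> = 2 powr (log 2 \<phi>)" using assms by simp
  have 1: "\<phi> \<le> 2 powr - real k" by (subst \<phi>) (use k in simp)
  have "\<phi> powr - \<gamma> = 2 powr (log 2 \<phi> * - \<gamma>)" by (subst \<phi>) (simp only: powr_powr)
  also have "\<dots> \<le> 2 powr (\<gamma> * (real k + 1))"
    using k(2) assms mult_left_mono[of "- log 2 \<phi>" "real k + 1" \<gamma>] by (simp add: mult.commute)
  finally have "ennreal (\<phi> powr - \<gamma>) \<le> ennreal (2 powr (\<gamma> * (real k + 1))) * of_bool (\<phi> \<le> 2 powr - real k)"
    using 1 by (simp add: ennreal_leI)
  also have "\<dots> \<le> inv_powr \<gamma> \<phi>"
    unfolding inv_powr_def
    using sum_le_suminf[of "\<lambda>k. ennreal (2 powr (\<gamma> * (real k + 1))) * of_bool (\<phi> \<le> 2 powr - real k)" "{k}"]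
    by auto
  finally show ?thesis .
qed

text \<open>The reason for using a series: \<open>0 powr - \<gamma>\<close> is 0, whereas a zero of
  \<phi> has to make the potential infinite.\<close>

lemma inv_powr_0:
  assumes "\<phi> \<le> 0" "0 \<le> \<gamma>"
  shows "inv_powr \<gamma> \<phi> = top"
proof -
  have "of_nat n \<le> inv_powr \<gamma> \<phi>" for n
  proof -
    have "of_nat n = (\<Sum>k<n. (1 :: ennreal))" by simp
    also have "\<dots> \<le> (\<Sum>k<n. ennreal (2 powr (\<gamma> * (real k + 1))) * of_bool (\<phi> \<le> 2 powr - real k))"
    proof (rule sum_mono)
      fix k
      have "\<phi> \<le> 2 powr - real k" using assms(1) by (simp add: order_trans[of _ 0])
      moreover have "1 \<le> 2 powr (\<gamma> * (real k + 1))" using assms by (intro ge_one_powr_ge_zero) auto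
      ultimately show "1 \<le> ennreal (2 powr (\<gamma> * (real k + 1))) * of_bool (\<phi> \<le> 2 powr - real k)"
        using ennreal_leI[of 1 "2 powr (\<gamma> * (real k + 1))"] by simp
    qed
    also have "\<dots> \<le> inv_powr \<gamma> \<phi>" unfolding inv_powr_def by (rule sum_le_suminf) auto
    finally show ?thesis .
  qed
  then show ?thesis using ennreal_Ex_less_of_nat[of "inv_powr \<gamma> \<phi>"] by (metis top.not_eq_extremum not_le)
qed

definition normalized_affine :: "'a::real_inner set \<Rightarrow> ('a \<Rightarrow> real) \<Rightarrow> bool" where
  "normalized_affine B \<phi> \<longleftrightarrow> (\<exists>a b z. z \<in> B \<and> b + a \<bullet> z \<noteq> 0 \<and>
    (\<forall>y\<in>B. \<bar>b + a \<bullet> y\<bar> \<le> \<bar>b + a \<bullet> z\<bar>) \<and> \<phi> = (\<lambda>y. \<bar>b + a \<bullet> y\<bar> / \<bar>b + a \<bullet> z\<bar>))"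

lemma normalized_affine_bounds:
  assumes "normalized_affine B \<phi>" "y \<in> B"
  shows "0 \<le> \<phi> y" "\<phi> y \<le> 1"
  using assms by (auto simp: normalized_affine_def)

lemma normalized_affine_measurable:
  "normalized_affine B (\<phi> :: 'a::euclidean_space \<Rightarrow> real) \<Longrightarrow> \<phi> \<in> borel_measurable borel"
  by (auto simp: normalized_affine_def)

section \<open>Consequences of absolute decay for affine functions\<close>

locale decaying_measure =
  fixes \<mu> :: "'a::euclidean_space measure" and D \<delta> \<rho> :: real
  assumes sets_borel: "sets \<mu> = sets borel" and D: "0 < D" and \<delta>: "0 < \<delta>" and \<rho>: "0 < \<rho>"
    and finite_ball: "\<And>x r. x \<in> measure_support \<mu> \<Longrightarrow> 0 < r \<Longrightarrow> r \<le> \<rho> \<Longrightarrow> emeasure \<mu> (cball x r) < top"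
    and decay: "\<And>x r H r'. x \<in> measure_support \<mu> \<Longrightarrow> 0 < r \<Longrightarrow> r \<le> \<rho> \<Longrightarrow> hyperplane H \<Longrightarrow> 0 < r' \<Longrightarrow>
      emeasure \<mu> (closed_nbhd H r' \<inter> cball x r) \<le> ennreal (D * (r' / r) powr \<delta>) * emeasure \<mu> (cball x r)"
begin

lemma sets_closed [measurable]: "closed X \<Longrightarrow> X \<in> sets \<mu>"
  by (simp add: sets_borel)

lemma ball_pos: "x \<in> measure_support \<mu> \<Longrightarrow> 0 < r \<Longrightarrow> 0 < emeasure \<mu> (cball x r)"
proof -
  assume "x \<in> measure_support \<mu>" "0 < r"
  then have "0 < emeasure \<mu> (ball x r)" by (auto simp: measure_support_def)
  also have "\<dots> \<le> emeasure \<mu> (cball x r)" by (intro emeasure_mono) (auto simp: sets_borel)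
  finally show ?thesis .
qed

text \<open>The first summand serves slabs around a hyperplane, of width up to
  \<open>4 * \<epsilon>\<close> relative to the radius; the second makes the bound trivial once
  \<epsilon> is at least 1/2.\<close>

definition C :: real where "C = D * 4 powr \<delta> + 2 powr \<delta>"

lemma C_pos: "0 < C"
  using D by (simp add: C_def add_pos_pos)

lemma slab:
  assumes x: "x \<in> measure_support \<mu>" and r: "0 < r" "r \<le> \<rho>"
    and \<phi>: "normalized_affine (cball x r) \<phi>" and \<epsilon>: "0 < \<epsilon>"
  shows "emeasure \<mu> {y \<in> cball x r. \<phi> y \<le> \<epsilon>} \<le> ennreal (C * \<epsilon> powr \<delta>) * emeasure \<mu> (cball x r)"
proof -
  let ?B = "cball x r"
  obtain a b z where z: "z \<in> ?B" "b + a \<bullet> z \<noteq> 0" "\<And>y. y \<in> ?B \<Longrightarrow> \<bar>b + a \<bullet> y\<bar> \<le> \<bar>b + a \<bullet> z\<bar>"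
    and \<phi>_eq: "\<phi> = (\<lambda>y. \<bar>b + a \<bullet> y\<bar> / \<bar>b + a \<bullet> z\<bar>)"
    using \<phi> by (auto simp: normalized_affine_def)
  define \<sigma> where "\<sigma> = \<bar>b + a \<bullet> z\<bar>"
  have \<sigma>: "0 < \<sigma>" using z by (simp add: \<sigma>_def)
  have slab_eq: "{y \<in> ?B. \<phi> y \<le> \<epsilon>} = {y \<in> ?B. \<bar>b + a \<bullet> y\<bar> \<le> \<epsilon> * \<sigma>}"
    using \<sigma> by (simp add: \<phi>_eq \<sigma>_def pos_divide_le_eq)
  have le: "ennreal c * emeasure \<mu> ?B \<le> ennreal c' * emeasure \<mu> ?B" if "c \<le> c'" for c c'
    using that by (intro mult_right_mono ennreal_leI) auto
  \<comment> \<open>With a small gradient the function exceeds half its maximum on the whole ball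
    and the slab is empty. With a large one the slab lies within \<open>4 * \<epsilon> * r\<close>
    of the zero hyperplane.\<close>
  consider "1 / 2 \<le> \<epsilon>" | "\<epsilon> < 1 / 2" "r * norm a < \<sigma> / 4" | "\<sigma> / 4 \<le> r * norm a" by linarith
  then show ?thesis
  proof cases
    case 1
    have "emeasure \<mu> {y \<in> ?B. \<phi> y \<le> \<epsilon>} \<le> ennreal 1 * emeasure \<mu> ?B"
      unfolding ennreal_1 mult_1 by (intro emeasure_mono) auto
    also have "\<dots> \<le> ennreal (C * \<epsilon> powr \<delta>) * emeasure \<mu> ?B"
    proof (rule le)
      have "1 \<le> (2 * \<epsilon>) powr \<delta>" using 1 \<delta> by (intro ge_one_powr_ge_zero) auto
      also have "\<dots> = 2 powr \<delta> * \<epsilon> powr \<delta>" using \<epsilon> by (simp add: powr_mult)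
      also have "\<dots> \<le> C * \<epsilon> powr \<delta>" using D by (intro mult_right_mono) (auto simp: C_def)
      finally show "1 \<le> C * \<epsilon> powr \<delta>" .
    qed
    finally show ?thesis .
  next
    case 2
    have "{y \<in> ?B. \<phi> y \<le> \<epsilon>} = {}"
    proof -
      have "\<epsilon> * \<sigma> < \<bar>b + a \<bullet> y\<bar>" if y: "y \<in> ?B" for y
      proof -
        have "dist y z \<le> dist x y + dist x z" by (metis dist_commute dist_triangle)
        then have d: "norm (y - z) \<le> 2 * r" using y z(1) by (simp add: dist_norm)
        have "\<bar>a \<bullet> (y - z)\<bar> \<le> norm a * norm (y - z)" by (rule Cauchy_Schwarz_ineq2)
        also have "\<dots> \<le> norm a * (2 * r)" using d by (intro mult_left_mono) auto
        also have "\<dots> = 2 * (r * norm a)" by simp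
        finally have "\<bar>(b + a \<bullet> y) - (b + a \<bullet> z)\<bar> < \<sigma> / 2" using 2(2) by (simp add: inner_diff_right)
        then have "\<sigma> / 2 < \<bar>b + a \<bullet> y\<bar>"
          using abs_triangle_ineq2_sym[of "b + a \<bullet> z" "b + a \<bullet> y"] unfolding \<sigma>_def[symmetric] by simp
        moreover have "\<epsilon> * \<sigma> < 1 / 2 * \<sigma>" using 2(1) \<sigma> by (rule mult_strict_right_mono)
        ultimately show ?thesis by simp
      qed
      then show ?thesis unfolding slab_eq by (auto simp flip: not_less)
    qed
    then show ?thesis by (simp only: emeasure_empty) simp
  next
    case 3
    then have a: "a \<noteq> 0" using \<sigma> by auto
    define H where "H = {y. a \<bullet> y = - b}"
    have H: "hyperplane H" using a by (auto simp: hyperplane_def H_def)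
    define r' where "r' = \<epsilon> * \<sigma> / norm a"
    have r': "0 < r'" using \<epsilon> \<sigma> a by (simp add: r'_def)
    have "infdist y H \<le> r'" if "\<bar>b + a \<bullet> y\<bar> \<le> \<epsilon> * \<sigma>" for y
    proof -
      let ?p = "y - ((b + a \<bullet> y) / (a \<bullet> a)) *\<^sub>R a"
      have "?p \<in> H" using a by (simp add: H_def inner_diff_right)
      then have "infdist y H \<le> dist y ?p" by (rule infdist_le)
      also have "\<dots> = \<bar>b + a \<bullet> y\<bar> / norm a"
        using a by (simp add: dist_norm abs_mult power2_norm_eq_inner[symmetric] power2_eq_square)
      also have "\<dots> \<le> r'" using that a by (simp add: r'_def divide_right_mono)
      finally show ?thesis .
    qed
    then have "{y \<in> ?B. \<phi> y \<le> \<epsilon>} \<subseteq> closed_nbhd H r' \<inter> ?B"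
      unfolding slab_eq by (auto simp: closed_nbhd_def)
    moreover have "closed (closed_nbhd H r')"
      unfolding closed_nbhd_def by (intro closed_Collect_le continuous_intros)
    ultimately have "emeasure \<mu> {y \<in> ?B. \<phi> y \<le> \<epsilon>} \<le> emeasure \<mu> (closed_nbhd H r' \<inter> ?B)"
      by (intro emeasure_mono) auto
    also have "\<dots> \<le> ennreal (D * (r' / r) powr \<delta>) * emeasure \<mu> ?B"
      using x r H r' by (rule decay)
    also have "\<dots> \<le> ennreal (C * \<epsilon> powr \<delta>) * emeasure \<mu> ?B"
    proof (rule le)
      have "r' / r \<le> 4 * \<epsilon>"
        using 3 a r \<epsilon> mult_left_mono[of \<sigma> "4 * (r * norm a)" \<epsilon>] by (simp add: r'_def field_simps)
      then have "(r' / r) powr \<delta> \<le> (4 * \<epsilon>) powr \<delta>" using r' r \<delta> by (intro powr_mono2) auto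
      also have "\<dots> = 4 powr \<delta> * \<epsilon> powr \<delta>" using \<epsilon> by (simp add: powr_mult)
      finally have "D * (r' / r) powr \<delta> \<le> D * (4 powr \<delta> * \<epsilon> powr \<delta>)" using D by (intro mult_left_mono) auto
      also have "\<dots> \<le> C * \<epsilon> powr \<delta>" by (simp add: C_def algebra_simps)
      finally show "D * (r' / r) powr \<delta> \<le> C * \<epsilon> powr \<delta>" .
    qed
    finally show ?thesis .
  qed
qed

text \<open>A geometric series: the exponent \<open>\<delta> / 2\<close> of \<open>inv_powr\<close>
  against the decay exponent \<delta> leaves the ratio
  \<open>2 powr (- \<delta> / 2)\<close>.\<close>

definition M :: real where "M = C * 2 powr (\<delta> / 2) / (1 - 2 powr (- \<delta> / 2))"

lemma M_pos: "0 < M"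
proof -
  have "2 powr (- \<delta> / 2) < 2 powr (0 :: real)" using \<delta> by (intro powr_less_mono) auto
  then show ?thesis using C_pos by (simp add: M_def)
qed

lemma nn_integral_inv_powr:
  assumes x: "x \<in> measure_support \<mu>" and r: "0 < r" "r \<le> \<rho>"
    and \<phi>: "normalized_affine (cball x r) \<phi>"
  shows "(\<integral>\<^sup>+y. inv_powr (\<delta> / 2) (\<phi> y) * indicator (cball x r) y \<partial>\<mu>) \<le> ennreal M * emeasure \<mu> (cball x r)"
proof -
  let ?B = "cball x r" and ?\<gamma> = "\<delta> / 2" and ?q = "2 powr (- \<delta> / 2)"
  have [measurable]: "\<phi> \<in> borel_measurable \<mu>"
    using normalized_affine_measurable[OF \<phi>] by (simp add: measurable_cong_sets[OF sets_borel])
  have q: "0 < ?q" "?q < 1"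
  proof -
    have "?q < 2 powr (0 :: real)" using \<delta> by (intro powr_less_mono) auto
    then show "0 < ?q" "?q < 1" by auto
  qed
  have meas: "{y \<in> ?B. \<phi> y \<le> e} \<in> sets \<mu>" for e
  proof -
    have "{y \<in> ?B. \<phi> y \<le> e} = ?B \<inter> (\<phi> -` {..e} \<inter> space \<mu>)"
      using sets_eq_imp_space_eq[OF sets_borel] by auto
    then show ?thesis by simp
  qed
  have "inv_powr ?\<gamma> (\<phi> y) * indicator ?B y
    = (\<Sum>k. ennreal (2 powr (?\<gamma> * (real k + 1))) * indicator {y \<in> ?B. \<phi> y \<le> 2 powr - real k} y)" for y
    unfolding inv_powr_def ennreal_suminf_multc[symmetric]
    by (intro suminf_cong) (auto simp: indicator_def)
  then have "(\<integral>\<^sup>+y. inv_powr ?\<gamma> (\<phi> y) * indicator ?B y \<partial>\<mu>)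
    = (\<Sum>k. \<integral>\<^sup>+y. ennreal (2 powr (?\<gamma> * (real k + 1))) * indicator {y \<in> ?B. \<phi> y \<le> 2 powr - real k} y \<partial>\<mu>)"
    using meas by (simp add: nn_integral_suminf)
  also have "\<dots> = (\<Sum>k. ennreal (2 powr (?\<gamma> * (real k + 1))) * emeasure \<mu> {y \<in> ?B. \<phi> y \<le> 2 powr - real k})"
    using meas by (simp add: nn_integral_cmult_indicator)
  also have "\<dots> \<le> (\<Sum>k. ennreal (C * 2 powr ?\<gamma> * ?q ^ k) * emeasure \<mu> ?B)"
  proof (rule suminf_le)
    fix k
    have "ennreal (2 powr (?\<gamma> * (real k + 1))) * emeasure \<mu> {y \<in> ?B. \<phi> y \<le> 2 powr - real k}
      \<le> ennreal (2 powr (?\<gamma> * (real k + 1))) * (ennreal (C * (2 powr - real k) powr \<delta>) * emeasure \<mu> ?B)"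
      by (intro mult_left_mono slab x r \<phi>) auto
    also have "\<dots> = ennreal (2 powr (?\<gamma> * (real k + 1)) * (C * (2 powr - real k) powr \<delta>)) * emeasure \<mu> ?B"
      using C_pos by (simp add: ennreal_mult mult.assoc)
    also have "2 powr (?\<gamma> * (real k + 1)) * (C * (2 powr - real k) powr \<delta>) = C * 2 powr ?\<gamma> * ?q ^ k"
    proof -
      have "?q ^ k = 2 powr (real k * (- \<delta> / 2))" by (simp add: powr_powr mult.commute flip: powr_realpow)
      moreover have "2 powr (?\<gamma> * (real k + 1)) * (2 powr - real k) powr \<delta> = 2 powr ?\<gamma> * 2 powr (real k * (- \<delta> / 2))"
        by (simp add: powr_powr field_simps flip: powr_add)
      ultimately show ?thesis by simp
    qed
    finally show "ennreal (2 powr (?\<gamma> * (real k + 1))) * emeasure \<mu> {y \<in> ?B. \<phi> y \<le> 2 powr - real k}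
      \<le> ennreal (C * 2 powr ?\<gamma> * ?q ^ k) * emeasure \<mu> ?B" .
  qed auto
  also have "\<dots> = (\<Sum>k. ennreal (C * 2 powr ?\<gamma> * ?q ^ k)) * emeasure \<mu> ?B"
    by (rule ennreal_suminf_multc)
  also have "(\<Sum>k. ennreal (C * 2 powr ?\<gamma> * ?q ^ k)) = ennreal M"
  proof (rule suminf_ennreal_eq)
    show "(\<lambda>k. C * 2 powr ?\<gamma> * ?q ^ k) sums M"
      using sums_mult[OF geometric_sums[of ?q], of "C * 2 powr ?\<gamma>"] q by (simp add: M_def)
  qed (use C_pos q in auto)
  finally show ?thesis .
qed

text \<open>The width is such that each slab has at most a quarter of the measure of the ball, which
  is positive and finite.\<close>

lemma avoid_two_slabs:
  assumes x: "x \<in> measure_support \<mu>" and r: "0 < r" "r \<le> \<rho>"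
    and \<phi>: "normalized_affine (cball x r) \<phi>" and \<psi>: "normalized_affine (cball x r) \<psi>"
  shows "\<exists>y\<in>cball x r. (1 / (4 * C)) powr (1 / \<delta>) < \<phi> y \<and> (1 / (4 * C)) powr (1 / \<delta>) < \<psi> y"
proof (rule ccontr)
  let ?B = "cball x r" and ?\<epsilon> = "(1 / (4 * C)) powr (1 / \<delta>)"
  have \<epsilon>: "0 < ?\<epsilon>" "C * ?\<epsilon> powr \<delta> = 1 / 4" using C_pos \<delta> by (auto simp: powr_powr)
  assume "\<not> ?thesis"
  then have cover: "?B = {y \<in> ?B. \<phi> y \<le> ?\<epsilon>} \<union> {y \<in> ?B. \<psi> y \<le> ?\<epsilon>}" by (auto simp: not_less)
  have meas: "{y \<in> ?B. f y \<le> e} \<in> sets \<mu>" if "normalized_affine ?B f" for f e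
  proof -
    have "f \<in> borel_measurable borel" using that by (rule normalized_affine_measurable)
    then have "?B \<inter> (f -` {..e} \<inter> space borel) \<in> sets borel" by measurable
    moreover have "{y \<in> ?B. f y \<le> e} = ?B \<inter> (f -` {..e} \<inter> space borel)" by auto
    ultimately show ?thesis by (simp add: sets_borel)
  qed
  have "emeasure \<mu> ?B \<le> emeasure \<mu> {y \<in> ?B. \<phi> y \<le> ?\<epsilon>} + emeasure \<mu> {y \<in> ?B. \<psi> y \<le> ?\<epsilon>}"
    by (subst cover) (intro emeasure_subadditive meas \<phi> \<psi>)
  also have "\<dots> \<le> ennreal (1 / 4) * emeasure \<mu> ?B + ennreal (1 / 4) * emeasure \<mu> ?B"
    using slab[OF x r \<phi> \<epsilon>(1)] slab[OF x r \<psi> \<epsilon>(1)] unfolding \<epsilon>(2) by (rule add_mono)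
  also have "\<dots> = ennreal (1 / 2) * emeasure \<mu> ?B"
    by (simp flip: distrib_right ennreal_plus)
  also have "\<dots> < 1 * emeasure \<mu> ?B"
    using ball_pos[OF x r(1)] finite_ball[OF x r]
    by (intro ennreal_mult_strict_right_mono ennreal_lessI[of 1, unfolded ennreal_1]) (auto simp: less_top)
  finally show False by simp
qed

text \<open>First moment argument: the average over the ball is less than 1. As the complement of
  the support is null, the point can be found in the support.\<close>

lemma select_point:
  fixes \<phi> :: "nat \<Rightarrow> nat \<Rightarrow> 'a \<Rightarrow> real" and c :: "nat \<Rightarrow> nat \<Rightarrow> ennreal"
  assumes x: "x \<in> measure_support \<mu>" and r: "0 < r" "r \<le> \<rho>" and J: "finite J"
    and \<phi>: "\<And>j l. normalized_affine (cball x r) (\<phi> j l)"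
    and small: "\<theta> + ennreal M * (\<Sum>j\<in>J. \<Sum>l. c j l) < 1"
  shows "\<exists>y\<in>cball x r \<inter> measure_support \<mu>. \<theta> + (\<Sum>j\<in>J. \<Sum>l. c j l * inv_powr (\<delta> / 2) (\<phi> j l y)) \<le> 1"
proof (rule ccontr)
  let ?B = "cball x r" and ?I = "\<lambda>j l y. inv_powr (\<delta> / 2) (\<phi> j l y)"
  assume "\<not> ?thesis"
  then have gt: "1 \<le> \<theta> + (\<Sum>j\<in>J. \<Sum>l. c j l * ?I j l y)" if "y \<in> ?B \<inter> measure_support \<mu>" for y
    using that by (meson le_cases)
  have [measurable]: "\<phi> j l \<in> borel_measurable \<mu>" for j l
    using normalized_affine_measurable[OF \<phi>] by (simp add: measurable_cong_sets[OF sets_borel])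
  have [measurable]: "?I j l \<in> borel_measurable \<mu>" for j l
    unfolding inv_powr_def by measurable
  have B[measurable]: "?B \<in> sets \<mu>" by simp
  have supp: "measure_support \<mu> \<in> sets \<mu>" using closed_measure_support by (rule sets_closed)
  have "emeasure \<mu> ?B = emeasure \<mu> (?B \<inter> measure_support \<mu>)"
  proof -
    have "emeasure \<mu> (?B - - measure_support \<mu>) = emeasure \<mu> ?B"
      using null_sets_compl_support[OF sets_borel] by (intro emeasure_Diff_null_set) auto
    moreover have "?B - - measure_support \<mu> = ?B \<inter> measure_support \<mu>" by auto
    ultimately show ?thesis by simp
  qed
  also have "\<dots> = (\<integral>\<^sup>+y. indicator (?B \<inter> measure_support \<mu>) y \<partial>\<mu>)"
    using supp by (intro nn_integral_indicator[symmetric]) auto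
  also have "\<dots> \<le> (\<integral>\<^sup>+y. \<theta> * indicator ?B y + (\<Sum>j\<in>J. \<Sum>l. c j l * (?I j l y * indicator ?B y)) \<partial>\<mu>)"
  proof (rule nn_integral_mono)
    fix y
    show "indicator (?B \<inter> measure_support \<mu>) y
      \<le> \<theta> * indicator ?B y + (\<Sum>j\<in>J. \<Sum>l. c j l * (?I j l y * indicator ?B y))"
      using gt[of y] by (cases "y \<in> ?B \<inter> measure_support \<mu>") auto
  qed
  also have "\<dots> = \<theta> * emeasure \<mu> ?B + (\<Sum>j\<in>J. \<Sum>l. c j l * (\<integral>\<^sup>+y. ?I j l y * indicator ?B y \<partial>\<mu>))"
    by (simp add: nn_integral_add nn_integral_sum nn_integral_suminf nn_integral_cmult nn_integral_cmult_indicator)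
  also have "\<dots> \<le> \<theta> * emeasure \<mu> ?B + (\<Sum>j\<in>J. \<Sum>l. c j l * (ennreal M * emeasure \<mu> ?B))"
    by (intro add_left_mono sum_mono suminf_le mult_left_mono nn_integral_inv_powr x r \<phi>) auto
  also have "\<dots> = (\<theta> + ennreal M * (\<Sum>j\<in>J. \<Sum>l. c j l)) * emeasure \<mu> ?B"
    by (simp add: ennreal_suminf_multc distrib_right mult.assoc mult.commute[of "ennreal M"]
        flip: sum_distrib_right)
  also have "\<dots> < 1 * emeasure \<mu> ?B"
    using ball_pos[OF x r(1)] finite_ball[OF x r] small
    by (intro ennreal_mult_strict_right_mono) (auto simp: less_top)
  finally show False by simp
qed

end

subsection \<open>Construction of a badly approximable point\<close>

lemma sum_const_ennreal: "0 \<le> X \<Longrightarrow> (\<Sum>j\<in>{1..m}. ennreal X) = ennreal (real m * X)"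
  by (subst sum_ennreal) auto

lemma suminf_shift_le: "(\<Sum>l. a (l + n)) \<le> (\<Sum>l. a l :: ennreal)"
proof (rule suminf_le_const)
  fix i
  have "(\<Sum>l<i. a (l + n)) = (\<Sum>l\<in>(\<lambda>l. l + n) ` {..<i}. a l)" by (simp add: sum.reindex)
  also have "\<dots> \<le> suminf a" by (rule sum_le_suminf) auto
  finally show "(\<Sum>l<i. a (l + n)) \<le> suminf a" .
qed auto

text \<open>\<open>\<Gamma>_small\<close> lets the gain of one step beat the averaging constant
  \<open>M\<close>; its leading factor 2 counts the two possible shifts of \<open>s\<close>.
  \<Theta> keeps the share of the thresholds below 1/4, and \<open>t0\<close> makes the balls small
  enough for decay. \<epsilon> is chosen last: its third condition gives the uniqueness of dangerous
  subspaces, the fourth the initial bound.\<close>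

locale bad_construction = weighted_flow w \<iota> + decaying_measure \<mu> D \<delta> \<rho>
  for w :: "real ^ 'd" and \<iota> and \<mu> :: "(real ^ 'd) measure" and D \<delta> \<rho> +
  fixes k :: nat and \<Delta> \<Theta> \<epsilon> t0 :: real
  assumes k: "4 \<le> real k * wmin"
    and \<Delta>: "0 < \<Delta>" "exp (- \<Delta>) \<le> 1 / 2"
    and \<Gamma>_small: "2 * M * (2 * (real CARD('d option set))\<^sup>2 * exp (- (wmin / k) * \<Delta> / 2)) powr (\<delta> / 2) \<le> 1 / 2"
    and \<Theta>: "0 < \<Theta>" "real m * (\<Theta> powr - (\<delta> / 2)
      / (1 - exp (- (wmin / k / (4 * (real m + 1)\<^sup>2)) * (\<Delta> / k) / 2 * (\<delta> / 2)))) \<le> 1 / 4"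
    and \<epsilon>: "0 < \<epsilon>" "\<epsilon> \<le> 1"
      "\<epsilon> * (exp \<Delta> * (1 + 4 * exp ((1 + w $ \<iota>) * \<Delta>)) * \<Theta>)
        < min 1 ((1 / (4 * C)) powr (1 / \<delta>) / real CARD('d option set))"
      "real m * ((2 * \<epsilon> / exp (- (1 + w $ \<iota>) * t0)) powr (\<delta> / 2)
        / (1 - exp (- (wmin / k / (4 * (real m + 1)\<^sup>2)) * (\<Delta> / k) * (\<delta> / 2)))) \<le> 1"
    and t0: "0 \<le> t0" "exp (- (1 + w $ \<iota>) * t0) \<le> \<rho>"
begin

section \<open>Derived constants and the potential\<close>

abbreviation \<gamma> :: real where "\<gamma> \<equiv> \<delta> / 2"
definition N :: real where "N = real CARD('d option set)"
definition c :: real where "c = wmin / k"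
text \<open>So slow a discount that, in every rank, a shift by \<open>k + 1\<close> grid steps costs
  at most \<open>exp (c * \<Delta> / 2)\<close>; see \<open>e_shift\<close>.\<close>

definition \<kappa> :: real where "\<kappa> = c / (4 * (real m + 1)\<^sup>2)"
text \<open>The grid width for \<open>s\<close>: with \<open>\<eta> = 1 / k\<close> the two shifts
  in \<open>\<Phi>_contraction\<close> are \<open>k - 1\<close> and \<open>k + 1\<close>
  steps.\<close>

definition \<zeta> :: real where "\<zeta> = \<Delta> / k"
definition q :: "nat \<Rightarrow> nat" where "q j = j * (m + 1 - j)"
definition u :: "nat \<Rightarrow> real" where "u l = \<epsilon> * exp (- \<kappa> * \<zeta> * real l)"
definition e :: "nat \<Rightarrow> nat \<Rightarrow> real" where "e j l = u l ^ q j"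
text \<open>The factor growing with \<open>l\<close> makes the sum in \<open>threshold_sum\<close>
  geometric. Its square is still outweighed by the two powers of \<open>u l\<close> that
  \<open>q_concave\<close> provides.\<close>

definition \<tau> :: "nat \<Rightarrow> nat \<Rightarrow> real" where "\<tau> j l = \<Theta> * e j l * exp (\<kappa> * \<zeta> * real l / 2)"
definition rad :: "real \<Rightarrow> real" where "rad t = exp (- (1 + w $ \<iota>) * t)"
text \<open>The loss of a subspace that is not dangerous: \<open>exp \<Delta>\<close> for the
  elapsed time, the other factor for restricting an affine map to a smaller ball.\<close>

definition drop :: real where "drop = exp \<Delta> * (1 + 4 * exp ((1 + w $ \<iota>) * \<Delta>))"
text \<open>The reciprocal of the factor in \<open>\<Phi>_contraction\<close> for
  \<open>\<eta> = 1 / k\<close>.\<close>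

definition gain :: real where "gain = exp (c * \<Delta>) / (2 * N\<^sup>2)"
text \<open>\<open>exp (c * \<Delta> / 2) / gain\<close>, the gain less the cost of the shift,
  raised to the exponent of the potential.\<close>

definition \<Gamma> :: real where "\<Gamma> = (2 * N\<^sup>2 * exp (- c * \<Delta> / 2)) powr \<gamma>"

definition bounded_below :: "real \<Rightarrow> real ^ 'd \<Rightarrow> nat \<Rightarrow> nat \<Rightarrow> real \<Rightarrow> bool" where
  "bounded_below t x j l b \<longleftrightarrow> (\<forall>\<omega>\<in>dec j. \<exists>x'\<in>cball x (rad t). b \<le> norm (\<Phi> t (real l * \<zeta>) x' \<omega>))"

text \<open>\<open>b j l\<close> bounds from below the size, at the parameter \<open>s = l * \<zeta>\<close>, of all integral subspaces of rank
  \<open>j\<close>. The sum being at most \<open>1\<close> forces \<open>e j l \<le> b j l\<close>.\<close>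

definition good :: "real \<Rightarrow> real ^ 'd \<Rightarrow> bool" where
  "good t x \<longleftrightarrow> x \<in> measure_support \<mu> \<and>
    (\<exists>b. (\<forall>j\<in>{1..m}. \<forall>l. 0 < b j l \<and> bounded_below t x j l (b j l)) \<and>
      (\<Sum>j\<in>{1..m}. \<Sum>l. ennreal ((e j l / b j l) powr \<gamma>)) \<le> 1)"

lemma k_pos: "0 < real k"
  using k wmin_pos by (metis mult_le_0_iff not_le not_numeral_le_zero of_nat_0_le_iff order_trans zero_less_mult_pos2 less_le_trans zero_less_numeral)

lemma k_ge: "4 \<le> k"
proof -
  have "real k * wmin \<le> real k * 1" using wmin_le_1 by (intro mult_left_mono) auto
  then show ?thesis using k by simp
qed

lemma constants_pos: "0 < c" "0 < \<kappa>" "0 < \<zeta>" "0 < rad t" "1 \<le> N" "0 < gain" "0 < drop" "0 \<le> \<Gamma>" "0 < \<gamma>"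
proof -
  show N: "1 \<le> N" unfolding N_def using zero_less_card_finite[where 'a = "'d option set"] by linarith
  show c: "0 < c" using wmin_pos k_pos by (simp add: c_def)
  show "0 < \<kappa>" using c by (simp add: \<kappa>_def)
  show "0 < \<zeta>" using \<Delta> k_pos by (simp add: \<zeta>_def)
  show "0 < rad t" by (simp add: rad_def)
  show "0 < gain" using N by (simp add: gain_def)
  show "0 < drop" by (simp add: drop_def add_pos_pos)
  show "0 \<le> \<Gamma>" by (simp add: \<Gamma>_def)
  show "0 < \<gamma>" using \<delta> by simp
qed

lemma k\<zeta>: "real k * \<zeta> = \<Delta>"
  using k_pos by (simp add: \<zeta>_def)

lemma u_pos: "0 < u l" and u_le: "u l \<le> \<epsilon>" and u_le_1: "u l \<le> 1"
proof -
  show "0 < u l" using \<epsilon> by (simp add: u_def)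
  have "\<epsilon> * exp (- \<kappa> * \<zeta> * real l) \<le> \<epsilon> * 1"
    using \<epsilon> constants_pos by (intro mult_left_mono) auto
  then show "u l \<le> \<epsilon>" by (simp add: u_def)
  then show "u l \<le> 1" using \<epsilon> by simp
qed

lemma e_pos: "0 < e j l" and e_le_1: "e j l \<le> 1" and e_extreme: "j = 0 \<or> j = Suc m \<Longrightarrow> e j l = 1"
  using u_pos[of l] u_le_1[of l] by (auto simp: e_def q_def power_le_one)

lemma \<tau>_pos: "0 < \<tau> j l"
  using \<Theta> e_pos by (simp add: \<tau>_def)

lemma e_shift:
  assumes "j \<le> m" "n \<le> k + 1"
  shows "e j l \<le> exp (c * \<Delta> / 2) * e j (l + n)"
proof -
  have q: "real (q j) \<le> (real m + 1)\<^sup>2"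
  proof -
    have "q j \<le> (m + 1) * (m + 1)" unfolding q_def using assms by (intro mult_mono) auto
    then have "real (q j) \<le> real ((m + 1) * (m + 1))" by (rule of_nat_mono)
    then show ?thesis by (simp only: power2_eq_square of_nat_mult of_nat_add of_nat_1)
  qed
  have n: "\<zeta> * real n \<le> 2 * \<Delta>"
  proof -
    have "\<zeta> * real n \<le> \<zeta> * (2 * real k)" using assms(2) k_ge constants_pos by (intro mult_left_mono) auto
    then show ?thesis using k\<zeta> by (simp add: mult_ac)
  qed
  have "\<kappa> * (\<zeta> * real n) * real (q j) \<le> \<kappa> * (2 * \<Delta>) * (real m + 1)\<^sup>2"
    using constants_pos \<Delta> by (intro mult_mono[OF mult_left_mono[OF n] q]) auto
  also have "\<dots> = c * \<Delta> / 2" by (simp add: \<kappa>_def field_simps)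
  finally have x: "exp (\<kappa> * (\<zeta> * real n) * real (q j)) \<le> exp (c * \<Delta> / 2)" by simp
  have "u l = exp (\<kappa> * (\<zeta> * real n)) * u (l + n)"
    by (simp add: u_def algebra_simps flip: exp_add)
  then have "e j l = exp (\<kappa> * (\<zeta> * real n)) ^ q j * e j (l + n)"
    by (simp add: e_def power_mult_distrib)
  also have "exp (\<kappa> * (\<zeta> * real n)) ^ q j = exp (\<kappa> * (\<zeta> * real n) * real (q j))"
    by (simp add: exp_of_nat2_mult)
  also have "\<dots> * e j (l + n) \<le> exp (c * \<Delta> / 2) * e j (l + n)"
    using x e_pos[of j "l + n"] by (intro mult_right_mono) auto
  finally show ?thesis .
qed

text \<open>The second difference is exactly \<open>2 * (i * i)\<close>.\<close>

lemma q_concave: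
  assumes "1 \<le> i" "i \<le> j" "j + i \<le> Suc m"
  shows "q (j - i) + q (j + i) + 2 \<le> 2 * q j"
proof -
  obtain a where a: "j = a + i" using assms(2) by (metis le_Suc_ex add.commute)
  obtain d where d: "Suc m = j + i + d" using assms(3) by (metis le_Suc_ex)
  have q1: "q (j - i) = a * (2 * i + d)" and q2: "q (j + i) = (a + 2 * i) * d" and q3: "q j = (a + i) * (i + d)"
    using d unfolding q_def a by (auto intro!: arg_cong2[where f = "(*)"])
  have "2 * q j = q (j - i) + q (j + i) + 2 * (i * i)"
    unfolding q1 q2 q3 by (simp add: algebra_simps)
  moreover have "1 \<le> i * i" using assms(1) by (metis mult_le_mono nat_mult_1)
  ultimately show ?thesis by simp
qed

lemma rad_add: "rad (t + s) = rad t * rad s"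
  by (simp add: rad_def algebra_simps flip: exp_add)

lemma rad_mono: "t0 \<le> t \<Longrightarrow> rad t \<le> rad t0"
  using w_nonneg[of \<iota>] by (simp add: rad_def mult_left_mono)

lemma rad_le_\<rho>: "t0 \<le> t \<Longrightarrow> rad t \<le> \<rho>"
  using rad_mono[of t] t0(2) unfolding rad_def by linarith

section \<open>Dangerous subspaces\<close>

lemma shear_continuous: "continuous_on X (\<lambda>x. shear x \<omega> $ K)"
proof -
  obtain a where "\<And>x. shear x \<omega> $ K = \<omega> $ K + a \<bullet> x" using shear_affine by blast
  then show ?thesis by (simp add: continuous_intros)
qed

text \<open>The maximum is taken over coordinates and points jointly, so that one normalized affine
  function bounds the whole multivector from below.\<close>

lemma maximal_coordinate:
  assumes \<omega>: "\<omega> \<noteq> 0" and r: "0 < r"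
  obtains z K where "z \<in> cball x r" "shear z \<omega> $ K \<noteq> 0"
    "\<And>y L. y \<in> cball x r \<Longrightarrow> exp (G t s L) * \<bar>shear y \<omega> $ L\<bar> \<le> exp (G t s K) * \<bar>shear z \<omega> $ K\<bar>"
    "normalized_affine (cball x r) (\<lambda>y. \<bar>shear y \<omega> $ K\<bar> / \<bar>shear z \<omega> $ K\<bar>)"
proof -
  let ?F = "\<lambda>L y. exp (G t s L) * \<bar>shear y \<omega> $ L\<bar>"
  have "\<exists>z\<in>cball x r. \<forall>y\<in>cball x r. ?F L y \<le> ?F L z" for L
    using r by (intro continuous_attains_sup) (auto intro!: continuous_intros shear_continuous)
  then obtain z where z: "\<And>L. z L \<in> cball x r" "\<And>L y. y \<in> cball x r \<Longrightarrow> ?F L y \<le> ?F L (z L)" by metis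
  obtain K where K: "\<And>L. ?F L (z L) \<le> ?F K (z K)"
    using Max_in[of "range (\<lambda>L. ?F L (z L))"] Max_ge[of "range (\<lambda>L. ?F L (z L))"] by fastforce
  have max: "?F L y \<le> ?F K (z K)" if "y \<in> cball x r" for L y 
    by (rule order_trans[OF z(2)[OF that, of L] K[of L]])
  have nz: "shear (z K) \<omega> $ K \<noteq> 0"
  proof
    assume "shear (z K) \<omega> $ K = 0"
    then have "?F L x \<le> 0" for L using max[of x L] r by simp
    then have "shear x \<omega> $ L = 0" for L by (simp add: mult_le_0_iff not_le)
    then have "\<Phi> t s x \<omega> = 0" by (simp add: \<Phi>_def vec_eq_iff)
    then show False using \<omega> by (simp add: \<Phi>_eq_0_iff)
  qed
  obtain a where a: "\<And>x. shear x \<omega> $ K = \<omega> $ K + a \<bullet> x" using shear_affine by blast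
  have "normalized_affine (cball x r) (\<lambda>y. \<bar>shear y \<omega> $ K\<bar> / \<bar>shear (z K) \<omega> $ K\<bar>)"
    unfolding normalized_affine_def
    by (rule exI[of _ a], rule exI[of _ "\<omega> $ K"], rule exI[of _ "z K"]) (use z nz max[of _ K] in \<open>auto simp flip: a\<close>)
  then show ?thesis using that[OF z(1) nz max] by blast
qed

text \<open>The two lower bounds may be attained at different points of the ball, but submodularity
  compares sizes at one point. Avoiding two slabs provides a common point at the cost of the factor
  \<xi>.\<close>

lemma simultaneous_lower_bound:
  assumes x: "x \<in> measure_support \<mu>" and t: "t0 \<le> t" and \<alpha>: "\<alpha> \<noteq> 0" and \<beta>: "\<beta> \<noteq> 0"
    and a: "\<exists>x'\<in>cball x (rad t). a \<le> norm (\<Phi> t s x' \<alpha>)"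
    and b: "\<exists>x'\<in>cball x (rad t). b \<le> norm (\<Phi> t s x' \<beta>)"
  defines "\<xi> \<equiv> (1 / (4 * C)) powr (1 / \<delta>) / N"
  shows "\<exists>y\<in>cball x (rad t). \<xi> * a \<le> norm (\<Phi> t s y \<alpha>) \<and> \<xi> * b \<le> norm (\<Phi> t s y \<beta>)"
proof -
  let ?B = "cball x (rad t)" and ?\<epsilon> = "(1 / (4 * C)) powr (1 / \<delta>)"
  have N: "1 \<le> N" by (rule constants_pos)
  have aux: "\<exists>\<phi>. normalized_affine ?B \<phi> \<and> (\<forall>y. ?\<epsilon> < \<phi> y \<longrightarrow> \<xi> * a \<le> norm (\<Phi> t s y \<omega>))"
    if \<omega>: "\<omega> \<noteq> 0" and a: "\<exists>x'\<in>?B. a \<le> norm (\<Phi> t s x' \<omega>)" for \<omega> a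
  proof -
    obtain z K where z: "z \<in> ?B" "shear z \<omega> $ K \<noteq> 0"
      "\<And>y L. y \<in> ?B \<Longrightarrow> exp (G t s L) * \<bar>shear y \<omega> $ L\<bar> \<le> exp (G t s K) * \<bar>shear z \<omega> $ K\<bar>"
      "normalized_affine ?B (\<lambda>y. \<bar>shear y \<omega> $ K\<bar> / \<bar>shear z \<omega> $ K\<bar>)"
      using maximal_coordinate[OF \<omega> constants_pos(4)] by blast
    let ?\<sigma> = "exp (G t s K) * \<bar>shear z \<omega> $ K\<bar>"
    obtain x' where x': "x' \<in> ?B" "a \<le> norm (\<Phi> t s x' \<omega>)" using a by auto
    have "norm (\<Phi> t s x' \<omega>) \<le> (\<Sum>L\<in>UNIV. \<bar>\<Phi> t s x' \<omega> $ L\<bar>)" by (rule norm_le_l1_cart)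
    also have "\<dots> \<le> real CARD('d option set) * ?\<sigma>"
      using z(3)[OF x'(1)] by (intro sum_bounded_above) (simp add: \<Phi>_def abs_mult)
    finally have "a \<le> N * ?\<sigma>" using x'(2) by (simp add: N_def)
    then have a\<sigma>: "a / N \<le> ?\<sigma>" using N by (simp add: pos_divide_le_eq mult.commute)
    have "\<xi> * a \<le> norm (\<Phi> t s y \<omega>)" if y: "?\<epsilon> < \<bar>shear y \<omega> $ K\<bar> / \<bar>shear z \<omega> $ K\<bar>" for y
    proof -
      have "\<xi> * a = ?\<epsilon> * (a / N)" by (simp add: \<xi>_def)
      also have "\<dots> \<le> ?\<epsilon> * ?\<sigma>" using a\<sigma> by (intro mult_left_mono) auto
      also have "\<dots> \<le> \<bar>shear y \<omega> $ K\<bar> / \<bar>shear z \<omega> $ K\<bar> * ?\<sigma>" using y by (intro mult_right_mono) auto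
      also have "\<dots> = exp (G t s K) * \<bar>shear y \<omega> $ K\<bar>" using z(2) by simp
      also have "\<dots> \<le> norm (\<Phi> t s y \<omega>)" by (rule norm_\<Phi>_ge)
      finally show ?thesis .
    qed
    then show ?thesis using z(4) by blast
  qed
  obtain \<phi> where \<phi>: "normalized_affine ?B \<phi>" "\<And>y. ?\<epsilon> < \<phi> y \<Longrightarrow> \<xi> * a \<le> norm (\<Phi> t s y \<alpha>)"
    using aux[OF \<alpha> a] by blast
  obtain \<psi> where \<psi>: "normalized_affine ?B \<psi>" "\<And>y. ?\<epsilon> < \<psi> y \<Longrightarrow> \<xi> * b \<le> norm (\<Phi> t s y \<beta>)"
    using aux[OF \<beta> b] by blast
  show ?thesis using avoid_two_slabs[OF x constants_pos(4) rad_le_\<rho>[OF t] \<phi>(1) \<psi>(1)] \<phi>(2) \<psi>(2) by blast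
qed

text \<open>At most one subspace of each rank is dangerous: if there were two, the submodularity of the norm
  would make their intersection or their sum violate the assumed lower bound, as \<open>q\<close> is strictly concave.\<close>

lemma dangerous_unique:
  assumes x: "x \<in> measure_support \<mu>" and t: "t0 \<le> t"
    and low: "\<And>j l. 1 \<le> j \<Longrightarrow> j \<le> m \<Longrightarrow> bounded_below t x j l (e j l)"
    and \<omega>: "\<omega> \<in> dec j" "\<omega>' \<in> dec j" and j: "1 \<le> j" "j \<le> m"
    and small: "\<And>x'. x' \<in> cball x (rad t) \<Longrightarrow> norm (\<Phi> t (real l * \<zeta>) x' \<omega>) < drop * \<tau> j l"
      "\<And>x'. x' \<in> cball x (rad t) \<Longrightarrow> norm (\<Phi> t (real l * \<zeta>) x' \<omega>') < drop * \<tau> j l"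
  obtains a where "\<omega>' = a *\<^sub>R \<omega>"
proof (cases rule: dec_cases[OF \<omega>])
  case (2 i \<alpha> \<beta>)
  let ?s = "real l * \<zeta>" and ?B = "cball x (rad t)"
  define \<xi> where "\<xi> = min 1 ((1 / (4 * C)) powr (1 / \<delta>) / N)"
  have \<xi>: "0 < \<xi>" using C_pos constants_pos(5) by (simp add: \<xi>_def)
  have ji: "j + i \<le> Suc m" using dec_rank_le[OF 2(4)] .
  have ex: "\<exists>x'\<in>?B. e n l \<le> norm (\<Phi> t ?s x' \<omega>)" if "\<omega> \<in> dec n" for \<omega> n
  proof (cases "n = 0 \<or> n = Suc m")
    case True
    then show ?thesis using norm_\<Phi>_extreme_rank[OF that True] e_extreme[OF True] constants_pos(4)[of t]
      by (intro bexI[of _ x]) auto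
  next
    case False
    then show ?thesis using low[of n l] that dec_rank_le[OF that] by (auto simp: bounded_below_def)
  qed
  obtain y where y: "y \<in> ?B" "(1 / (4 * C)) powr (1 / \<delta>) / N * e (j - i) l \<le> norm (\<Phi> t ?s y \<alpha>)"
    "(1 / (4 * C)) powr (1 / \<delta>) / N * e (j + i) l \<le> norm (\<Phi> t ?s y \<beta>)"
    using simultaneous_lower_bound[OF x t dec_nonzero[OF 2(3)] dec_nonzero[OF 2(4)] ex[OF 2(3)] ex[OF 2(4)]] by blast
  have "\<xi> * e n l \<le> (1 / (4 * C)) powr (1 / \<delta>) / N * e n l" for n
    using e_pos[of n l] by (intro mult_right_mono) (auto simp: \<xi>_def)
  then have y': "\<xi> * e (j - i) l \<le> norm (\<Phi> t ?s y \<alpha>)" "\<xi> * e (j + i) l \<le> norm (\<Phi> t ?s y \<beta>)"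
    using y by (meson order_trans)+
  have "(\<xi> * e (j - i) l) * (\<xi> * e (j + i) l) \<le> norm (\<Phi> t ?s y \<alpha>) * norm (\<Phi> t ?s y \<beta>)"
    using y' \<xi> e_pos[of "j - i" l] e_pos[of "j + i" l] by (intro mult_mono) auto
  also have "\<dots> \<le> norm (\<Phi> t ?s y \<omega>) * norm (\<Phi> t ?s y \<omega>')" by (rule 2(5))
  also have "\<dots> \<le> (drop * \<tau> j l) * (drop * \<tau> j l)"
    using small(1)[OF y(1)] small(2)[OF y(1)] constants_pos \<tau>_pos[of j l] by (intro mult_mono) auto
  also have "\<dots> = (drop * \<Theta>)\<^sup>2 * (u l ^ (2 * q j) * exp (\<kappa> * \<zeta> * real l))"
    by (simp add: \<tau>_def e_def power2_eq_square mult_ac power_add mult_2 flip: exp_add)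
  \<comment> \<open>Concavity frees two powers of \<open>u l\<close>; together with the growth of
    the thresholds they are at most the square of \<epsilon>.\<close>
  also have "\<dots> \<le> (drop * \<Theta>)\<^sup>2 * (u l ^ (q (j - i) + q (j + i) + 2) * exp (\<kappa> * \<zeta> * real l))"
    using q_concave[OF 2(1,2) ji] u_pos[of l] u_le_1[of l]
    by (intro mult_left_mono mult_right_mono power_decreasing) auto
  also have "\<dots> = e (j - i) l * e (j + i) l * ((drop * \<Theta>)\<^sup>2 * ((u l)\<^sup>2 * exp (\<kappa> * \<zeta> * real l)))"
    by (simp add: e_def power_add power2_eq_square mult_ac)
  finally have "e (j - i) l * e (j + i) l * \<xi>\<^sup>2
    \<le> e (j - i) l * e (j + i) l * ((drop * \<Theta>)\<^sup>2 * ((u l)\<^sup>2 * exp (\<kappa> * \<zeta> * real l)))"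
    by (simp add: power2_eq_square mult_ac)
  then have "\<xi>\<^sup>2 \<le> (drop * \<Theta>)\<^sup>2 * ((u l)\<^sup>2 * exp (\<kappa> * \<zeta> * real l))"
    using e_pos[of "j - i" l] e_pos[of "j + i" l] by simp
  also have "\<dots> \<le> (drop * \<Theta>)\<^sup>2 * \<epsilon>\<^sup>2"
  proof (rule mult_left_mono)
    have "(u l)\<^sup>2 * exp (\<kappa> * \<zeta> * real l) = \<epsilon> * u l"
      by (simp add: u_def power2_eq_square mult_ac flip: exp_add)
    also have "\<dots> \<le> \<epsilon> * \<epsilon>" using u_le \<epsilon> by (intro mult_left_mono) auto
    finally show "(u l)\<^sup>2 * exp (\<kappa> * \<zeta> * real l) \<le> \<epsilon>\<^sup>2" by (simp add: power2_eq_square)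
  qed simp
  finally have "\<xi>\<^sup>2 \<le> (\<epsilon> * (drop * \<Theta>))\<^sup>2" by (simp add: power_mult_distrib mult.commute)
  then have "\<xi> \<le> \<epsilon> * (drop * \<Theta>)"
    by (rule power2_le_imp_le) (use \<epsilon> \<Theta> constants_pos in auto)
  moreover have "\<epsilon> * (drop * \<Theta>) < \<xi>" using \<epsilon>(3) by (simp add: drop_def \<xi>_def N_def mult_ac)
  ultimately show ?thesis by simp
qed (use that in blast)

text \<open>An affine map bounded by \<open>a\<close> on the small ball around \<open>y\<close> is
  bounded on the old ball by a multiple of \<open>a\<close> depending only on the ratio of the
  radii, which contradicts its size at \<open>x'\<close>.\<close>

lemma not_dangerous:
  assumes y: "y \<in> cball x (rad t)" and x': "x' \<in> cball x (rad t)"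
    and big: "drop * a \<le> norm (\<Phi> t s x' \<omega>)"
  shows "\<exists>y'\<in>cball y (rad (t + \<Delta>)). a \<le> norm (\<Phi> (t + \<Delta>) s y' \<omega>)"
proof (rule ccontr)
  assume "\<not> ?thesis"
  then have lt: "norm (\<Phi> (t + \<Delta>) s y' \<omega>) < a" if "y' \<in> cball y (rad (t + \<Delta>))" for y' using that by force
  \<comment> \<open>\<open>y\<close> and \<open>x'\<close> are at most \<open>2 * rad t\<close>
    apart, so this fraction of the segment between them stays in the small ball.\<close>
  define v where "v = rad \<Delta> / 2"
  have v: "0 < v" using constants_pos by (simp add: v_def)
  let ?y = "y + v *\<^sub>R (x' - y)"
  have "dist y x' \<le> dist x y + dist x x'" by (rule dist_triangle3)
  then have "norm (x' - y) \<le> 2 * rad t" using y x' by (simp add: dist_norm norm_minus_commute)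
  then have "v * norm (x' - y) \<le> v * (2 * rad t)" using v by (intro mult_left_mono) auto
  then have "?y \<in> cball y (rad (t + \<Delta>))" using v by (simp add: dist_norm rad_add v_def)
  then have 1: "norm (\<Phi> (t + \<Delta>) s ?y \<omega>) < a" by (rule lt)
  have 2: "norm (\<Phi> (t + \<Delta>) s y \<omega>) < a" using constants_pos(4)[of "t + \<Delta>"] by (intro lt) simp
  have a: "0 < a" using 2 norm_ge_zero[of "\<Phi> (t + \<Delta>) s y \<omega>"] by linarith
  have "v *\<^sub>R \<Phi> (t + \<Delta>) s x' \<omega> = \<Phi> (t + \<Delta>) s ?y \<omega> - (1 - v) *\<^sub>R \<Phi> (t + \<Delta>) s y \<omega>"
    by (simp add: \<Phi>_affine)
  then have "v * norm (\<Phi> (t + \<Delta>) s x' \<omega>) \<le> norm (\<Phi> (t + \<Delta>) s ?y \<omega>) + \<bar>1 - v\<bar> * norm (\<Phi> (t + \<Delta>) s y \<omega>)"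
    using v norm_triangle_ineq4[of "\<Phi> (t + \<Delta>) s ?y \<omega>" "(1 - v) *\<^sub>R \<Phi> (t + \<Delta>) s y \<omega>"]
    by (metis abs_of_pos norm_scaleR)
  also have "\<dots> < a + (1 + v) * a"
  proof (rule add_less_le_mono[OF 1])
    show "\<bar>1 - v\<bar> * norm (\<Phi> (t + \<Delta>) s y \<omega>) \<le> (1 + v) * a"
      using 2 v by (intro mult_mono) auto
  qed
  finally have "norm (\<Phi> (t + \<Delta>) s x' \<omega>) < (2 + v) * a / v"
    using v by (simp add: pos_less_divide_eq mult.commute algebra_simps)
  also have "\<dots> = (1 + 4 * exp ((1 + w $ \<iota>) * \<Delta>)) * a"
  proof -
    have "exp ((1 + w $ \<iota>) * \<Delta>) * rad \<Delta> = 1" by (simp add: rad_def algebra_simps flip: exp_add)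
    then have "exp ((1 + w $ \<iota>) * \<Delta>) = 1 / rad \<Delta>" using constants_pos(4)[of \<Delta>] by (simp add: field_simps)
    then show ?thesis using constants_pos(4)[of \<Delta>] by (simp add: v_def field_simps)
  qed
  finally have 3: "norm (\<Phi> (t + \<Delta>) s x' \<omega>) < (1 + 4 * exp ((1 + w $ \<iota>) * \<Delta>)) * a" .
  have "(1 + 4 * exp ((1 + w $ \<iota>) * \<Delta>)) * a = exp (- \<Delta>) * (drop * a)"
    by (simp add: drop_def exp_minus)
  also have "\<dots> \<le> exp (- \<Delta>) * norm (\<Phi> t s x' \<omega>)" using big by (intro mult_left_mono) auto
  also have "\<dots> \<le> norm (\<Phi> (t + \<Delta>) s x' \<omega>)" using \<Delta> by (intro norm_\<Phi>_time) auto
  finally show False using 3 by simp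
qed

text \<open>Dangerous multivectors of the same rank and parameter are proportional, so they share
  the normalized coordinate \<phi>. Its maximal size at the later time dominates the size at one of
  the two shifted parameters, where \<open>b\<close> is a lower bound.\<close>

lemma dangerous_contraction:
  assumes x: "x \<in> measure_support \<mu>" and t: "t0 \<le> t"
    and b: "\<And>j l. 1 \<le> j \<Longrightarrow> j \<le> m \<Longrightarrow> 0 < b j l \<and> bounded_below t x j l (b j l)"
    and eb: "\<And>j l. 1 \<le> j \<Longrightarrow> j \<le> m \<Longrightarrow> e j l \<le> b j l"
    and j: "1 \<le> j" "j \<le> m"
  shows "\<exists>\<phi>. normalized_affine (cball x (rad t)) \<phi> \<and>
    (\<forall>\<omega>\<in>dec j. (\<forall>x'\<in>cball x (rad t). norm (\<Phi> t (real l * \<zeta>) x' \<omega>) < drop * \<tau> j l) \<longrightarrow>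
      (\<forall>y\<in>cball x (rad t). \<phi> y * gain * min (b j (l + (k - 1))) (b j (l + (k + 1)))
        \<le> norm (\<Phi> (t + \<Delta>) (real l * \<zeta>) y \<omega>)))"
proof (cases "\<exists>\<omega>\<in>dec j. \<forall>x'\<in>cball x (rad t). norm (\<Phi> t (real l * \<zeta>) x' \<omega>) < drop * \<tau> j l")
  case False
  have "normalized_affine (cball x (rad t)) (\<lambda>_. 1)"
    unfolding normalized_affine_def using constants_pos(4)[of t]
    by (intro exI[of _ 0] exI[of _ 1] exI[of _ x]) auto
  then show ?thesis using False by blast
next
  case True
  let ?B = "cball x (rad t)" and ?s = "real l * \<zeta>"
  obtain \<omega> where \<omega>: "\<omega> \<in> dec j" "\<And>x'. x' \<in> ?B \<Longrightarrow> norm (\<Phi> t ?s x' \<omega>) < drop * \<tau> j l"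
    using True by blast
  obtain z K where z: "z \<in> ?B" "shear z \<omega> $ K \<noteq> 0"
    "\<And>y L. y \<in> ?B \<Longrightarrow> exp (G (t + \<Delta>) ?s L) * \<bar>shear y \<omega> $ L\<bar> \<le> exp (G (t + \<Delta>) ?s K) * \<bar>shear z \<omega> $ K\<bar>"
    "normalized_affine ?B (\<lambda>y. \<bar>shear y \<omega> $ K\<bar> / \<bar>shear z \<omega> $ K\<bar>)"
    using maximal_coordinate[OF dec_nonzero[OF \<omega>(1)] constants_pos(4)] by blast
  have low: "bounded_below t x j l (e j l)" if "1 \<le> j" "j \<le> m" for j l
    using b[OF that, of l] eb[OF that, of l] unfolding bounded_below_def by (meson order_trans)
  have "\<bar>shear y \<omega> $ K\<bar> / \<bar>shear z \<omega> $ K\<bar> * gain * min (b j (l + (k - 1))) (b j (l + (k + 1)))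
      \<le> norm (\<Phi> (t + \<Delta>) ?s y \<omega>')"
    if \<omega>': "\<omega>' \<in> dec j" "\<And>x'. x' \<in> ?B \<Longrightarrow> norm (\<Phi> t ?s x' \<omega>') < drop * \<tau> j l" and y: "y \<in> ?B" for \<omega>' y
  proof -
    obtain a where a: "\<omega>' = a *\<^sub>R \<omega>"
      using dangerous_unique[OF x t low \<omega>(1) \<omega>'(1) j \<omega>(2) \<omega>'(2)] by blast
    have sh: "shear y \<omega>' $ L = a * shear y \<omega> $ L" for y L by (simp add: a linear_cmul[OF shear_linear])
    define \<sigma> where "\<sigma> = exp (G (t + \<Delta>) ?s K) * \<bar>shear z \<omega>' $ K\<bar>"
    have \<sigma>: "exp (G (t + \<Delta>) ?s L) * \<bar>shear y \<omega>' $ L\<bar> \<le> \<sigma>" if "y \<in> ?B" for L y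
    proof -
      have "\<bar>a\<bar> * (exp (G (t + \<Delta>) ?s L) * \<bar>shear y \<omega> $ L\<bar>) \<le> \<bar>a\<bar> * (exp (G (t + \<Delta>) ?s K) * \<bar>shear z \<omega> $ K\<bar>)"
        using z(3)[OF that] by (intro mult_left_mono) auto
      then show ?thesis by (simp add: \<sigma>_def sh abs_mult mult_ac)
    qed
    have \<eta>: "0 < 1 / real k" "1 / real k \<le> wmin / 4" using k k_pos by (auto simp: field_simps)
    have s0: "0 \<le> ?s" using constants_pos by simp
    obtain h where h: "h \<in> {(1 - 1 / real k) * \<Delta>, (1 + 1 / real k) * \<Delta>}"
      "\<And>x'. x' \<in> ?B \<Longrightarrow> norm (\<Phi> t (?s + h) x' \<omega>') \<le> 2 * N\<^sup>2 * exp (- (1 / real k) * wmin * \<Delta>) * \<sigma>"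
      using \<Phi>_contraction[OF \<omega>'(1) j s0 \<Delta>(1) \<eta>, of x t \<sigma>] \<sigma> unfolding rad_def N_def by blast
    obtain n where n: "n = k - 1 \<or> n = k + 1" "?s + h = real (l + n) * \<zeta>"
    proof -
      have "?s + (1 - 1 / real k) * \<Delta> = real (l + (k - 1)) * \<zeta>" "?s + (1 + 1 / real k) * \<Delta> = real (l + (k + 1)) * \<zeta>"
        using k_ge k_pos by (simp_all add: \<zeta>_def of_nat_diff field_simps)
      then show ?thesis using h(1) that[of "k - 1"] that[of "k + 1"] by (metis insertE singletonD)
    qed
    obtain x' where x': "x' \<in> ?B" "b j (l + n) \<le> norm (\<Phi> t (?s + h) x' \<omega>')"
      using b[OF j, of "l + n"] \<omega>'(1) unfolding bounded_below_def n(2) by blast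
    have "min (b j (l + (k - 1))) (b j (l + (k + 1))) \<le> b j (l + n)" using n(1) by auto
    also have "\<dots> \<le> 2 * N\<^sup>2 * exp (- (1 / real k) * wmin * \<Delta>) * \<sigma>" using h(2)[OF x'(1)] x'(2) by simp
    also have "\<dots> = \<sigma> / gain" by (simp add: gain_def c_def exp_minus field_simps)
    finally have "gain * min (b j (l + (k - 1))) (b j (l + (k + 1))) \<le> \<sigma>"
      using constants_pos(6) by (simp add: pos_le_divide_eq mult.commute)
    then have "\<bar>shear y \<omega> $ K\<bar> / \<bar>shear z \<omega> $ K\<bar> * (gain * min (b j (l + (k - 1))) (b j (l + (k + 1))))
      \<le> \<bar>shear y \<omega> $ K\<bar> / \<bar>shear z \<omega> $ K\<bar> * \<sigma>" by (intro mult_left_mono) auto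
    also have "\<dots> = exp (G (t + \<Delta>) ?s K) * \<bar>shear y \<omega>' $ K\<bar>"
      using z(2) by (simp add: \<sigma>_def sh abs_mult)
    also have "\<dots> \<le> norm (\<Phi> (t + \<Delta>) ?s y \<omega>')" by (rule norm_\<Phi>_ge)
    finally show ?thesis by (simp only: mult.assoc)
  qed
  then show ?thesis using z(4) by blast
qed

section \<open>One step of the descent\<close>

lemma threshold_sum: "(\<Sum>j\<in>{1..m}. \<Sum>l. ennreal ((e j l / \<tau> j l) powr \<gamma>)) \<le> ennreal (1 / 4)"
proof -
  define p where "p = exp (- \<kappa> * \<zeta> / 2 * \<gamma>)"
  have p: "0 < p" "p < 1" using constants_pos by (auto simp: p_def)
  have "(e j l / \<tau> j l) powr \<gamma> = \<Theta> powr - \<gamma> * p ^ l" for j l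
  proof -
    have "e j l / \<tau> j l = inverse \<Theta> * exp (- (\<kappa> * \<zeta> * real l / 2))"
      using e_pos[of j l] \<Theta> by (simp add: \<tau>_def exp_minus field_simps)
    then have "(e j l / \<tau> j l) powr \<gamma> = inverse \<Theta> powr \<gamma> * exp (- (\<kappa> * \<zeta> * real l / 2)) powr \<gamma>"
      using \<Theta> by (simp add: powr_mult)
    also have "inverse \<Theta> powr \<gamma> = \<Theta> powr - \<gamma>" using \<Theta> by (simp add: powr_minus inverse_powr)
    also have "exp (- (\<kappa> * \<zeta> * real l / 2)) powr \<gamma> = p ^ l"
      by (simp add: p_def powr_def mult_ac flip: exp_of_nat_mult)
    finally show ?thesis .
  qed
  moreover have "(\<Sum>l. ennreal (\<Theta> powr - \<gamma> * p ^ l)) = ennreal (\<Theta> powr - \<gamma> / (1 - p))"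
  proof (rule suminf_ennreal_eq)
    show "(\<lambda>l. \<Theta> powr - \<gamma> * p ^ l) sums (\<Theta> powr - \<gamma> / (1 - p))"
      using sums_mult[OF geometric_sums[of p], of "\<Theta> powr - \<gamma>"] p by simp
  qed (use p in auto)
  ultimately have "(\<Sum>j\<in>{1..m}. \<Sum>l. ennreal ((e j l / \<tau> j l) powr \<gamma>)) = ennreal (real m * (\<Theta> powr - \<gamma> / (1 - p)))"
    using p sum_const_ennreal[of "\<Theta> powr - \<gamma> / (1 - p)" m] by simp
  also have "\<dots> \<le> ennreal (1 / 4)"
    using \<Theta>(2) by (intro ennreal_leI) (simp add: p_def \<kappa>_def \<zeta>_def c_def)
  finally show ?thesis .
qed

lemma lower_bound_of_sum:
  assumes sum: "(\<Sum>j\<in>{1..m}. \<Sum>l. ennreal ((e j l / b j l) powr \<gamma>)) \<le> 1"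
    and j: "1 \<le> j" "j \<le> m" and pos: "0 < b j l"
  shows "e j l \<le> b j l"
proof -
  define a where "a j l = ennreal ((e j l / b j l) powr \<gamma>)" for j l
  have "a j l \<le> (\<Sum>l. a j l)" using sum_le_suminf[of "a j" "{l}"] by auto
  also have "\<dots> \<le> (\<Sum>j\<in>{1..m}. \<Sum>l. a j l)" using j by (intro member_le_sum) auto
  also have "\<dots> \<le> 1" using sum by (simp add: a_def)
  finally have "(e j l / b j l) powr \<gamma> \<le> 1" by (simp add: a_def)
  moreover have "1 < (e j l / b j l) powr \<gamma>" if "1 < e j l / b j l"
    using powr_less_mono2[OF constants_pos(9) _ that] by simp
  ultimately have "e j l / b j l \<le> 1" by (meson not_le)
  then show ?thesis using pos by simp
qed

text \<open>The new bound is the smaller of the threshold, valid for subspaces that are not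
  dangerous, and the bound \<open>b1\<close> for the dangerous one. The former contributes at most
  1/4 to the potential, the latter at most 1/2 on average, so some point of the support keeps the
  sum at most 1.\<close>

lemma good_step:
  assumes t: "t0 \<le> t" and good: "good t x"
  shows "\<exists>y\<in>cball x (rad t). good (t + \<Delta>) y"
proof -
  let ?B = "cball x (rad t)"
  have x: "x \<in> measure_support \<mu>" using good by (simp add: good_def)
  obtain b where b0: "\<forall>j\<in>{1..m}. \<forall>l. 0 < b j l \<and> bounded_below t x j l (b j l)"
    and sum: "(\<Sum>j\<in>{1..m}. \<Sum>l. ennreal ((e j l / b j l) powr \<gamma>)) \<le> 1"
    using good unfolding good_def by blast
  have b: "0 < b j l \<and> bounded_below t x j l (b j l)" if "1 \<le> j" "j \<le> m" for j l
    using b0 that by auto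
  define a where "a j l = ennreal ((e j l / b j l) powr \<gamma>)" for j l
  have eb: "e j l \<le> b j l" if j: "1 \<le> j" "j \<le> m" for j l
    using sum j b[OF j, of l] by (intro lower_bound_of_sum) auto
  have "\<exists>\<phi>. normalized_affine ?B \<phi> \<and> (1 \<le> j \<and> j \<le> m \<longrightarrow>
    (\<forall>\<omega>\<in>dec j. (\<forall>x'\<in>?B. norm (\<Phi> t (real l * \<zeta>) x' \<omega>) < drop * \<tau> j l) \<longrightarrow>
      (\<forall>y\<in>?B. \<phi> y * gain * min (b j (l + (k - 1))) (b j (l + (k + 1)))
        \<le> norm (\<Phi> (t + \<Delta>) (real l * \<zeta>) y \<omega>))))" for j l
  proof (cases "1 \<le> j \<and> j \<le> m")
    case True
    then show ?thesis using dangerous_contraction[OF x t b eb, where j = j and l = l] by blast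
  next
    case False
    have "normalized_affine ?B (\<lambda>_. 1)"
      unfolding normalized_affine_def using constants_pos(4)[of t]
      by (intro exI[of _ 0] exI[of _ 1] exI[of _ x]) auto
    then show ?thesis using False by blast
  qed
  then obtain \<phi> where \<phi>: "\<And>j l. normalized_affine ?B (\<phi> j l)"
    and \<phi>': "\<And>j l \<omega> y. 1 \<le> j \<Longrightarrow> j \<le> m \<Longrightarrow> \<omega> \<in> dec j \<Longrightarrow>
      (\<forall>x'\<in>?B. norm (\<Phi> t (real l * \<zeta>) x' \<omega>) < drop * \<tau> j l) \<Longrightarrow> y \<in> ?B \<Longrightarrow>
      \<phi> j l y * gain * min (b j (l + (k - 1))) (b j (l + (k + 1))) \<le> norm (\<Phi> (t + \<Delta>) (real l * \<zeta>) y \<omega>)"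
    by metis
  define A where "A j l = ennreal \<Gamma> * (a j (l + (k - 1)) + a j (l + (k + 1)))" for j l
  define \<theta> where "\<theta> = (\<Sum>j\<in>{1..m}. \<Sum>l. ennreal ((e j l / \<tau> j l) powr \<gamma>))"
  have "ennreal M * (\<Sum>j\<in>{1..m}. \<Sum>l. A j l) \<le> ennreal (1 / 2)"
  proof -
    have "(\<Sum>l. A j l) \<le> ennreal \<Gamma> * ((\<Sum>l. a j l) + (\<Sum>l. a j l))" for j
    proof -
      have "(\<Sum>l. A j l) = ennreal \<Gamma> * ((\<Sum>l. a j (l + (k - 1))) + (\<Sum>l. a j (l + (k + 1))))"
        unfolding A_def by (subst suminf_add) auto
      also have "\<dots> \<le> ennreal \<Gamma> * ((\<Sum>l. a j l) + (\<Sum>l. a j l))"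
        by (intro mult_left_mono add_mono suminf_shift_le) auto
      finally show ?thesis .
    qed
    then have "(\<Sum>j\<in>{1..m}. \<Sum>l. A j l) \<le> (\<Sum>j\<in>{1..m}. ennreal \<Gamma> * ((\<Sum>l. a j l) + (\<Sum>l. a j l)))"
      by (rule sum_mono)
    also have "\<dots> = ennreal \<Gamma> * ((\<Sum>j\<in>{1..m}. \<Sum>l. a j l) + (\<Sum>j\<in>{1..m}. \<Sum>l. a j l))"
      by (simp add: sum.distrib flip: sum_distrib_left)
    also have "\<dots> \<le> ennreal \<Gamma> * (1 + 1)"
      using sum by (intro mult_left_mono add_mono) (auto simp: a_def)
    finally have "ennreal M * (\<Sum>j\<in>{1..m}. \<Sum>l. A j l) \<le> ennreal M * (ennreal \<Gamma> * (1 + 1))"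
      by (rule mult_left_mono) simp
    also have "\<dots> = ennreal (2 * M * \<Gamma>)"
      using M_pos constants_pos(8) by (simp add: ennreal_mult mult_ac)
    also have "\<dots> \<le> ennreal (1 / 2)"
      using \<Gamma>_small by (intro ennreal_leI) (simp add: \<Gamma>_def N_def c_def)
    finally show ?thesis .
  qed
  then have "\<theta> + ennreal M * (\<Sum>j\<in>{1..m}. \<Sum>l. A j l) \<le> ennreal (1 / 4) + ennreal (1 / 2)"
    using threshold_sum unfolding \<theta>_def by (intro add_mono)
  also have "\<dots> = ennreal (3 / 4)" by (subst ennreal_plus[symmetric]) auto
  also have "\<dots> < ennreal 1" by (intro ennreal_lessI) auto
  also have "\<dots> = 1" by simp
  finally have "\<theta> + ennreal M * (\<Sum>j\<in>{1..m}. \<Sum>l. A j l) < 1" .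
  then have "\<exists>y\<in>?B \<inter> measure_support \<mu>. \<theta> + (\<Sum>j\<in>{1..m}. \<Sum>l. A j l * inv_powr \<gamma> (\<phi> j l y)) \<le> 1"
    by (intro select_point x constants_pos(4) rad_le_\<rho> t \<phi> finite_atLeastAtMost)
  then obtain y where y: "y \<in> ?B" "y \<in> measure_support \<mu>"
    and ysum: "\<theta> + (\<Sum>j\<in>{1..m}. \<Sum>l. A j l * inv_powr \<gamma> (\<phi> j l y)) \<le> 1"
    by blast
  \<comment> \<open>All coefficients are positive, so a zero of any \<phi> at \<open>y\<close> would
    make the sum infinite.\<close>
  have \<phi>y: "0 < \<phi> j l y" "\<phi> j l y \<le> 1" if j: "1 \<le> j" "j \<le> m" for j l
  proof -
    show "\<phi> j l y \<le> 1" using normalized_affine_bounds[OF \<phi> y(1)] by simp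
    show "0 < \<phi> j l y"
    proof (rule ccontr)
      assume "\<not> 0 < \<phi> j l y"
      then have "inv_powr \<gamma> (\<phi> j l y) = top" using constants_pos(9) by (intro inv_powr_0) auto
      moreover have "0 < A j l"
      proof -
        have "0 < \<Gamma>" using constants_pos(5) by (simp add: \<Gamma>_def)
        moreover have "0 < a j (l + (k - 1))" using e_pos[of j "l + (k - 1)"] b[OF j, of "l + (k - 1)"] by (simp add: a_def)
        ultimately show ?thesis by (simp add: A_def ennreal_zero_less_mult_iff add_pos_nonneg)
      qed
      ultimately have "top \<le> A j l * inv_powr \<gamma> (\<phi> j l y)" by (simp add: ennreal_mult_top)
      also have "\<dots> \<le> (\<Sum>l. A j l * inv_powr \<gamma> (\<phi> j l y))"
        using sum_le_suminf[of "\<lambda>l. A j l * inv_powr \<gamma> (\<phi> j l y)" "{l}"] by auto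
      also have "\<dots> \<le> (\<Sum>j\<in>{1..m}. \<Sum>l. A j l * inv_powr \<gamma> (\<phi> j l y))" using j by (intro member_le_sum) auto
      also have "\<dots> \<le> 1" by (rule order_trans[OF add_increasing[OF zero_le order_refl] ysum])
      finally show False by (simp add: top_unique)
    qed
  qed
  define b1 where "b1 j l = \<phi> j l y * gain * min (b j (l + (k - 1))) (b j (l + (k + 1)))" for j l
  define b' where "b' j l = min (\<tau> j l) (b1 j l)" for j l
  have b1_pos: "0 < b1 j l" if j: "1 \<le> j" "j \<le> m" for j l
    unfolding b1_def using \<phi>y[OF j] constants_pos(6) b[OF j] by (intro mult_pos_pos) auto
  have b'_pos: "0 < b' j l" if "1 \<le> j" "j \<le> m" for j l
    using b1_pos[OF that] \<tau>_pos by (simp add: b'_def)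
  have low: "bounded_below (t + \<Delta>) y j l (b' j l)" if j: "1 \<le> j" "j \<le> m" for j l
    unfolding bounded_below_def
  proof
    fix \<omega> assume \<omega>: "\<omega> \<in> dec j"
    show "\<exists>x'\<in>cball y (rad (t + \<Delta>)). b' j l \<le> norm (\<Phi> (t + \<Delta>) (real l * \<zeta>) x' \<omega>)"
    proof (cases "\<forall>x'\<in>?B. norm (\<Phi> t (real l * \<zeta>) x' \<omega>) < drop * \<tau> j l")
      case True
      then have "b1 j l \<le> norm (\<Phi> (t + \<Delta>) (real l * \<zeta>) y \<omega>)"
        unfolding b1_def using j \<omega> y(1) by (intro \<phi>')
      then show ?thesis using constants_pos(4)[of "t + \<Delta>"] by (intro bexI[of _ y]) (auto simp: b'_def)
    next
      case False
      then obtain x' where "x' \<in> ?B" "drop * \<tau> j l \<le> norm (\<Phi> t (real l * \<zeta>) x' \<omega>)" by (auto simp: not_less)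
      from not_dangerous[OF y(1) this] obtain y' where "y' \<in> cball y (rad (t + \<Delta>))"
        "\<tau> j l \<le> norm (\<Phi> (t + \<Delta>) (real l * \<zeta>) y' \<omega>)" by blast
      moreover have "b' j l \<le> \<tau> j l" by (simp add: b'_def)
      ultimately show ?thesis by (meson order_trans)
    qed
  qed
  have summand: "ennreal ((e j l / b' j l) powr \<gamma>)
      \<le> ennreal ((e j l / \<tau> j l) powr \<gamma>) + A j l * inv_powr \<gamma> (\<phi> j l y)" if j: "1 \<le> j" "j \<le> m" for j l
  proof (cases "\<tau> j l \<le> b1 j l")
    case True
    then have "b' j l = \<tau> j l" by (simp add: b'_def)
    then show ?thesis by simp
  next
    case False
    then have b'1: "b' j l = b1 j l" by (simp add: b'_def)
    obtain n where n: "n = k - 1 \<or> n = k + 1" "b1 j l = \<phi> j l y * gain * b j (l + n)"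
    proof (cases "b j (l + (k - 1)) \<le> b j (l + (k + 1))")
      case True
      show ?thesis by (rule that[of "k - 1"]) (simp_all only: b1_def min.absorb1[OF True] simp_thms)
    next
      case False
      then have "b j (l + (k + 1)) \<le> b j (l + (k - 1))" by simp
      then show ?thesis by (intro that[of "k + 1"]) (simp_all only: b1_def min.absorb2 simp_thms)
    qed
    have bn: "0 < b j (l + n)" using b[OF j] by simp
    \<comment> \<open>Changing the normalization from \<open>l\<close> to \<open>l + n\<close> costs
      the square root of the factor \<open>exp (c * \<Delta>)\<close> in
      \<open>gain\<close>.\<close>
    have "e j l \<le> exp (c * \<Delta> / 2) * e j (l + n)" using n(1) j by (intro e_shift) auto
    then have "e j l / b1 j l \<le> exp (c * \<Delta> / 2) * e j (l + n) / b1 j l"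
      using b1_pos[OF j, of l] by (intro divide_right_mono) auto
    also have "\<dots> = inverse (\<phi> j l y) * (exp (c * \<Delta> / 2) / gain) * (e j (l + n) / b j (l + n))"
      by (simp add: n(2) field_simps)
    also have "exp (c * \<Delta> / 2) / gain = 2 * N\<^sup>2 * exp (- c * \<Delta> / 2)"
    proof -
      have "exp (c * \<Delta>) = exp (c * \<Delta> / 2) * exp (c * \<Delta> / 2)" by (simp flip: exp_add)
      then show ?thesis by (simp add: gain_def exp_minus field_simps)
    qed
    finally have "(e j l / b1 j l) powr \<gamma>
      \<le> (inverse (\<phi> j l y) * (2 * N\<^sup>2 * exp (- c * \<Delta> / 2)) * (e j (l + n) / b j (l + n))) powr \<gamma>"
      using constants_pos(9) e_pos[of j l] b1_pos[OF j, of l] by (intro powr_mono2) auto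
    also have "\<dots> = inverse (\<phi> j l y) powr \<gamma> * \<Gamma> * (e j (l + n) / b j (l + n)) powr \<gamma>"
      unfolding \<Gamma>_def using \<phi>y[OF j, of l] e_pos[of j "l + n"] bn constants_pos(5)
      by (simp only: powr_mult)
    also have "inverse (\<phi> j l y) powr \<gamma> = \<phi> j l y powr - \<gamma>"
      using \<phi>y[OF j, of l] by (simp add: powr_minus inverse_powr)
    finally have "ennreal ((e j l / b1 j l) powr \<gamma>)
      \<le> ennreal (\<phi> j l y powr - \<gamma> * \<Gamma> * (e j (l + n) / b j (l + n)) powr \<gamma>)" by (rule ennreal_leI)
    also have "\<dots> = ennreal (\<phi> j l y powr - \<gamma>) * (ennreal \<Gamma> * a j (l + n))"
      using constants_pos(8) by (simp add: a_def ennreal_mult mult.assoc)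
    also have "\<dots> \<le> inv_powr \<gamma> (\<phi> j l y) * A j l"
    proof (rule mult_mono)
      show "ennreal (\<phi> j l y powr - \<gamma>) \<le> inv_powr \<gamma> (\<phi> j l y)"
        using \<phi>y[OF j, of l] constants_pos(9) by (intro inv_powr_ge) auto
      show "ennreal \<Gamma> * a j (l + n) \<le> A j l" unfolding A_def using n(1) by (intro mult_left_mono) auto
    qed auto
    finally show ?thesis unfolding b'1 by (simp add: mult.commute add_increasing)
  qed
  have "(\<Sum>j\<in>{1..m}. \<Sum>l. ennreal ((e j l / b' j l) powr \<gamma>))
    \<le> (\<Sum>j\<in>{1..m}. \<Sum>l. ennreal ((e j l / \<tau> j l) powr \<gamma>) + A j l * inv_powr \<gamma> (\<phi> j l y))"
    using summand by (intro sum_mono suminf_le) auto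
  also have "\<dots> = \<theta> + (\<Sum>j\<in>{1..m}. \<Sum>l. A j l * inv_powr \<gamma> (\<phi> j l y))"
    unfolding \<theta>_def sum.distrib[symmetric] by (intro sum.cong refl suminf_add[symmetric]) auto
  also have "\<dots> \<le> 1" by (rule ysum)
  finally have "good (t + \<Delta>) y"
    unfolding good_def using y(2) b'_pos low by (intro conjI exI[of _ b']) auto
  then show ?thesis using y(1) by blast
qed

text \<open>The initial lower bound is the same for all ranks and all \<open>l\<close>, so the sum
  converges through the discount in \<open>e\<close> alone and is small with \<epsilon>.\<close>

lemma good_initial:
  assumes x: "x \<in> measure_support \<mu>"
  shows "good t0 x"
proof -
  define p where "p = exp (- \<kappa> * \<zeta> * \<gamma>)"
  have p: "0 < p" "p < 1" using constants_pos by (auto simp: p_def)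
  let ?b = "rad t0 / 2"
  have "0 \<le> (1 + w $ \<iota>) * t0" using t0 w_nonneg[of \<iota>] by (intro mult_nonneg_nonneg) auto
  then have r1: "rad t0 \<le> 1" unfolding rad_def mult_minus_left by simp
  have low: "bounded_below t0 x j l ?b" if "1 \<le> j" "j \<le> m" for j l
    unfolding bounded_below_def
    using norm_\<Phi>_initial[OF _ that t0(1) _ constants_pos(4) r1] constants_pos(3) by simp
  have "(e j l / ?b) powr \<gamma> \<le> (2 * \<epsilon> / rad t0) powr \<gamma> * p ^ l" if j: "1 \<le> j" "j \<le> m" for j l
  proof -
    have "1 \<le> q j" using j by (simp add: q_def)
    then have "e j l \<le> u l" unfolding e_def using u_pos[of l] u_le_1[of l] power_decreasing[of 1 "q j" "u l"] by simp
    then have "e j l / ?b \<le> u l / ?b" using constants_pos(4)[of t0] by (intro divide_right_mono) auto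
    then have "(e j l / ?b) powr \<gamma> \<le> (u l / ?b) powr \<gamma>"
      using constants_pos(4)[of t0] constants_pos(9) e_pos[of j l] by (intro powr_mono2) auto
    also have "u l / ?b = 2 * \<epsilon> / rad t0 * exp (- \<kappa> * \<zeta> * real l)" by (simp add: u_def)
    also have "\<dots> powr \<gamma> = (2 * \<epsilon> / rad t0) powr \<gamma> * exp (- \<kappa> * \<zeta> * real l) powr \<gamma>"
      by (rule powr_mult)
    also have "exp (- \<kappa> * \<zeta> * real l) powr \<gamma> = p ^ l"
      by (simp add: p_def powr_def mult_ac flip: exp_of_nat_mult)
    finally show ?thesis .
  qed
  then have "(\<Sum>j\<in>{1..m}. \<Sum>l. ennreal ((e j l / ?b) powr \<gamma>))
    \<le> (\<Sum>j\<in>{1..m}. \<Sum>l. ennreal ((2 * \<epsilon> / rad t0) powr \<gamma> * p ^ l))"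
    by (intro sum_mono suminf_le ennreal_leI) auto
  also have "(\<Sum>l. ennreal ((2 * \<epsilon> / rad t0) powr \<gamma> * p ^ l)) = ennreal ((2 * \<epsilon> / rad t0) powr \<gamma> / (1 - p))"
  proof (rule suminf_ennreal_eq)
    show "(\<lambda>l. (2 * \<epsilon> / rad t0) powr \<gamma> * p ^ l) sums ((2 * \<epsilon> / rad t0) powr \<gamma> / (1 - p))"
      using sums_mult[OF geometric_sums[of p], of "(2 * \<epsilon> / rad t0) powr \<gamma>"] p by simp
  qed (use p in auto)
  also have "(\<Sum>j\<in>{1..m}. ennreal ((2 * \<epsilon> / rad t0) powr \<gamma> / (1 - p)))
    = ennreal (real m * ((2 * \<epsilon> / rad t0) powr \<gamma> / (1 - p)))"
    using p by (intro sum_const_ennreal) auto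
  also have "\<dots> \<le> ennreal 1"
    using \<epsilon>(4) by (intro ennreal_leI) (simp add: p_def \<kappa>_def \<zeta>_def c_def rad_def)
  finally show ?thesis
    unfolding good_def using x low constants_pos(4)[of t0] by (intro conjI exI[of _ "\<lambda>_ _. ?b"]) auto
qed

end

section \<open>The limit point and its approximation property\<close>

context bad_construction
begin

lemma rad_half: "rad (t + \<Delta>) \<le> rad t / 2"
proof -
  have "rad \<Delta> \<le> exp (- \<Delta>)"
    unfolding rad_def using w_nonneg[of \<iota>] \<Delta> by (simp add: algebra_simps)
  then have "rad \<Delta> \<le> 1 / 2" using \<Delta> by linarith
  then have "rad t * rad \<Delta> \<le> rad t * (1 / 2)" using constants_pos(4)[of t] by (intro mult_left_mono) auto
  then show ?thesis by (simp add: rad_add)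
qed

lemma good_limit:
  assumes "measure_support \<mu> \<noteq> {}"
  shows "\<exists>x\<in>measure_support \<mu>. \<exists>X. (\<forall>n. good (t0 + real n * \<Delta>) (X n)) \<and>
    (\<forall>n. dist (X n) x \<le> 2 * rad (t0 + real n * \<Delta>))"
proof -
  define T where "T n = t0 + real n * \<Delta>" for n
  have T: "t0 \<le> T n" "T (Suc n) = T n + \<Delta>" for n using \<Delta> by (simp_all add: T_def algebra_simps)
  have "\<exists>X. \<forall>n. good (T n) (X n) \<and> X (Suc n) \<in> cball (X n) (rad (T n))"
  proof (rule dependent_nat_choice[of "\<lambda>n. good (T n)" "\<lambda>n x y. y \<in> cball x (rad (T n))"])
    show "\<exists>x. good (T 0) x" using assms good_initial by (auto simp: T_def)
    show "\<exists>y. good (T (Suc n)) y \<and> y \<in> cball x (rad (T n))" if "good (T n) x" for x n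
      using good_step[OF T(1) that] T(2) by auto
  qed
  then obtain X where X: "\<And>n. good (T n) (X n)" "\<And>n. dist (X n) (X (Suc n)) \<le> rad (T n)" by auto
  have d: "dist (X n) (X (n + p)) \<le> 2 * rad (T n)" for n p
  proof (induction p arbitrary: n)
    case 0
    show ?case using constants_pos(4)[of "T n"] by simp
  next
    case (Suc p)
    have "dist (X n) (X (n + Suc p)) \<le> dist (X n) (X (Suc n)) + dist (X (Suc n)) (X (Suc n + p))"
      by (simp add: dist_triangle)
    also have "\<dots> \<le> rad (T n) + 2 * rad (T (Suc n))" using X(2)[of n] Suc[of "Suc n"] by simp
    also have "\<dots> \<le> 2 * rad (T n)" using rad_half[of "T n"] by (simp add: T(2))
    finally show ?case .
  qed
  have rT: "rad (T n) \<le> rad t0 * (1 / 2) ^ n" for n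
  proof (induction n)
    case 0
    show ?case by (simp add: T_def)
  next
    case (Suc n)
    then show ?case using rad_half[of "T n"] by (simp add: T(2))
  qed
  have "(\<lambda>n. 2 * (rad t0 * (1 / 2) ^ n)) \<longlonglongrightarrow> 2 * (rad t0 * 0)"
    by (intro tendsto_intros LIMSEQ_power_zero) auto
  then have lim0: "(\<lambda>n. 2 * (rad t0 * (1 / 2) ^ n)) \<longlonglongrightarrow> 0" by simp
  have "Cauchy X"
  proof (rule metric_CauchyI)
    fix e :: real assume "0 < e"
    then obtain M0 where M0: "\<And>n. M0 \<le> n \<Longrightarrow> 2 * (rad t0 * (1 / 2) ^ n) < e / 2"
      using order_tendstoD(2)[OF lim0, of "e / 2"] by (auto simp: eventually_sequentially)
    have "dist (X n) (X M0) < e / 2" if "M0 \<le> n" for n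
    proof -
      have "dist (X M0) (X (M0 + (n - M0))) \<le> 2 * rad (T M0)" by (rule d)
      also have "\<dots> \<le> 2 * (rad t0 * (1 / 2) ^ M0)" using rT[of M0] by simp
      also have "\<dots> < e / 2" by (rule M0) simp
      finally show ?thesis using that by (simp add: dist_commute)
    qed
    then have "dist (X a) (X b) < e" if "M0 \<le> a" "M0 \<le> b" for a b
      using that by (metis dist_triangle_half_l)
    then show "\<exists>M. \<forall>m\<ge>M. \<forall>n\<ge>M. dist (X m) (X n) < e" by blast
  qed
  then obtain x where x: "X \<longlonglongrightarrow> x" by (auto simp: Cauchy_convergent_iff convergent_def)
  have "x \<in> measure_support \<mu>"
    using closed_sequentially[OF closed_measure_support _ x] X(1) by (auto simp: good_def)
  moreover have "dist (X n) x \<le> 2 * rad (T n)" for n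
  proof (rule LIMSEQ_le_const2)
    show "(\<lambda>p. dist (X n) (X (n + p))) \<longlonglongrightarrow> dist (X n) x"
      by (intro tendsto_dist tendsto_const) (use LIMSEQ_ignore_initial_segment[OF x, of n] in \<open>simp add: add.commute\<close>)
  qed (use d in auto)
  ultimately show ?thesis using X(1) unfolding T_def by blast
qed

text \<open>Diophantine approximation concerns only vectors, and only \<open>s = 0\<close>, where
  the second flow disappears; one coordinate must carry its share of the norm.\<close>

lemma bounded_below_rank_1:
  assumes z: "z \<in> int_lattice A" "z \<noteq> 0" and b: "bounded_below t x 1 0 b"
  shows "\<exists>x'\<in>cball x (rad t). \<exists>k\<in>A. b / real CARD('d option) \<le> \<bar>exp (rate t 0 k) * shear1 x' z $ k\<bar>"
proof -
  have "norm (wedge [z]) \<noteq> 0" using z by (simp add: norm_wedge_single)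
  then have "wedge [z] \<in> dec 1" using z by (auto simp: dec_def intro!: exI[of _ "[z]"])
  then obtain x' where x': "x' \<in> cball x (rad t)" "b \<le> norm (\<Phi> t 0 x' (wedge [z]))"
    using b by (auto simp: bounded_below_def)
  let ?v = "act1 t 0 x' z"
  have "b \<le> norm ?v" using x'(2) by (simp add: \<Phi>_wedge norm_wedge_single)
  also have "\<dots> \<le> (\<Sum>k\<in>UNIV. \<bar>?v $ k\<bar>)" by (rule norm_le_l1_cart)
  also have "\<dots> = (\<Sum>k\<in>A. \<bar>?v $ k\<bar>)"
  proof (rule sum.mono_neutral_right)
    have "?v $ k = 0" if "k \<notin> A" for k
      using that z(1) by (cases k) (auto simp: act1_def shear1_def lift_def A_def int_lattice_def)
    then show "\<forall>k\<in>UNIV - A. \<bar>?v $ k\<bar> = 0" by simp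
  qed auto
  finally have sum: "b \<le> (\<Sum>k\<in>A. \<bar>?v $ k\<bar>)" .
  have "\<exists>k\<in>A. b / real CARD('d option) \<le> \<bar>?v $ k\<bar>"
  proof (rule ccontr)
    assume "\<not> ?thesis"
    then have lt: "\<And>k. k \<in> A \<Longrightarrow> \<bar>?v $ k\<bar> < b / real CARD('d option)" by (auto simp: not_le)
    have ne: "A \<noteq> {}" by (simp add: A_def)
    then obtain k0 where "k0 \<in> A" by auto
    with lt have "0 < b / real CARD('d option)" by (metis abs_ge_zero le_less_trans)
    have "(\<Sum>k\<in>A. \<bar>?v $ k\<bar>) < (\<Sum>k\<in>A. b / real CARD('d option))"
      using lt ne by (intro sum_strict_mono) auto
    also have "\<dots> = real (card A) * (b / real CARD('d option))" by simp
    also have "\<dots> \<le> real CARD('d option) * (b / real CARD('d option))"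
      using \<open>0 < b / _\<close> by (intro mult_right_mono of_nat_mono card_mono) auto
    also have "\<dots> = b" by simp
    finally show False using sum by simp
  qed
  then show ?thesis using x'(1) by (auto simp: act1_def)
qed

lemma good_bounded_below:
  assumes "good t x"
  shows "bounded_below t x 1 0 (\<epsilon> ^ m)"
proof -
  obtain b where b: "\<forall>j\<in>{1..m}. \<forall>l. 0 < b j l \<and> bounded_below t x j l (b j l)"
    and sum: "(\<Sum>j\<in>{1..m}. \<Sum>l. ennreal ((e j l / b j l) powr \<gamma>)) \<le> 1"
    using assms unfolding good_def by blast
  have b1: "0 < b 1 0" "bounded_below t x 1 0 (b 1 0)" using b m_pos by auto
  have "e 1 0 \<le> b 1 0" using sum m_pos b1(1) by (intro lower_bound_of_sum[where b = b]) auto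
  moreover have "e 1 0 = \<epsilon> ^ m" by (simp add: e_def u_def q_def)
  ultimately show ?thesis using b1(2) unfolding bounded_below_def by (metis order_trans)
qed

lemma limit_badly_approximable:
  fixes X x
  assumes X: "\<And>n. good (t0 + real n * \<Delta>) (X n)" "\<And>n. dist (X n) x \<le> 2 * rad (t0 + real n * \<Delta>)"
  shows "x \<in> Bad w"
proof -
  define T where "T n = t0 + real n * \<Delta>" for n
  define a where "a = \<epsilon> ^ m / real CARD('d option)"
  \<comment> \<open>Bounds \<open>exp (T n)\<close> by a multiple of the denominator at the time
    chosen below: the first entry by minimality of \<open>n\<close>, the second if already
    \<open>n = 0\<close> qualifies.\<close>
  define Y where "Y = max (6 * exp \<Delta> / a) (exp t0)"
  have a: "0 < a" using \<epsilon> by (simp add: a_def)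
  have Y1: "1 \<le> Y" using t0 by (simp add: Y_def le_max_iff_disj)
  have T0: "0 \<le> T n" for n using t0 \<Delta> by (simp add: T_def)
  have "\<exists>i. a / (2 * Y) / real Q powr (1 + w $ i) \<le> \<bar>x $ i - of_int (p $ i) / real Q\<bar>"
    if Q: "0 < Q" for Q :: nat and p :: "int ^ 'd"
  proof -
    have Q1: "1 \<le> real Q" using Q by simp
    \<comment> \<open>The first time at which the denominator has contracted below
      \<open>a / 6\<close>. This excludes \<open>k = None\<close>, and it leaves half of
      \<open>a\<close> after \<open>x'\<close> is replaced by \<open>x\<close>, which is within
      three radii.\<close>
    obtain n where n: "6 * real Q * exp (- T n) < a" "exp (T n) \<le> Y * real Q"
    proof -
      have ex: "\<exists>n. 6 * real Q * exp (- T n) < a"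
      proof -
        obtain n where "ln (6 * real Q / a) < real n * \<Delta>" using reals_Archimedean3[OF \<Delta>(1)] by blast
        then have "ln (6 * real Q / a) < T n" using t0 by (simp add: T_def)
        then have "exp (ln (6 * real Q / a)) < exp (T n)" by (simp only: exp_less_mono)
        then have "6 * real Q / a < exp (T n)" using Q a by simp
        then have "6 * real Q * exp (- T n) < a" using a by (simp add: exp_minus field_simps)
        then show ?thesis by blast
      qed
      define n where "n = (LEAST n. 6 * real Q * exp (- T n) < a)"
      have n: "6 * real Q * exp (- T n) < a" unfolding n_def using ex by (rule LeastI_ex)
      have "exp (T n) \<le> Y * real Q"
      proof (cases n)
        case 0
        have "exp t0 * 1 \<le> Y * real Q" using Q1 Y1 by (intro mult_mono) (auto simp: Y_def)
        then show ?thesis using 0 by (simp add: T_def)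
      next
        case (Suc n')
        then have "\<not> 6 * real Q * exp (- T n') < a" 
          using not_less_Least[of n' "\<lambda>n. 6 * real Q * exp (- T n) < a"] unfolding n_def by simp
        then have "exp (T n') \<le> 6 * real Q / a" using a by (simp add: exp_minus field_simps)
        moreover have "exp (T n) = exp \<Delta> * exp (T n')" using Suc by (simp add: T_def algebra_simps flip: exp_add)
        ultimately have "exp (T n) \<le> exp \<Delta> * (6 * real Q / a)"
          by (simp only: mult_left_mono exp_ge_zero)
        also have "\<dots> = 6 * exp \<Delta> / a * real Q" by simp
        also have "\<dots> \<le> Y * real Q" by (intro mult_right_mono) (auto simp: Y_def)
        finally show ?thesis .
      qed
      then show ?thesis using that n by blast
    qed
    define z where "z = (\<chi> k. case k of None \<Rightarrow> real Q | Some i \<Rightarrow> if i \<in> S then - of_int (p $ i) else 0)"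
    have z: "z \<in> int_lattice A" by (auto simp: int_lattice_def z_def A_def split: option.splits)
    have "z $ None \<noteq> 0" using Q by (simp add: z_def)
    then have "z \<noteq> 0" by auto
    from bounded_below_rank_1[OF z this good_bounded_below[OF X(1)]]
    obtain x' k where x': "x' \<in> cball (X n) (rad (T n))" and k: "k \<in> A"
      and big: "a \<le> \<bar>exp (rate (T n) 0 k) * shear1 x' z $ k\<bar>"
      unfolding a_def T_def by blast
    have "k \<noteq> None"
    proof
      assume "k = None"
      then have "a \<le> exp (- T n) * real Q" using big by (simp add: rate_def shear1_def lift_def z_def abs_mult)
      moreover have "0 \<le> exp (- T n) * real Q" by simp
      moreover have "6 * real Q * exp (- T n) = 6 * (exp (- T n) * real Q)" by simp
      ultimately show False using n(1) by linarith
    qed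
    then obtain i where i: "k = Some i" "i \<in> S" using k by (auto simp: A_def)
    have big': "a \<le> exp (w $ i * T n) * \<bar>real Q * x' $ i - of_int (p $ i)\<bar>"
      using big i by (simp add: rate_def shear1_def lift_def z_def abs_mult split: if_splits)
    have "dist x' x \<le> dist (X n) x' + dist (X n) x" by (metis dist_commute dist_triangle)
    then have "dist x' x \<le> 3 * rad (T n)" using x' X(2)[of n] by (simp add: T_def)
    then have xi: "\<bar>x' $ i - x $ i\<bar> \<le> 3 * rad (T n)"
      using dist_vec_nth_le[of x' i x] by (simp add: dist_real_def)
    have "\<bar>real Q * x' $ i - of_int (p $ i)\<bar> \<le> \<bar>real Q * x $ i - of_int (p $ i)\<bar> + real Q * \<bar>x' $ i - x $ i\<bar>"
    proof -
      have "real Q * x' $ i - of_int (p $ i) = (real Q * x $ i - of_int (p $ i)) + real Q * (x' $ i - x $ i)"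
        by (simp add: algebra_simps)
      then show ?thesis by (metis abs_mult abs_of_nat abs_triangle_ineq)
    qed
    also have "\<dots> \<le> \<bar>real Q * x $ i - of_int (p $ i)\<bar> + real Q * (3 * rad (T n))"
      using xi by (intro add_left_mono mult_left_mono) auto
    finally have "a \<le> exp (w $ i * T n) * (\<bar>real Q * x $ i - of_int (p $ i)\<bar> + real Q * (3 * rad (T n)))"
      using big' by (meson exp_ge_zero mult_left_mono order_trans)
    also have "\<dots> = exp (w $ i * T n) * \<bar>real Q * x $ i - of_int (p $ i)\<bar> + 3 * real Q * (exp (w $ i * T n) * rad (T n))"
      by (simp add: algebra_simps)
    \<comment> \<open>The radius shrinks according to the maximal weight, so the displacement is
      harmless in every coordinate.\<close>
    also have "exp (w $ i * T n) * rad (T n) \<le> exp (- T n)"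
    proof -
      have "w $ i * T n \<le> w $ \<iota> * T n" using max_weight T0 by (intro mult_right_mono) auto
      then show ?thesis unfolding rad_def by (simp add: algebra_simps flip: exp_add)
    qed
    finally have "a \<le> exp (w $ i * T n) * \<bar>real Q * x $ i - of_int (p $ i)\<bar> + 3 * real Q * exp (- T n)"
      using Q by simp
    then have half: "a / 2 \<le> exp (w $ i * T n) * \<bar>real Q * x $ i - of_int (p $ i)\<bar>" using n(1) by linarith
    have "exp (w $ i * T n) = exp (T n) powr (w $ i)" by (simp add: powr_def mult.commute)
    also have "\<dots> \<le> (Y * real Q) powr (w $ i)" using n(2) w_nonneg by (intro powr_mono2) auto
    also have "\<dots> = Y powr (w $ i) * real Q powr (w $ i)" by (rule powr_mult)
    also have "\<dots> \<le> Y * real Q powr (w $ i)"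
    proof (rule mult_right_mono)
      have "w $ i \<le> 1" using max_weight[of i] w\<iota>_le_1 by simp
      then have "Y powr (w $ i) \<le> Y powr 1" using Y1 by (intro powr_mono) auto
      then show "Y powr (w $ i) \<le> Y" using Y1 by simp
    qed simp
    finally have "exp (w $ i * T n) * \<bar>real Q * x $ i - of_int (p $ i)\<bar>
      \<le> Y * real Q powr (w $ i) * \<bar>real Q * x $ i - of_int (p $ i)\<bar>" by (intro mult_right_mono) auto
    with half have h2: "a / 2 \<le> Y * real Q powr (w $ i) * \<bar>real Q * x $ i - of_int (p $ i)\<bar>" by simp
    have "\<bar>real Q * x $ i - of_int (p $ i)\<bar> = real Q * \<bar>x $ i - of_int (p $ i) / real Q\<bar>"
    proof -
      have "real Q * x $ i - of_int (p $ i) = real Q * (x $ i - of_int (p $ i) / real Q)"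
        using Q by (simp add: field_simps)
      then show ?thesis by (simp only: abs_mult abs_of_nat)
    qed
    with h2 have "a / 2 \<le> Y * real Q powr (1 + w $ i) * \<bar>x $ i - of_int (p $ i) / real Q\<bar>"
      using Q by (simp add: powr_add mult_ac)
    then have "a / (2 * Y) / real Q powr (1 + w $ i) \<le> \<bar>x $ i - of_int (p $ i) / real Q\<bar>"
      using Y1 Q by (simp add: field_simps)
    then show ?thesis by blast
  qed
  moreover have "0 < a / (2 * Y)" using a Y1 by simp
  ultimately show ?thesis unfolding Bad_def by blast
qed

end

section \<open>Choice of the constants\<close>

lemma powr_le_of_le_root:
  fixes x y g :: real
  assumes "0 \<le> x" "0 < y" "0 < g" "x \<le> y powr (1 / g)"
  shows "x powr g \<le> y"
proof -
  have "x powr g \<le> (y powr (1 / g)) powr g" using assms by (intro powr_mono2) auto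
  also have "\<dots> = y" using assms by (simp add: powr_powr)
  finally show ?thesis .
qed

theorem theorem1p3:
  fixes w :: "real ^ 'd" and \<mu> :: "(real ^ 'd) measure"
  assumes "w \<in> weights"
    and "sets \<mu> = sets borel"
    and "emeasure \<mu> UNIV \<noteq> 0"
    and "compact (measure_support \<mu>)"
    and "Ahlfors_regular \<mu>"
    and "absolutely_decaying \<mu>"
  shows "Bad w \<inter> measure_support \<mu> \<noteq> {}"
proof -
  obtain \<iota> where \<iota>: "\<And>i. w $ i \<le> w $ \<iota>"
    using Max_in[of "range (\<lambda>i. w $ i)"] Max_ge[of "range (\<lambda>i. w $ i)"] by fastforce
  interpret weighted_flow w \<iota> using assms(1) \<iota> by unfold_locales
  obtain \<alpha> a \<rho>0 where \<rho>0: "0 < \<rho>0"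
    and ahl: "\<And>x r. x \<in> measure_support \<mu> \<Longrightarrow> 0 < r \<Longrightarrow> r \<le> \<rho>0 \<Longrightarrow> emeasure \<mu> (cball x r) \<le> ennreal (a * r powr \<alpha>)"
    using assms(5) unfolding Ahlfors_regular_def alpha_Ahlfors_regular_def by blast
  obtain D \<delta> r0 where D: "0 < D" and \<delta>: "0 < \<delta>" and r0: "0 < r0"
    and dec: "\<forall>x\<in>measure_support \<mu>. \<forall>r. 0 < r \<and> r \<le> r0 \<longrightarrow> (\<forall>H. hyperplane H \<longrightarrow> (\<forall>r'>0.
      emeasure \<mu> (closed_nbhd H r' \<inter> cball x r) \<le> ennreal (D * (r' / r) powr \<delta>) * emeasure \<mu> (cball x r)))"
    using assms(6) unfolding absolutely_decaying_def by blast
  define \<rho> where "\<rho> = min \<rho>0 r0"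
  have \<rho>: "0 < \<rho>" using \<rho>0 r0 by (simp add: \<rho>_def)
  interpret decaying_measure \<mu> D \<delta> \<rho>
  proof
    show "emeasure \<mu> (cball x r) < top" if "x \<in> measure_support \<mu>" "0 < r" "r \<le> \<rho>" for x r
      using ahl[OF that(1,2)] that(3) by (auto simp: \<rho>_def intro: le_less_trans)
  qed (use assms(2) D \<delta> \<rho> dec in \<open>auto simp: \<rho>_def\<close>)
  define N where "N = real CARD('d option set)"
  have N: "1 \<le> N" unfolding N_def using zero_less_card_finite[where 'a = "'d option set"] by linarith
  define g where "g = \<delta> / 2"
  have g: "0 < g" using \<delta> by (simp add: g_def)
  define k where "k = nat \<lceil>4 / wmin\<rceil>"
  have "4 / wmin \<le> real k" unfolding k_def by linarith
  then have k: "4 \<le> real k * wmin" using wmin_pos by (simp add: pos_divide_le_eq)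
  then have k0: "0 < real k" using wmin_pos by (cases k) auto
  define c where "c = wmin / k"
  have c: "0 < c" using k0 wmin_pos by (simp add: c_def)
  \<comment> \<open>Solves \<open>2 * M * (2 * N\<^sup>2 * y) powr g = 1 / 2\<close>; \<Delta> is
    then taken so large that \<open>exp (- c * \<Delta> / 2)\<close> is at most
    \<open>y\<close>.\<close>
  define y where "y = (1 / (4 * M)) powr (1 / g) / (2 * N\<^sup>2)"
  have y: "0 < y" using M_pos N by (simp add: y_def)
  define \<Delta> where "\<Delta> = max 1 (- (2 / c) * ln y)"
  have \<Delta>: "0 < \<Delta>" "exp (- \<Delta>) \<le> 1 / 2"
  proof -
    show "0 < \<Delta>" by (simp add: \<Delta>_def)
    have "2 \<le> exp (1 :: real)" using exp_ge_add_one_self[of 1] by simp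
    also have "\<dots> \<le> exp \<Delta>" by (simp add: \<Delta>_def)
    finally show "exp (- \<Delta>) \<le> 1 / 2" by (simp add: exp_minus field_simps)
  qed
  have \<Gamma>: "2 * M * (2 * N\<^sup>2 * exp (- c * \<Delta> / 2)) powr g \<le> 1 / 2"
  proof -
    have "- (2 / c) * ln y \<le> \<Delta>" by (simp add: \<Delta>_def)
    then have "- c * \<Delta> / 2 \<le> ln y" using c by (simp add: field_simps)
    then have "exp (- c * \<Delta> / 2) \<le> exp (ln y)" by (simp only: exp_le_cancel_iff)
    then have "2 * N\<^sup>2 * exp (- c * \<Delta> / 2) \<le> 2 * N\<^sup>2 * y" using N y by (intro mult_left_mono) auto
    also have "\<dots> = (1 / (4 * M)) powr (1 / g)" using N by (simp add: y_def)
    finally have "(2 * N\<^sup>2 * exp (- c * \<Delta> / 2)) powr g \<le> 1 / (4 * M)"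
      using M_pos g N by (intro powr_le_of_le_root) auto
    then have "2 * M * (2 * N\<^sup>2 * exp (- c * \<Delta> / 2)) powr g \<le> 2 * M * (1 / (4 * M))"
      using M_pos by (intro mult_left_mono) auto
    then show ?thesis using M_pos by simp
  qed
  define \<kappa> where "\<kappa> = c / (4 * (real m + 1)\<^sup>2) * (\<Delta> / k)"
  have \<kappa>: "0 < \<kappa>" using c \<Delta> k0 by (simp add: \<kappa>_def)
  define p1 where "p1 = 1 - exp (- \<kappa> / 2 * g)"
  define p2 where "p2 = 1 - exp (- \<kappa> * g)"
  have p: "0 < p1" "0 < p2" using \<kappa> g by (simp_all add: p1_def p2_def)
  have m: "0 < real m" using m_pos by simp
  \<comment> \<open>Solves \<open>real m * (\<Theta> powr - g / p1) = 1 / 4\<close>.\<close>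
  define \<Theta> where "\<Theta> = (4 * real m / p1) powr (1 / g)"
  have \<Theta>: "0 < \<Theta>" using m p by (simp add: \<Theta>_def)
  have \<Theta>': "real m * (\<Theta> powr - g / p1) \<le> 1 / 4"
  proof -
    have "\<Theta> powr - g = inverse (4 * real m / p1)"
      using g m p by (simp add: \<Theta>_def powr_powr powr_minus)
    then show ?thesis using m p by (simp add: field_simps)
  qed
  define t0 where "t0 = max 0 (- ln \<rho>)"
  have t0: "0 \<le> t0" "exp (- (1 + w $ \<iota>) * t0) \<le> \<rho>"
  proof -
    show 0: "0 \<le> t0" by (simp add: t0_def)
    have "- (1 + w $ \<iota>) * t0 \<le> - t0" using 0 w_nonneg[of \<iota>] by (simp add: algebra_simps)
    also have "\<dots> \<le> ln \<rho>" by (simp add: t0_def)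
    finally have "exp (- (1 + w $ \<iota>) * t0) \<le> exp (ln \<rho>)" by (simp only: exp_le_cancel_iff)
    then show "exp (- (1 + w $ \<iota>) * t0) \<le> \<rho>" using \<rho> by simp
  qed
  define r where "r = exp (- (1 + w $ \<iota>) * t0)"
  define d where "d = exp \<Delta> * (1 + 4 * exp ((1 + w $ \<iota>) * \<Delta>)) * \<Theta>"
  have d: "0 < d" using \<Theta> by (simp add: d_def add_pos_pos)
  define l where "l = min 1 ((1 / (4 * C)) powr (1 / \<delta>) / N)"
  have l: "0 < l" using C_pos N by (simp add: l_def)
  \<comment> \<open>The 2 in \<open>l / (2 * d)\<close> makes the uniqueness condition strict; the
    last entry turns the initial condition into an equality.\<close>
  define \<epsilon> where "\<epsilon> = min 1 (min (l / (2 * d)) (r / 2 * (p2 / real m) powr (1 / g)))"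
  have \<epsilon>: "0 < \<epsilon>" "\<epsilon> \<le> 1" using l d p m by (simp_all add: \<epsilon>_def r_def)
  have \<epsilon>d: "\<epsilon> * d < l"
  proof -
    have "\<epsilon> \<le> l / (2 * d)" by (simp add: \<epsilon>_def)
    then have "\<epsilon> * d \<le> l / (2 * d) * d" using d by (intro mult_right_mono) auto
    also have "\<dots> < l" using d l by simp
    finally show ?thesis .
  qed
  have \<epsilon>r: "real m * ((2 * \<epsilon> / r) powr g / p2) \<le> 1"
  proof -
    have "\<epsilon> \<le> r / 2 * (p2 / real m) powr (1 / g)" by (simp add: \<epsilon>_def)
    then have "2 * \<epsilon> / r \<le> (p2 / real m) powr (1 / g)" by (simp add: r_def field_simps)
    then have "(2 * \<epsilon> / r) powr g \<le> p2 / real m"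
      using \<epsilon> p m g by (intro powr_le_of_le_root) (auto simp: r_def)
    then show ?thesis using m p by (simp add: field_simps)
  qed
  interpret bad_construction w \<iota> \<mu> D \<delta> \<rho> k \<Delta> \<Theta> \<epsilon> t0
  proof
    show "4 \<le> real k * wmin" by (rule k)
    show "0 < \<Delta>" "exp (- \<Delta>) \<le> 1 / 2" by (rule \<Delta>)+
    show "0 < \<Theta>" by (rule \<Theta>)
    show "0 < \<epsilon>" "\<epsilon> \<le> 1" by (rule \<epsilon>)+
    show "0 \<le> t0" "exp (- (1 + w $ \<iota>) * t0) \<le> \<rho>" by (rule t0)+
    show "2 * M * (2 * (real CARD('d option set))\<^sup>2 * exp (- (wmin / k) * \<Delta> / 2)) powr (\<delta> / 2) \<le> 1 / 2"
      using \<Gamma> unfolding N_def c_def g_def .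
    show "real m * (\<Theta> powr - (\<delta> / 2)
      / (1 - exp (- (wmin / k / (4 * (real m + 1)\<^sup>2)) * (\<Delta> / k) / 2 * (\<delta> / 2)))) \<le> 1 / 4"
      using \<Theta>' unfolding p1_def \<kappa>_def c_def g_def mult_minus_left .
    show "\<epsilon> * (exp \<Delta> * (1 + 4 * exp ((1 + w $ \<iota>) * \<Delta>)) * \<Theta>)
        < min 1 ((1 / (4 * C)) powr (1 / \<delta>) / real CARD('d option set))"
      using \<epsilon>d unfolding d_def l_def N_def .
    show "real m * ((2 * \<epsilon> / exp (- (1 + w $ \<iota>) * t0)) powr (\<delta> / 2)
        / (1 - exp (- (wmin / k / (4 * (real m + 1)\<^sup>2)) * (\<Delta> / k) * (\<delta> / 2)))) \<le> 1"
      using \<epsilon>r unfolding p2_def \<kappa>_def c_def g_def r_def mult_minus_left .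
  qed
  obtain x X where x: "x \<in> measure_support \<mu>" "\<forall>n. good (t0 + real n * \<Delta>) (X n)"
    "\<forall>n. dist (X n) x \<le> 2 * rad (t0 + real n * \<Delta>)"
    using good_limit[OF measure_support_nonempty[OF assms(2,3)]] by (elim bexE exE conjE)
  have "x \<in> Bad w" using x(2,3) by (intro limit_badly_approximable[of X x]) simp_all
  then show ?thesis using x(1) by blast
qed

end
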